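(* Let $n\in\mathbb N$, let $\mathbf F\in L_{1+\frac1n}(\Omega)^{d\times d}_{\rm sym}$, and let $\lambda,\mu$ satisfy (A1)--(A4). Suppose in addition that there exist $\beta\in(0,1]$ and $\Lambda>0$ such that $$|\lambda(r)r-\lambda(s)s|\le\Lambda|r-s|^\beta\ \ \forall\,r,s\in\mathbb R,\qquad \big|\mu(|\mathbf R|)\mathbf R-\mu(|\mathbf S|)\mathbf S\big|\le\Lambda|\mathbf R-\mathbf S|^\beta\ \ \forall\,\mathbf R,\mathbf S\in\mathbb R^{d\times d}_{\rm sym}.$$ Let $(\mathbf T_n,\mathbf u_n)$ be the unique solution of the regularized problem (R$_n$) and $(\mathbf T_{n,h},\mathbf u_{n,h})$ the unique solution of its finite element approximation (R$_{n,h}$). If $n\ge2$, assume that $\mathbf T_n\in L_\infty(\Omega)^{d\times d}_{\rm sym}$. Then there is a constant $C=C(d,\Lambda,\beta,n,\mathrm K_n,\mathrm K)$, depending only on the listed quantities, such that $$\int_\Omega\Phi_n\big(|\mathbf T_{n,h}-\Pi_h\mathbf T_n|\big)\,dx\le C\left(\inf_{\mathbf v_h\in\mathbb X_{n,h}}\int_\Omega\Phi_n^*\big(|\varepsilon(\mathbf v_h-\mathbf u_n)|\big)\,dx+\int_\Omega\Phi_n^*\big(|\mathbf T_n-\Pi_h\mathbf T_n|^{\min(\beta,\frac1n)}\big)\,dx\right).$$ When $n=1$ the inequality holds without the assumption $\mathbf T_n\in L_\infty(\Omega)^{d\times d}_{\rm sym}$ (in which case $\mathrm K_1$ is omitted from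 the quantities on which $C$ depends).
   Context: $\Omega\subset\mathbb R^d$, $d\in\{2,3\}$, is a bounded polygonal domain ($d=2$) or bounded Lipschitz polyhedral domain ($d=3$). $\mathbb N=\{1,2,\dots\}$. The subscript "sym" denotes symmetric $d\times d$ tensors; $\mathbf S:\mathbf T=\sum_{i,j}S_{ij}T_{ij}$, $|\mathbf S|^2=\mathbf S:\mathbf S$; $\mathbf S^{\mathbf d}=\mathbf S-\frac1d\mathrm{Tr}(\mathbf S)\mathbf I$; $\varepsilon(\mathbf v)=\frac12(\nabla\mathbf v+(\nabla\mathbf v)^{\rm T})$. Assumptions on the material functions: $\lambda\in\mathcal C^0(\mathbb R)$, $\mu\in\mathcal C^0([0,\infty))$, $s\mapsto\lambda(s)s\in\mathcal C^1(\mathbb R)$, and there are positive constants $C_1,C_2,\kappa,\alpha$ such that (A1) $\frac{C_1s^2}{\kappa+|s|}\le\lambda(s)s^2\le C_2|s|$ for all $s\in\mathbb R$; (A2) $\frac{C_1s^2}{\kappa+s}\le\mu(s)s^2\le C_2s$ for all $s\ge0$; (A3) $0\le\frac{d}{ds}(\lambda(s)s)$ for all $s\in\mathbb R$; (A4) $\frac{C_1}{(\kappa+s)^{\alpha+1}}\le\frac{d}{ds}(\mu(s)s)$ for all $s>0$. Regularized problem (R$_n$): with $\mathbb M_n=L_{1+\frac1n}(\Omega)^{d\times d}_{\rm sym}$, $\mathbb X_n=W^{1,n+1}_0(\Omega)^d$, and $$a_n(\mathbf T,\mathbf S)=\frac1n\int_\Omega\Big(\frac{\mathrm{Tr}(\mathbf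 T)\mathbf I}{|\mathrm{Tr}(\mathbf T)|^{1-\frac1n}}+\frac{\mathbf T^{\mathbf d}}{|\mathbf T^{\mathbf d}|^{1-\frac1n}}\Big):\mathbf S\,dx,$$ $$c(\mathbf T;\mathbf R,\mathbf S)=\int_\Omega\big(\lambda(\mathrm{Tr}(\mathbf T))\mathrm{Tr}(\mathbf R)\mathbf I+\mu(|\mathbf T^{\mathbf d}|)\mathbf R^{\mathbf d}\big):\mathbf S\,dx,\qquad b(\mathbf S,\mathbf v)=\int_\Omega\mathbf S:\varepsilon(\mathbf v)\,dx$$ (quotients $x/|x|^{1-1/n}$ are understood as $0$ when $x=0$), find $(\mathbf T_n,\mathbf u_n)\in\mathbb M_n\times\mathbb X_n$ with $$a_n(\mathbf T_n,\mathbf S)+c(\mathbf T_n;\mathbf T_n,\mathbf S)-b(\mathbf S,\mathbf u_n)=0\ \ \forall\,\mathbf S\in\mathbb M_n,\qquad b(\mathbf T_n,\mathbf v)=\int_\Omega\mathbf F:\varepsilon(\mathbf v)\,dx\ \ \forall\,\mathbf v\in\mathbb X_n.$$ Discretization (R$_{n,h}$): $(\mathcal T_h)_{h\in(0,1]}$ is a family of (conforming) simplicial subdivisions of $\overline\Omega$ with mesh-size $h=\max_Kh_K$, shape-regular: there is $\eta>0$ independent of $h$ with $h_K/\varrho_K\le\eta$ for all closed simplices $K\in\mathcal T_h$, where $h_K$ is the diameter of $K$ and $\varrho_K$ the diameter of its largest inscribed ball. $\mathbb M_{n,h}$ is the space of symmetric $d\times d$ tensor fields that are constant on each $K\in\mathcal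 T_h$; $\mathbb X_{n,h}$ is the space of continuous $\mathbb R^d$-valued functions on $\overline\Omega$ that are affine on each $K\in\mathcal T_h$ and vanish on $\partial\Omega$. Find $(\mathbf T_{n,h},\mathbf u_{n,h})\in\mathbb M_{n,h}\times\mathbb X_{n,h}$ with $$a_n(\mathbf T_{n,h},\mathbf S_h)+c(\mathbf T_{n,h};\mathbf T_{n,h},\mathbf S_h)-b(\mathbf S_h,\mathbf u_{n,h})=0\ \ \forall\,\mathbf S_h\in\mathbb M_{n,h},\qquad b(\mathbf T_{n,h},\mathbf v_h)=\int_\Omega\mathbf F:\varepsilon(\mathbf v_h)\,dx\ \ \forall\,\mathbf v_h\in\mathbb X_{n,h}.$$ Both (R$_n$) and (R$_{n,h}$) have exactly one solution. $\Pi_h$ is the componentwise elementwise mean: $\Pi_hf|_K=\frac1{|K|}\int_Kf\,dx$ for $K\in\mathcal T_h$. $\Phi_n(s)=\frac{s^2}{(1+s)^{1-\frac1n}}$ for $s\in[0,\infty)$; $\Phi_n^*(s)=\sup_{t\ge0}(st-\Phi_n(t))$ for $s\in[0,\infty)$ is its convex conjugate. $\mathrm K_n=\max(1,\|\mathbf T_n\|_{L_\infty(\Omega)})$. $\mathrm K=\mathrm K(n)>2$ is a constant, depending only on $n$, such that $\Phi_n^*(2s)\le\mathrm K\,\Phi_n^*(s)$ for all $s\in[0,\infty)$ (such a constant exists). *)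

theory Defs
  imports "HOL-Analysis.Analysis" "HOL-Probability.Essential_Supremum"
begin

section \<open>Tensors\<close>

text \<open>A \<open>d \<times> d\<close> tensor is an element of \<open>real ^ 'd ^ 'd\<close>. On this type the library's \<open>norm\<close> and
  inner product are the Frobenius ones, i.e. \<open>|S|\<close> and \<open>S : T\<close>.\<close>

definition dev :: "real ^ 'd ^ 'd \<Rightarrow> real ^ 'd ^ 'd" where
  "dev S = S - (trace S / real CARD('d)) *\<^sub>R mat 1"

definition sym_tensor :: "real ^ 'd ^ 'd \<Rightarrow> bool" where
  "sym_tensor S \<longleftrightarrow> transpose S = S"


section \<open>Domains\<close>

definition lipschitz_boundary :: "'a::euclidean_space set \<Rightarrow> bool" where
  "lipschitz_boundary \<Omega> \<longleftrightarrow>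
     (\<forall>x \<in> frontier \<Omega>. \<exists>U e L g. open U \<and> x \<in> U \<and> norm e = 1 \<and>
        L-lipschitz_on {y. y \<bullet> e = 0} g \<and>
        \<Omega> \<inter> U = {y \<in> U. y \<bullet> e < g (y - (y \<bullet> e) *\<^sub>R e)})"

definition polyhedral_boundary :: "'a::euclidean_space set \<Rightarrow> bool" where
  "polyhedral_boundary \<Omega> \<longleftrightarrow>
     (\<exists>\<P>. finite \<P> \<and> (\<forall>P \<in> \<P>. polytope P \<and> aff_dim P = int DIM('a) - 1) \<and> frontier \<Omega> = \<Union>\<P>)"

definition admissible_domain :: "(real ^ 'd) set \<Rightarrow> bool" where
  "admissible_domain \<Omega> \<longleftrightarrow>
     open \<Omega> \<and> connected \<Omega> \<and> bounded \<Omega> \<and> \<Omega> \<noteq> {} \<and> polyhedral_boundary \<Omega> \<and>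
     (CARD('d) = 3 \<longrightarrow> lipschitz_boundary \<Omega>)"


section \<open>Lebesgue and Sobolev spaces\<close>

text \<open>Elements of function spaces are represented by functions on the whole space, of which only
  the values on \<open>\<Omega>\<close> (up to null sets) matter.\<close>

definition Lp :: "real \<Rightarrow> 'a::euclidean_space set \<Rightarrow> ('a \<Rightarrow> 'b::euclidean_space) set" where
  "Lp p \<Omega> = {f. f \<in> borel_measurable (lebesgue_on \<Omega>) \<and>
                 integrable (lebesgue_on \<Omega>) (\<lambda>x. norm (f x) powr p)}"

definition Linf :: "'a::euclidean_space set \<Rightarrow> ('a \<Rightarrow> 'b::euclidean_space) set" where
  "Linf \<Omega> = {f. f \<in> borel_measurable (lebesgue_on \<Omega>) \<and>
                 esssup (lebesgue_on \<Omega>) (\<lambda>x. ereal (norm (f x))) < \<infinity>}"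

definition Linf_norm :: "'a::euclidean_space set \<Rightarrow> ('a \<Rightarrow> 'b::euclidean_space) \<Rightarrow> real" where
  "Linf_norm \<Omega> f = real_of_ereal (esssup (lebesgue_on \<Omega>) (\<lambda>x. ereal (norm (f x))))"

primrec C_k :: "nat \<Rightarrow> ('a::euclidean_space \<Rightarrow> 'b::euclidean_space) \<Rightarrow> bool" where
  "C_k 0 f \<longleftrightarrow> continuous_on UNIV f"
| "C_k (Suc k) f \<longleftrightarrow> (\<forall>x. f differentiable (at x)) \<and>
     (\<forall>i \<in> Basis. C_k k (\<lambda>x. frechet_derivative f (at x) i))"

definition test_function :: "'a::euclidean_space set \<Rightarrow> ('a \<Rightarrow> 'b::euclidean_space) \<Rightarrow> bool" where
  "test_function \<Omega> \<phi> \<longleftrightarrow>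
     (\<forall>k. C_k k \<phi>) \<and> compact (closure {x. \<phi> x \<noteq> 0}) \<and> closure {x. \<phi> x \<noteq> 0} \<subseteq> \<Omega>"

definition locally_integrable_on :: "('a::euclidean_space \<Rightarrow> 'b::euclidean_space) \<Rightarrow> 'a set \<Rightarrow> bool"
  where
  "locally_integrable_on f \<Omega> \<longleftrightarrow> (\<forall>K. compact K \<and> K \<subseteq> \<Omega> \<longrightarrow> integrable (lebesgue_on K) f)"

text \<open>The entry \<open>G $ i $ j\<close> is the weak derivative of \<open>u $ i\<close> in direction \<open>j\<close>.\<close>

definition has_weak_gradient ::
  "(real ^ 'd) set \<Rightarrow> (real ^ 'd \<Rightarrow> real ^ 'd) \<Rightarrow> (real ^ 'd \<Rightarrow> real ^ 'd ^ 'd) \<Rightarrow> bool" where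
  "has_weak_gradient \<Omega> u G \<longleftrightarrow>
     locally_integrable_on u \<Omega> \<and> locally_integrable_on G \<Omega> \<and>
     (\<forall>\<phi> i j. test_function \<Omega> \<phi> \<longrightarrow>
        (LINT x|lebesgue_on \<Omega>. u x $ i * frechet_derivative \<phi> (at x) (axis j 1)) =
        - (LINT x|lebesgue_on \<Omega>. G x $ i $ j * \<phi> x))"

text \<open>Weak gradients are unique up to null sets, so all integrals below are independent of the
  choice made here.\<close>

definition weak_gradient ::
  "(real ^ 'd) set \<Rightarrow> (real ^ 'd \<Rightarrow> real ^ 'd) \<Rightarrow> real ^ 'd \<Rightarrow> real ^ 'd ^ 'd" where
  "weak_gradient \<Omega> u = (SOME G. has_weak_gradient \<Omega> u G)"

definition W1p :: "real \<Rightarrow> (real ^ 'd) set \<Rightarrow> (real ^ 'd \<Rightarrow> real ^ 'd) set" where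
  "W1p p \<Omega> = {u \<in> Lp p \<Omega>. \<exists>G \<in> Lp p \<Omega>. has_weak_gradient \<Omega> u G}"

definition W1p_0 :: "real \<Rightarrow> (real ^ 'd) set \<Rightarrow> (real ^ 'd \<Rightarrow> real ^ 'd) set" where
  "W1p_0 p \<Omega> = {u \<in> W1p p \<Omega>. \<exists>\<phi>. (\<forall>k::nat. test_function \<Omega> (\<phi> k)) \<and>
     (\<lambda>k. LINT x|lebesgue_on \<Omega>. norm (\<phi> k x - u x) powr p) \<longlonglongrightarrow> 0 \<and>
     (\<lambda>k. LINT x|lebesgue_on \<Omega>. norm (jacobian (\<phi> k) (at x) - weak_gradient \<Omega> u x) powr p)
        \<longlonglongrightarrow> 0}"

definition sym_gradient ::
  "(real ^ 'd) set \<Rightarrow> (real ^ 'd \<Rightarrow> real ^ 'd) \<Rightarrow> real ^ 'd \<Rightarrow> real ^ 'd ^ 'd" where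
  "sym_gradient \<Omega> v x = (1 / 2) *\<^sub>R (weak_gradient \<Omega> v x + transpose (weak_gradient \<Omega> v x))"


section \<open>The regularized problem\<close>

definition material_functions :: "(real \<Rightarrow> real) \<Rightarrow> (real \<Rightarrow> real) \<Rightarrow> bool" where
  "material_functions lam mu \<longleftrightarrow>
     continuous_on UNIV lam \<and> continuous_on {0..} mu \<and>
     (\<lambda>s. lam s * s) C1_differentiable_on UNIV \<and>
     (\<exists>C\<^sub>1 C\<^sub>2 \<kappa> \<alpha>. C\<^sub>1 > 0 \<and> C\<^sub>2 > 0 \<and> \<kappa> > 0 \<and> \<alpha> > 0 \<and>
        (\<forall>s. C\<^sub>1 * s\<^sup>2 / (\<kappa> + \<bar>s\<bar>) \<le> lam s * s\<^sup>2 \<and> lam s * s\<^sup>2 \<le> C\<^sub>2 * \<bar>s\<bar>) \<and>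
        (\<forall>s \<ge> 0. C\<^sub>1 * s\<^sup>2 / (\<kappa> + s) \<le> mu s * s\<^sup>2 \<and> mu s * s\<^sup>2 \<le> C\<^sub>2 * s) \<and>
        (\<forall>s. 0 \<le> deriv (\<lambda>t. lam t * t) s) \<and>
        (\<forall>s > 0. (\<lambda>t. mu t * t) differentiable (at s) \<and>
           C\<^sub>1 / (\<kappa> + s) powr (\<alpha> + 1) \<le> deriv (\<lambda>t. mu t * t) s))"

definition hoelder_material :: "real \<Rightarrow> real \<Rightarrow> (real \<Rightarrow> real) \<Rightarrow> (real \<Rightarrow> real) \<Rightarrow> 'd::finite itself \<Rightarrow> bool"
  where
  "hoelder_material \<Lambda> \<beta> lam mu (_ :: 'd itself) \<longleftrightarrow>
     (\<forall>r s. \<bar>lam r * r - lam s * s\<bar> \<le> \<Lambda> * \<bar>r - s\<bar> powr \<beta>) \<and>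
     (\<forall>R S :: real ^ 'd ^ 'd. sym_tensor R \<longrightarrow> sym_tensor S \<longrightarrow>
        norm (mu (norm R) *\<^sub>R R - mu (norm S) *\<^sub>R S) \<le> \<Lambda> * norm (R - S) powr \<beta>)"

definition M_space :: "nat \<Rightarrow> (real ^ 'd) set \<Rightarrow> (real ^ 'd \<Rightarrow> real ^ 'd ^ 'd) set" where
  "M_space n \<Omega> = {T \<in> Lp (1 + 1 / real n) \<Omega>. AE x in lebesgue_on \<Omega>. sym_tensor (T x)}"

definition X_space :: "nat \<Rightarrow> (real ^ 'd) set \<Rightarrow> (real ^ 'd \<Rightarrow> real ^ 'd) set" where
  "X_space n \<Omega> = W1p_0 (real n + 1) \<Omega>"

text \<open>The quotients vanish for vanishing numerators, since division by zero yields zero.\<close>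

definition form_a :: "nat \<Rightarrow> (real ^ 'd) set \<Rightarrow>
    (real ^ 'd \<Rightarrow> real ^ 'd ^ 'd) \<Rightarrow> (real ^ 'd \<Rightarrow> real ^ 'd ^ 'd) \<Rightarrow> real" where
  "form_a n \<Omega> T S = 1 / real n * (LINT x|lebesgue_on \<Omega>.
     ((trace (T x) / \<bar>trace (T x)\<bar> powr (1 - 1 / real n)) *\<^sub>R mat 1
       + dev (T x) /\<^sub>R norm (dev (T x)) powr (1 - 1 / real n)) \<bullet> S x)"

definition form_c :: "(real \<Rightarrow> real) \<Rightarrow> (real \<Rightarrow> real) \<Rightarrow> (real ^ 'd) set \<Rightarrow>
    (real ^ 'd \<Rightarrow> real ^ 'd ^ 'd) \<Rightarrow> (real ^ 'd \<Rightarrow> real ^ 'd ^ 'd) \<Rightarrow>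
    (real ^ 'd \<Rightarrow> real ^ 'd ^ 'd) \<Rightarrow> real" where
  "form_c lam mu \<Omega> T R S = (LINT x|lebesgue_on \<Omega>.
     ((lam (trace (T x)) * trace (R x)) *\<^sub>R mat 1 + mu (norm (dev (T x))) *\<^sub>R dev (R x)) \<bullet> S x)"

definition form_b :: "(real ^ 'd) set \<Rightarrow> (real ^ 'd \<Rightarrow> real ^ 'd ^ 'd) \<Rightarrow>
    (real ^ 'd \<Rightarrow> real ^ 'd) \<Rightarrow> real" where
  "form_b \<Omega> S v = (LINT x|lebesgue_on \<Omega>. S x \<bullet> sym_gradient \<Omega> v x)"

definition solves :: "nat \<Rightarrow> (real \<Rightarrow> real) \<Rightarrow> (real \<Rightarrow> real) \<Rightarrow> (real ^ 'd) set \<Rightarrow>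
    (real ^ 'd \<Rightarrow> real ^ 'd ^ 'd) \<Rightarrow>
    (real ^ 'd \<Rightarrow> real ^ 'd ^ 'd) set \<Rightarrow> (real ^ 'd \<Rightarrow> real ^ 'd) set \<Rightarrow>
    (real ^ 'd \<Rightarrow> real ^ 'd ^ 'd) \<Rightarrow> (real ^ 'd \<Rightarrow> real ^ 'd) \<Rightarrow> bool" where
  "solves n lam mu \<Omega> F M X T u \<longleftrightarrow>
     T \<in> M \<and> u \<in> X \<and>
     (\<forall>S \<in> M. form_a n \<Omega> T S + form_c lam mu \<Omega> T T S - form_b \<Omega> S u = 0) \<and>
     (\<forall>v \<in> X. form_b \<Omega> T v = (LINT x|lebesgue_on \<Omega>. F x \<bullet> sym_gradient \<Omega> v x))"

definition solves_R :: "nat \<Rightarrow> (real \<Rightarrow> real) \<Rightarrow> (real \<Rightarrow> real) \<Rightarrow> (real ^ 'd) set \<Rightarrow>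
    (real ^ 'd \<Rightarrow> real ^ 'd ^ 'd) \<Rightarrow>
    (real ^ 'd \<Rightarrow> real ^ 'd ^ 'd) \<Rightarrow> (real ^ 'd \<Rightarrow> real ^ 'd) \<Rightarrow> bool" where
  "solves_R n lam mu \<Omega> F T u \<longleftrightarrow> solves n lam mu \<Omega> F (M_space n \<Omega>) (X_space n \<Omega>) T u"


section \<open>Discretization\<close>

definition simplicial_mesh :: "(real ^ 'd) set \<Rightarrow> (real ^ 'd) set set \<Rightarrow> bool" where
  "simplicial_mesh \<Omega> \<T> \<longleftrightarrow>
     triangulation \<T> \<and> (\<forall>K \<in> \<T>. int CARD('d) simplex K) \<and> \<Union>\<T> = closure \<Omega>"

definition inball_diameter :: "'a::euclidean_space set \<Rightarrow> real" where
  "inball_diameter K = Sup {2 * r | x r. 0 \<le> r \<and> cball x r \<subseteq> K}"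

text \<open>The family is indexed by a set \<open>H \<subseteq> (0,1]\<close> of mesh-sizes: no mesh of \<open>\<Omega>\<close> has a mesh-size
  exceeding the diameter of \<open>\<Omega>\<close>, so \<open>H = (0,1]\<close> would exclude small domains.\<close>

definition shape_regular_family ::
  "(real ^ 'd) set \<Rightarrow> real set \<Rightarrow> (real \<Rightarrow> (real ^ 'd) set set) \<Rightarrow> bool" where
  "shape_regular_family \<Omega> H \<T> \<longleftrightarrow>
     H \<subseteq> {0<..1} \<and>
     (\<forall>h \<in> H. simplicial_mesh \<Omega> (\<T> h) \<and> h = Max (diameter ` \<T> h)) \<and>
     (\<exists>\<eta> > 0. \<forall>h \<in> H. \<forall>K \<in> \<T> h. diameter K / inball_diameter K \<le> \<eta>)"

text \<open>Closed simplices overlap, so piecewise constancy is required on their interiors only; the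
  values on the (null) faces are irrelevant.\<close>

definition M_disc :: "(real ^ 'd) set set \<Rightarrow> (real ^ 'd \<Rightarrow> real ^ 'd ^ 'd) set" where
  "M_disc \<T> = {S. \<forall>K \<in> \<T>. \<exists>A. sym_tensor A \<and> (\<forall>x \<in> interior K. S x = A)}"

definition X_disc :: "(real ^ 'd) set \<Rightarrow> (real ^ 'd) set set \<Rightarrow> (real ^ 'd \<Rightarrow> real ^ 'd) set" where
  "X_disc \<Omega> \<T> = {v. continuous_on (closure \<Omega>) v \<and>
     (\<forall>K \<in> \<T>. \<exists>(A :: real ^ 'd ^ 'd) b. \<forall>x \<in> K. v x = A *v x + b) \<and>
     (\<forall>x \<in> frontier \<Omega>. v x = 0)}"

definition solves_R_disc :: "nat \<Rightarrow> (real \<Rightarrow> real) \<Rightarrow> (real \<Rightarrow> real) \<Rightarrow> (real ^ 'd) set \<Rightarrow>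
    (real ^ 'd \<Rightarrow> real ^ 'd ^ 'd) \<Rightarrow> (real ^ 'd) set set \<Rightarrow>
    (real ^ 'd \<Rightarrow> real ^ 'd ^ 'd) \<Rightarrow> (real ^ 'd \<Rightarrow> real ^ 'd) \<Rightarrow> bool" where
  "solves_R_disc n lam mu \<Omega> F \<T> T u \<longleftrightarrow> solves n lam mu \<Omega> F (M_disc \<T>) (X_disc \<Omega> \<T>) T u"

definition mesh_mean :: "'a::euclidean_space set set \<Rightarrow> ('a \<Rightarrow> 'b::euclidean_space) \<Rightarrow> 'a \<Rightarrow> 'b" where
  "mesh_mean \<T> f x = (\<Sum>K\<in>\<T>. indicator (interior K) x *\<^sub>R
     ((1 / measure lebesgue K) *\<^sub>R (LINT y|lebesgue_on K. f y)))"


section \<open>The function measuring the error\<close>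

definition Phi :: "nat \<Rightarrow> real \<Rightarrow> real" where
  "Phi n s = s\<^sup>2 / (1 + s) powr (1 - 1 / real n)"

text \<open>The supremum is finite because \<open>Phi n\<close> grows superlinearly for \<open>n \<ge> 1\<close>.\<close>

definition Phi_conj :: "nat \<Rightarrow> real \<Rightarrow> real" where
  "Phi_conj n s = (SUP t\<in>{0..}. s * t - Phi n t)"

end

(* With E = T_h - Pi_h T and A the nonlinear tensor operator, both problems tested with E give
     int (A(T_h) - A(Pi_h T)) : E = int (A(T) - A(Pi_h T)) : E + int E : eps(v_h - u_n)
   for every v_h, because E is L^2-orthogonal to eps(v_h): X_h is a subspace of W_0^{1,n+1} and
   eps(v_h) is elementwise constant. The left side dominates Phi_n(|E|) by strong monotonicity of
   the power-law terms, and Young's inequality for Phi_n and Phi_n^*, with the doubling constant K,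
   absorbs E on the right. For n = 1 the regularizing term is linear, so its consistency error
   vanishes by orthogonality of the mean and no bound on T_n is needed.
   The inclusion of X_h in W_0^{1,n+1} holds because mollified soft thresholds of a piecewise affine
   function are test functions whose gradients are bounded and almost everywhere eventually equal
   to its gradient. *)

theory Submission
  imports Defs "HOL-Computational_Algebra.Polynomial"
begin

text \<open>The degenerate weight shapes the estimate. Strong monotonicity yields |R - S|^2 / (|R| +
  |S|)^(1 - 1/n), whereas Phi_n carries the weight (1 + |R - S|)^(1 - 1/n). The two compare once one
  argument is bounded, and here S = Pi_h T inherits the bound of T. The same bound serves a second
  time: consistency errors of orders beta and 1/n are brought to the common order min(beta, 1/n), at
  the cost of a factor, since |T - Pi_h T| stays below twice that bound. For n = 1 the weight is 1,
  and the consistency error that remains has order beta. The exponents fit together: Phi_n^* is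
  bounded by a multiple of s + s^(n + 1), matching the integrability of strains, and min(beta, 1/n)
  times n + 1 is at most 1 + 1/n, the integrability of T. The inclusion in W_0^{1,n+1} goes through
  thresholds because they use of the boundary only that the function vanishes there.\<close>

section \<open>Power-law fields\<close>

text \<open>Polarization: the directions of \<open>a\<close> and \<open>b\<close> enter only through
  |a - b|^2. Replacing that by (|a| - |b|)^2 gives the same identity for the two lengths, so vector
  monotonicity reduces to a scalar inequality.\<close>

lemma inner_scaled_diff:
  fixes a b :: "'a::real_inner"
  shows "(X *\<^sub>R a - Y *\<^sub>R b) \<bullet> (a - b) =
    (X + Y) * (norm (a - b))\<^sup>2 / 2 + (X - Y) * ((norm a)\<^sup>2 - (norm b)\<^sup>2) / 2"
  by (simp add: power2_norm_eq_inner inner_diff_left inner_diff_right inner_commute field_simps)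

lemma norm_diff_sq_ge:
  fixes a b :: "'a::real_normed_vector"
  shows "(norm a - norm b)\<^sup>2 \<le> (norm (a - b))\<^sup>2"
  by (metis abs_le_square_iff abs_norm_cancel norm_triangle_ineq3)

text \<open>The scalar product for the lengths is nonnegative by \<open>mono\<close>, and passing
  from (|a| - |b|)^2 to |a - b|^2 increases it because the weights are nonnegative.\<close>

lemma radial_monotone:
  fixes a b :: "'a::real_inner" and m :: "real \<Rightarrow> real"
  assumes nonneg: "\<And>s. s > 0 \<Longrightarrow> 0 \<le> m s"
    and mono: "\<And>r s. 0 \<le> r \<Longrightarrow> r \<le> s \<Longrightarrow> m r * r \<le> m s * s"
  shows "0 \<le> (m (norm a) *\<^sub>R a - m (norm b) *\<^sub>R b) \<bullet> (a - b)"
proof -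
  \<comment> \<open>Nothing is assumed about the sign of \<open>m 0\<close>, so vanishing vectors
    are treated apart.\<close>
  consider "a = 0" | "b = 0" | "a \<noteq> 0" "b \<noteq> 0" by blast
  then show ?thesis
  proof cases
    case 1
    then show ?thesis using nonneg[of "norm b"] by (cases "b = 0") auto
  next
    case 2
    then show ?thesis using nonneg[of "norm a"] by (cases "a = 0") auto
  next
    case 3
    define x y X Y where d: "x = norm a" "y = norm b" "X = m (norm a)" "Y = m (norm b)"
    have p: "X \<ge> 0" "Y \<ge> 0" using 3 nonneg d by auto
    have "0 \<le> (X * x - Y * y) * (x - y)"
      using mono[of x y] mono[of y x] d
      by (cases "x \<le> y") (auto intro: mult_nonpos_nonpos mult_nonneg_nonneg)
    also have "\<dots> = (X + Y) * (x - y)\<^sup>2 / 2 + (X - Y) * (x\<^sup>2 - y\<^sup>2) / 2"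
      by (simp add: power2_eq_square field_simps)
    also have "\<dots> \<le> (X + Y) * (norm (a - b))\<^sup>2 / 2 + (X - Y) * (x\<^sup>2 - y\<^sup>2) / 2"
      using p norm_diff_sq_ge[of a b] d
      by (intro add_right_mono divide_right_mono mult_left_mono) auto
    also have "\<dots> = (X *\<^sub>R a - Y *\<^sub>R b) \<bullet> (a - b)"
      by (simp add: inner_scaled_diff d)
    finally show ?thesis by (simp add: d)
  qed
qed

text \<open>The p-Laplace type field of length |a|^p. It lives on any normed space, so that one set
  of inequalities covers the trace, which is a real, and the deviator, which is a tensor.\<close>

definition power_field :: "real \<Rightarrow> 'a::real_normed_vector \<Rightarrow> 'a" where
  "power_field p a = a /\<^sub>R norm a powr (1 - p)"

lemma power_field_0 [simp]: "power_field p 0 = 0"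
  by (simp add: power_field_def)

lemma power_field_1 [simp]: "power_field 1 a = a"
  by (cases "a = 0") (simp_all add: power_field_def)

lemma norm_power_field: "norm (power_field p a) = (if a = 0 then 0 else norm a powr p)"
  by (simp add: power_field_def powr_diff field_simps)

text \<open>The weight p / (|a| + |b|)^(1 - p) is at most p times either of the two weights of the
  field. Subtracting it leaves a nonnegative coefficient of |a - b|^2, and the scalar case, which is
  concavity of t^p, remains.\<close>

lemma power_field_strongly_monotone:
  fixes a b :: "'a::real_inner"
  assumes p: "0 < p" "p \<le> 1"
  shows "p * (norm (a - b))\<^sup>2 / (norm a + norm b) powr (1 - p)
    \<le> (power_field p a - power_field p b) \<bullet> (a - b)"
proof -
  have zero: "p * (norm c)\<^sup>2 / norm c powr (1 - p) \<le> power_field p c \<bullet> c" for c :: 'a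
    using p by (auto simp: power_field_def power2_norm_eq_inner divide_simps mult_left_le_one_le)
  have main: "p * (norm (a - b))\<^sup>2 / (norm a + norm b) powr (1 - p)
    \<le> (power_field p a - power_field p b) \<bullet> (a - b)"
    if ab: "a \<noteq> 0" "b \<noteq> 0" "norm b \<le> norm a" for a b :: 'a
  proof -
    define x y X Y Z where d: "x = norm a" "y = norm b" "X = 1 / norm a powr (1 - p)"
      "Y = 1 / norm b powr (1 - p)" "Z = p / (norm a + norm b) powr (1 - p)"
    have pos: "x > 0" "y > 0" "X > 0" "Y > 0" "Z > 0"
      using ab p d by (auto intro!: divide_pos_pos simp: add_pos_pos powr_gt_zero add_nonneg_eq_0_iff)
    have s: "norm a + norm b > 0" using ab by (simp add: add_pos_pos)
    have ZX: "Z \<le> p * X" unfolding d using p ab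
      by (auto intro!: divide_left_mono powr_mono2 simp: s less_imp_neq[OF s, symmetric])
    have ZY: "Z \<le> p * Y" unfolding d using p ab
      by (auto intro!: divide_left_mono powr_mono2 simp: s less_imp_neq[OF s, symmetric])
    have pX: "p * X \<le> X" "p * Y \<le> Y" using pos p by (auto simp: mult_left_le_one_le)
    have Yy: "Y * y = y powr p" and Xx: "1 / X = x powr (1 - p)"
      using pos by (simp_all add: d powr_diff)
    \<comment> \<open>After division by x^(1 - p) this is the tangent inequality at the larger
      length, x^p - y^p >= p x^(p - 1) (x - y).\<close>
    have "y powr p * x powr (1 - p) \<le> p * y + (1 - p) * x"
      using Youngs_inequality_0[of p "1 - p" y x] p pos by simp
    then have "Y * y / X \<le> p * y + (1 - p) * x" using Yy Xx by (metis times_divide_eq_right mult_1_right)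
    then have "Y * y \<le> (p * y + (1 - p) * x) * X" using pos by (simp add: field_simps)
    then have "p * X * (x - y) \<le> X * x - Y * y" by (simp add: field_simps)
    moreover have "Z * (x - y) \<le> p * X * (x - y)" using ZX ab d by (intro mult_right_mono) auto
    ultimately have "Z * (x - y) * (x - y) \<le> (X * x - Y * y) * (x - y)"
      using ab d by (intro mult_right_mono) auto
    then have 1: "Z * (x - y)\<^sup>2 \<le> (X + Y) * (x - y)\<^sup>2 / 2 + (X - Y) * (x\<^sup>2 - y\<^sup>2) / 2"
      by (simp add: power2_eq_square field_simps)
    \<comment> \<open>The coefficient is nonnegative because Z lies below both X and Y; this is what
      lets the scalar inequality pass to vectors.\<close>
    have "((X + Y) / 2 - Z) * (x - y)\<^sup>2 \<le> ((X + Y) / 2 - Z) * (norm (a - b))\<^sup>2"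
    proof (rule mult_left_mono)
      have "Z \<le> X" "Z \<le> Y" using ZX ZY pX by (blast intro: order_trans)+
      then show "0 \<le> (X + Y) / 2 - Z" by simp
    qed (use norm_diff_sq_ge[of a b] d in simp)
    then have "(X + Y) * (x - y)\<^sup>2 / 2 - Z * (x - y)\<^sup>2 \<le> (X + Y) * (norm (a - b))\<^sup>2 / 2 - Z * (norm (a - b))\<^sup>2"
      by (simp only: left_diff_distrib times_divide_eq_left)
    with 1 have "Z * (norm (a - b))\<^sup>2 \<le> (X + Y) * (norm (a - b))\<^sup>2 / 2 + (X - Y) * (x\<^sup>2 - y\<^sup>2) / 2"
      by linarith
    also have "\<dots> = (X *\<^sub>R a - Y *\<^sub>R b) \<bullet> (a - b)" by (simp add: inner_scaled_diff d)
    finally show ?thesis by (simp add: d power_field_def divide_inverse mult_ac)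
  qed
  consider "a = 0" | "b = 0" | "a \<noteq> 0" "b \<noteq> 0" "norm b \<le> norm a" | "a \<noteq> 0" "b \<noteq> 0" "norm a \<le> norm b"
    by linarith
  then show ?thesis
  proof cases
    case 1 then show ?thesis using zero[of b] by simp
  next
    case 2 then show ?thesis using zero[of a] by simp
  next
    case 3 then show ?thesis by (rule main)
  next
    case 4
    have "(power_field p b - power_field p a) \<bullet> (b - a) = (power_field p a - power_field p b) \<bullet> (a - b)"
      by (simp add: inner_diff_left inner_diff_right)
    then show ?thesis using main[of b a] 4 by (simp add: norm_minus_commute add.commute)
  qed
qed

text \<open>If |a - b| exceeds the larger length, each of the two values is at most |a - b|^p.
  Otherwise the difference splits into a change of vector and a change of weight, each bounded by |a
  - b|^p. Hence the 2.\<close>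

lemma power_field_hoelder:
  fixes a b :: "'a::real_normed_vector"
  assumes p: "0 < p" "p \<le> 1"
  shows "norm (power_field p a - power_field p b) \<le> 2 * norm (a - b) powr p"
proof -
  have main: "norm (power_field p a - power_field p b) \<le> 2 * norm (a - b) powr p"
    if le: "norm b \<le> norm a" for a b :: 'a
  proof -
    define x y D where d: "x = norm a" "y = norm b" "D = norm (a - b)"
    have nn: "0 \<le> y" "y \<le> x" "0 \<le> D" using d le by auto
    consider "D = 0" | "x < D" | "0 < D" "D \<le> x" "b = 0" | "0 < D" "D \<le> x" "b \<noteq> 0" using nn by linarith
    then show ?thesis
    proof cases
      case 1 then show ?thesis by (simp add: d)
    next
      case 2
      have "x powr p \<le> D powr p" "y powr p \<le> D powr p" using 2 nn p by (auto intro!: powr_mono2)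
      then have "norm (power_field p a) \<le> D powr p" "norm (power_field p b) \<le> D powr p"
        by (auto simp: norm_power_field d)
      then show ?thesis using norm_triangle_ineq4[of "power_field p a" "power_field p b"]
        unfolding d(3)[symmetric] by linarith
    next
      case 3
      then show ?thesis by (simp add: norm_power_field d)
    next
      case 4
      have y: "y > 0" "x > 0" using 4 d nn by auto
      define X Y where XY: "X = inverse (x powr (1 - p))" "Y = inverse (y powr (1 - p))"
      have pos: "X > 0" "Y > 0" using y by (auto simp: XY)
      have DX: "D * X \<le> D powr p"
      proof -
        have "X \<le> inverse (D powr (1 - p))" unfolding XY using 4 p by (auto intro!: le_imp_inverse_le powr_mono2)
        then have "D * X \<le> D * inverse (D powr (1 - p))" using nn by (intro mult_left_mono) auto
        also have "\<dots> = D powr p" using 4 by (simp add: powr_diff)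
        finally show ?thesis .
      qed
      have XlY: "X \<le> Y" unfolding XY using y nn p by (auto intro!: le_imp_inverse_le powr_mono2)
      have xX: "x * X = x powr p" "y * Y = y powr p" using y by (simp_all add: XY powr_diff)
      have "power_field p a - power_field p b = X *\<^sub>R (a - b) - (Y - X) *\<^sub>R b"
        by (simp add: power_field_def XY d algebra_simps)
      then have "norm (power_field p a - power_field p b) \<le> norm (X *\<^sub>R (a - b)) + norm ((Y - X) *\<^sub>R b)"
        by (metis norm_triangle_ineq4)
      also have "\<dots> = D * X + (Y - X) * y" using pos XlY by (simp add: d)
      \<comment> \<open>Since Y y = y^p and X x = x^p, the claim is y^p <= x^p after adding X y to
        both sides.\<close>
      also have "(Y - X) * y \<le> (x - y) * X"
      proof -
        have "y powr p \<le> x powr p" using nn p by (intro powr_mono2) auto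
        then show ?thesis using xX by (simp add: algebra_simps)
      qed
      also have "(x - y) * X \<le> D * X" using pos norm_triangle_ineq2[of a b] d by (intro mult_right_mono) auto
      finally show ?thesis using DX unfolding d(3)[symmetric] by linarith
    qed
  qed
  show ?thesis
    using main[of a b] main[of b a] by (cases "norm b \<le> norm a") (auto simp: norm_minus_commute)
qed

section \<open>The error function and its conjugate\<close>

lemma Phi_nonneg: "0 \<le> Phi n s"
  by (simp add: Phi_def)

lemma Phi_0 [simp]: "Phi n 0 = 0"
  by (simp add: Phi_def)

text \<open>Beyond t = 1 + (2 s)^n one has s t <= Phi_n(t), because there t^(1/n) >= 2 s and
  Phi_n(t) >= t^(1 + 1/n) / 2. Only smaller t contribute, and for them Phi_n(t) is dropped. The
  bound makes the supremum finite and gives the growth exponent n + 1, dual to 1 + 1/n.\<close>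

lemma Phi_conj_arg_le:
  assumes n: "n \<ge> 1" and s: "0 \<le> s" and t: "0 \<le> t"
  shows "s * t - Phi n t \<le> s + 2 ^ n * s ^ (n + 1)"
proof (cases "t \<le> 1 + (2 * s) ^ n")
  case True
  then have "s * t \<le> s * (1 + (2 * s) ^ n)" using s by (intro mult_left_mono)
  then show ?thesis using Phi_nonneg[of n t] by (simp add: algebra_simps power_mult_distrib)
next
  case False
  define p where "p = 1 / real n"
  have p: "0 < p" "p \<le> 1" using n by (auto simp: p_def)
  have s2: "0 \<le> (2 * s) ^ n" using s by simp
  have t1: "t > 1" "t \<ge> (2 * s) ^ n" using False s2 by linarith+
  have "2 * s \<le> t powr p"
  proof (cases "s = 0")
    case False
    then have "2 * s = ((2 * s) powr real n) powr p" using s n by (simp add: powr_powr p_def)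
    also have "\<dots> \<le> t powr p" using t1 s p False by (intro powr_mono2) (auto simp: powr_realpow)
    finally show ?thesis .
  qed simp
  then have "2 * s * t \<le> t powr p * t" using t1 by (intro mult_right_mono) auto
  also have "\<dots> = 2 * (t\<^sup>2 / (2 * t powr (1 - p)))" using t1 by (simp add: powr_diff power2_eq_square)
  also have "\<dots> \<le> 2 * Phi n t"
  proof -
    have "(1 + t) powr (1 - p) \<le> (2 * t) powr (1 - p)" using t1 p by (intro powr_mono2) auto
    also have "\<dots> \<le> 2 * t powr (1 - p)"
    proof -
      have "2 powr (1 - p) \<le> (2::real) powr 1" using p by (intro powr_mono) auto
      then show ?thesis using t1 by (simp add: powr_mult)
    qed
    finally have "t\<^sup>2 / (2 * t powr (1 - p)) \<le> t\<^sup>2 / (1 + t) powr (1 - p)"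
      using t1 by (intro divide_left_mono) auto
    then show ?thesis unfolding Phi_def p_def[symmetric] by simp
  qed
  finally have "s * t - Phi n t \<le> 0" by simp
  then show ?thesis using s by (smt (verit) mult_nonneg_nonneg zero_le_power)
qed

lemma Phi_conj_bdd: "n \<ge> 1 \<Longrightarrow> 0 \<le> s \<Longrightarrow> bdd_above ((\<lambda>t. s * t - Phi n t) ` {0..})"
  using Phi_conj_arg_le by (intro bdd_aboveI2) auto

lemma Phi_conj_ge: "n \<ge> 1 \<Longrightarrow> 0 \<le> s \<Longrightarrow> 0 \<le> t \<Longrightarrow> s * t - Phi n t \<le> Phi_conj n s"
  unfolding Phi_conj_def by (rule cSUP_upper) (auto intro: Phi_conj_bdd)

lemma Phi_conj_nonneg: "n \<ge> 1 \<Longrightarrow> 0 \<le> s \<Longrightarrow> 0 \<le> Phi_conj n s"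
  using Phi_conj_ge[of n s 0] by simp

lemma Phi_conj_le: "n \<ge> 1 \<Longrightarrow> 0 \<le> s \<Longrightarrow> Phi_conj n s \<le> s + 2 ^ n * s ^ (n + 1)"
  unfolding Phi_conj_def by (rule cSUP_least) (use Phi_conj_arg_le in \<open>simp_all del: power_Suc\<close>)

lemma Phi_conj_mono:
  assumes "n \<ge> 1" "0 \<le> r" "r \<le> s"
  shows "Phi_conj n r \<le> Phi_conj n s"
  unfolding Phi_conj_def
proof (rule cSUP_mono)
  fix t :: real assume t: "t \<in> {0..}"
  then have "r * t - Phi n t \<le> s * t - Phi n t" using assms by (simp add: mult_right_mono)
  then show "\<exists>t'\<in>{0..}. r * t - Phi n t \<le> s * t' - Phi n t'" using t by blast
qed (use assms in \<open>auto intro: Phi_conj_bdd\<close>)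

text \<open>Doubling is iterated, with the crude bound x <= 2 ^ m for m the ceiling of x in place of
  a logarithm. Since the exponent depends on x alone, the final constant is explicit in
  \<open>K\<close>.\<close>

lemma Phi_conj_dilate:
  assumes n: "n \<ge> 1" and K: "K > 2" and dbl: "\<forall>s \<ge> 0. Phi_conj n (2 * s) \<le> K * Phi_conj n s"
    and s: "0 \<le> s" and x: "0 \<le> x"
  shows "Phi_conj n (x * s) \<le> K ^ nat \<lceil>x\<rceil> * Phi_conj n s"
proof -
  have pow: "Phi_conj n (2 ^ m * s) \<le> K ^ m * Phi_conj n s" for m
  proof (induction m)
    case (Suc m)
    have "Phi_conj n (2 * (2 ^ m * s)) \<le> K * Phi_conj n (2 ^ m * s)" using dbl s by simp
    also have "\<dots> \<le> K * (K ^ m * Phi_conj n s)" using Suc K by (intro mult_left_mono) auto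
    finally show ?case by (simp add: mult_ac)
  qed simp
  have "x \<le> real (nat \<lceil>x\<rceil>)" using x by linarith
  also have "real m \<le> 2 ^ m" for m by (simp add: less_imp_le of_nat_less_two_power)
  finally have "x * s \<le> 2 ^ nat \<lceil>x\<rceil> * s" using s by (rule mult_right_mono)
  then show ?thesis using pow[of "nat \<lceil>x\<rceil>"] Phi_conj_mono[OF n, of "x * s"] s x by (smt (verit) mult_nonneg_nonneg)
qed

text \<open>The Fenchel inequality is applied to the dilated argument (B / c) s and multiplied by
  \<open>c\<close>; the dilation is then paid for with powers of \<open>K\<close>. The free
  \<open>c\<close> allows the first term to be absorbed by coercivity.\<close>

lemma Phi_young:
  assumes n: "n \<ge> 1" and K: "K > 2" and dbl: "\<forall>s \<ge> 0. Phi_conj n (2 * s) \<le> K * Phi_conj n s"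
    and s: "0 \<le> s" and t: "0 \<le> t" and c: "0 < c" and B: "0 \<le> B"
  shows "B * (t * s) \<le> c * Phi n t + c * K ^ nat \<lceil>B / c\<rceil> * Phi_conj n s"
proof -
  have "B / c * s * t - Phi n t \<le> Phi_conj n (B / c * s)"
    using assms by (intro Phi_conj_ge) auto
  also have "\<dots> \<le> K ^ nat \<lceil>B / c\<rceil> * Phi_conj n s" using assms by (intro Phi_conj_dilate) auto
  finally have "c * (B / c * s * t - Phi n t) \<le> c * (K ^ nat \<lceil>B / c\<rceil> * Phi_conj n s)"
    using c by (intro mult_left_mono) auto
  then show ?thesis using c by (simp add: algebra_simps)
qed

lemma borel_measurable_Phi_conj:
  assumes n: "n \<ge> 1" and f: "f \<in> borel_measurable M" and nn: "\<And>x. 0 \<le> f x"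
  shows "(\<lambda>x. Phi_conj n (f x)) \<in> borel_measurable M"
proof -
  \<comment> \<open>A supremum over uncountably many t: measurability comes from monotonicity,
    extended to all reals by cutting the argument off at zero.\<close>
  have "mono (\<lambda>s. Phi_conj n (max 0 s))" by (intro monoI Phi_conj_mono n) auto
  then have "(\<lambda>s. Phi_conj n (max 0 s)) \<in> borel_measurable borel" by (rule borel_measurable_mono)
  from measurable_compose[OF f this] show ?thesis using nn by (simp add: max_absorb2)
qed

text \<open>A bound on one tensor suffices, because |R| + |S| <= |R - S| + 2 M <= 2 M (1 + |R - S|).
  The exponent 1 - 1/n lies in [0,1] and 2 M >= 1, so the factor 2 M need not be raised to
  it.\<close>

lemma Phi_le_quotient:
  fixes R S :: "'a::real_normed_vector"
  assumes n: "n \<ge> 1" and S: "norm S \<le> M" and M: "M \<ge> 1"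
  shows "Phi n (norm (R - S)) / (2 * M) \<le> (norm (R - S))\<^sup>2 / (norm R + norm S) powr (1 - 1 / real n)"
proof (cases "norm R + norm S = 0")
  case False
  define q where "q = 1 - 1 / real n"
  have q: "0 \<le> q" "q \<le> 1" using n by (auto simp: q_def)
  have pos: "norm R + norm S > 0" using False by (smt (verit) norm_ge_zero)
  have "norm R \<le> norm (R - S) + norm S" by (metis diff_add_cancel norm_triangle_ineq)
  then have "norm R + norm S \<le> norm (R - S) + 2 * M" using S by linarith
  also have "\<dots> \<le> 2 * M * (1 + norm (R - S))" using M 
  proof -
    have "1 * norm (R - S) \<le> 2 * M * norm (R - S)" using M by (intro mult_right_mono) auto
    then show ?thesis by (simp add: algebra_simps)
  qed
  finally have "(norm R + norm S) powr q \<le> (2 * M * (1 + norm (R - S))) powr q"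
    using q pos by (intro powr_mono2) auto
  also have "\<dots> = (2 * M) powr q * (1 + norm (R - S)) powr q" using M by (simp add: powr_mult)
  also have "\<dots> \<le> 2 * M * (1 + norm (R - S)) powr q"
  proof -
    have "(2 * M) powr q \<le> (2 * M) powr 1" using q M by (intro powr_mono) auto
    then show ?thesis using M by (intro mult_right_mono) auto
  qed
  finally have le: "(norm R + norm S) powr q \<le> 2 * M * (1 + norm (R - S)) powr q" .
  have pos1: "0 < (1 + norm (R - S)) powr q" by (simp add: add_nonneg_eq_0_iff)
  have "(norm (R - S))\<^sup>2 / (2 * M * (1 + norm (R - S)) powr q) \<le> (norm (R - S))\<^sup>2 / (norm R + norm S) powr q"
    using le pos pos1 False M by (intro divide_left_mono) (auto intro!: mult_pos_pos)
  then show ?thesis by (simp add: Phi_def q_def mult_ac)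
qed (use norm_ge_zero[of R] norm_ge_zero[of S] in \<open>simp add: add_nonneg_eq_0_iff\<close>)

lemma Phi_1: "0 \<le> s \<Longrightarrow> Phi 1 s = s\<^sup>2"
  by (simp add: Phi_def)

section \<open>Tensor operators\<close>

lemma sqrt_le_self: "1 \<le> x \<Longrightarrow> sqrt x \<le> x" for x :: real
  by (rule real_le_lsqrt) (auto simp: power2_eq_square)

lemma trace_eq_inner: "trace S = S \<bullet> mat 1" for S :: "real ^ 'd ^ 'd"
proof -
  have "S \<bullet> mat 1 = (\<Sum>i\<in>UNIV. \<Sum>j\<in>UNIV. S $ i $ j * (if i = j then 1 else 0))"
    by (simp add: inner_vec_def mat_def)
  also have "\<dots> = trace S" by (simp add: trace_def sum.delta' if_distrib cong: if_cong)
  finally show ?thesis by simp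
qed

lemma mat1_inner_mat1: "(mat 1 :: real ^ 'd ^ 'd) \<bullet> mat 1 = real CARD('d)"
  by (simp add: trace_eq_inner[symmetric] trace_I)

lemma norm_mat1: "norm (mat 1 :: real ^ 'd ^ 'd) = sqrt (real CARD('d))"
  by (simp add: norm_eq_sqrt_inner mat1_inner_mat1)

lemma linear_dev: "linear (dev :: real ^ 'd ^ 'd \<Rightarrow> _)"
  by (intro linearI) (simp_all add: dev_def trace_eq_inner inner_add_left algebra_simps add_divide_distrib)

lemma linear_trace: "linear (trace :: real ^ 'd ^ 'd \<Rightarrow> real)"
  by (intro linearI) (simp_all add: trace_eq_inner inner_add_left)

lemma dev_diff: "dev (R - S) = dev R - dev S" for R S :: "real ^ 'd ^ 'd"
  by (rule linear_diff[OF linear_dev])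

lemma dev_inner_mat1: "dev S \<bullet> mat 1 = 0" for S :: "real ^ 'd ^ 'd"
  by (simp add: dev_def inner_diff_left mat1_inner_mat1 trace_eq_inner)

lemma inner_dev: "S \<bullet> R = S \<bullet> dev R" if "S \<bullet> mat 1 = 0" for R S :: "real ^ 'd ^ 'd"
  using that by (simp add: dev_def inner_diff_right)

text \<open>Pythagoras for the splitting into the deviator and a multiple of the identity, whose
  squared length is d.\<close>

lemma norm_dev_trace: "(norm S)\<^sup>2 = (norm (dev S))\<^sup>2 + (trace S)\<^sup>2 / real CARD('d)" for S :: "real ^ 'd ^ 'd"
proof -
  have "dev S \<bullet> dev S = S \<bullet> S - (trace S)\<^sup>2 / real CARD('d)"
  proof -
    have "dev S \<bullet> dev S = dev S \<bullet> S" by (rule inner_dev[OF dev_inner_mat1, symmetric])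
    also have "\<dots> = S \<bullet> S - (trace S)\<^sup>2 / real CARD('d)"
      unfolding dev_def by (simp add: inner_diff_left trace_eq_inner[of S] inner_commute[of "mat 1" S] power2_eq_square)
    finally show ?thesis .
  qed
  then show ?thesis by (simp add: power2_norm_eq_inner)
qed

lemma norm_dev_le: "norm (dev S) \<le> norm S" for S :: "real ^ 'd ^ 'd"
proof (rule power2_le_imp_le)
  show "(norm (dev S))\<^sup>2 \<le> (norm S)\<^sup>2" unfolding norm_dev_trace[of S] by simp
qed simp

lemma abs_trace_le: "\<bar>trace S\<bar> \<le> real CARD('d) * norm S" for S :: "real ^ 'd ^ 'd"
proof -
  have "\<bar>trace S\<bar> \<le> norm S * sqrt (real CARD('d))"
    using Cauchy_Schwarz_ineq2[of S "mat 1"] by (simp add: trace_eq_inner norm_mat1)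
  also have "\<dots> \<le> norm S * real CARD('d)"
    by (intro mult_left_mono sqrt_le_self) (auto simp: Suc_leI)
  finally show ?thesis by (simp add: mult.commute)
qed

lemma sym_tensor_dev: "sym_tensor S \<Longrightarrow> sym_tensor (dev S)" for S :: "real ^ 'd ^ 'd"
  by (auto simp: sym_tensor_def dev_def vec_eq_iff transpose_def mat_def)

lemma sym_tensor_diff: "sym_tensor R \<Longrightarrow> sym_tensor S \<Longrightarrow> sym_tensor (R - S)" for R S :: "real ^ 'd ^ 'd"
  by (auto simp: sym_tensor_def vec_eq_iff transpose_def)

definition tensor_a :: "nat \<Rightarrow> real ^ 'd ^ 'd \<Rightarrow> real ^ 'd ^ 'd" where
  "tensor_a n S = (1 / real n) *\<^sub>R
     (power_field (1 / real n) (trace S) *\<^sub>R mat 1 + power_field (1 / real n) (dev S))"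

definition tensor_c :: "(real \<Rightarrow> real) \<Rightarrow> (real \<Rightarrow> real) \<Rightarrow> real ^ 'd ^ 'd \<Rightarrow> real ^ 'd ^ 'd" where
  "tensor_c lam mu S = (lam (trace S) * trace S) *\<^sub>R mat 1 + mu (norm (dev S)) *\<^sub>R dev S"

lemma form_a_eq: "form_a n \<Omega> T S = (LINT x|lebesgue_on \<Omega>. tensor_a n (T x) \<bullet> S x)"
  by (simp add: form_a_def tensor_a_def power_field_def divide_inverse inner_add_left mult.commute
      flip: integral_mult_right_zero)

lemma form_c_eq: "form_c lam mu \<Omega> T T S = (LINT x|lebesgue_on \<Omega>. tensor_c lam mu (T x) \<bullet> S x)"
  by (simp add: form_c_def tensor_c_def)

lemma tensor_a_1: "tensor_a 1 S = trace S *\<^sub>R mat 1 + dev S"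
  by (simp add: tensor_a_def)

text \<open>Deviators are orthogonal to the identity, so the pairing decouples. The coefficients are
  arbitrary so that the regularizing and the material operator are both instances.\<close>

lemma split_trace_dev:
  fixes R S :: "real ^ 'd ^ 'd"
  shows "((x *\<^sub>R mat 1 + a *\<^sub>R dev R) - (y *\<^sub>R mat 1 + b *\<^sub>R dev S)) \<bullet> (R - S) =
    (x - y) * (trace R - trace S) + (a *\<^sub>R dev R - b *\<^sub>R dev S) \<bullet> (dev R - dev S)"
proof -
  have "(a *\<^sub>R dev R - b *\<^sub>R dev S) \<bullet> (R - S) = (a *\<^sub>R dev R - b *\<^sub>R dev S) \<bullet> (dev R - dev S)"
    by (subst inner_dev) (auto simp: inner_diff_left dev_inner_mat1 dev_diff)
  moreover have "((x *\<^sub>R mat 1 + a *\<^sub>R dev R) - (y *\<^sub>R mat 1 + b *\<^sub>R dev S)) =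
    (x - y) *\<^sub>R mat 1 + (a *\<^sub>R dev R - b *\<^sub>R dev S)" by (simp add: algebra_simps)
  moreover have "mat 1 \<bullet> (R - S) = trace R - trace S"
    by (simp add: trace_eq_inner inner_diff_right inner_commute)
  ultimately show ?thesis by (simp only: inner_add_left inner_scaleR_left)
qed

text \<open>One factor 1/n is the prefactor of the operator, the other is the monotonicity constant
  of \<open>power_field\<close> with exponent 1/n.\<close>

lemma tensor_a_strongly_monotone:
  fixes R S :: "real ^ 'd ^ 'd"
  assumes n: "n \<ge> 1"
  shows "(1 / real n)\<^sup>2 * ((norm (R - S))\<^sup>2 / (norm R + norm S) powr (1 - 1 / real n))
    \<le> (tensor_a n R - tensor_a n S) \<bullet> (R - S)"
proof (cases "norm R + norm S = 0")
  case False
  define p d where "p = 1 / real n" and "d = real CARD('d)"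
  have p: "0 < p" "p \<le> 1" and d: "d \<ge> 1" using n by (auto simp: p_def d_def Suc_leI)
  define N where "N = (norm R + norm S) powr (1 - p)"
  have N: "N > 0" using False by (auto simp: N_def)
  have 1: "p * (\<bar>trace R - trace S\<bar>\<^sup>2 / (d * N)) \<le>
      (power_field p (trace R) - power_field p (trace S)) * (trace R - trace S)"
  proof (cases "\<bar>trace R\<bar> + \<bar>trace S\<bar> = 0")
    case False
    \<comment> \<open>The factor d lost by bounding traces through norms is exactly the 1/d with
      which the trace enters \<open>norm_dev_trace\<close>, so the constant does not depend on the
      dimension.\<close>
    have "(\<bar>trace R\<bar> + \<bar>trace S\<bar>) powr (1 - p) \<le> (d * (norm R + norm S)) powr (1 - p)"
      using abs_trace_le[of R] abs_trace_le[of S] p by (intro powr_mono2) (auto simp: d_def algebra_simps)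
    also have "\<dots> = d powr (1 - p) * N" using d by (simp add: powr_mult N_def)
    also have "\<dots> \<le> d powr 1 * N" using N d p by (intro mult_right_mono powr_mono) auto
    finally have "(\<bar>trace R\<bar> + \<bar>trace S\<bar>) powr (1 - p) \<le> d * N" using d by simp
    then have "p * (trace R - trace S)\<^sup>2 / (d * N) \<le> p * (trace R - trace S)\<^sup>2 / (\<bar>trace R\<bar> + \<bar>trace S\<bar>) powr (1 - p)"
      using False N d p by (intro divide_left_mono) auto
    then show ?thesis using power_field_strongly_monotone[OF p, of "trace R" "trace S"] by simp
  next
    case True
    then have "trace R = 0" "trace S = 0" by auto
    then show ?thesis by simp
  qed
  have 2: "p * ((norm (dev R - dev S))\<^sup>2 / N) \<le>
      (power_field p (dev R) - power_field p (dev S)) \<bullet> (dev R - dev S)"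
  proof (cases "norm (dev R) + norm (dev S) = 0")
    case False
    have "(norm (dev R) + norm (dev S)) powr (1 - p) \<le> N" unfolding N_def
      using norm_dev_le[of R] norm_dev_le[of S] p by (intro powr_mono2) auto
    then have "p * (norm (dev R - dev S))\<^sup>2 / N \<le> p * (norm (dev R - dev S))\<^sup>2 / (norm (dev R) + norm (dev S)) powr (1 - p)"
      using False N p by (intro divide_left_mono) auto
    then show ?thesis using power_field_strongly_monotone[OF p, of "dev R" "dev S"] by simp
  qed (simp add: add_nonneg_eq_0_iff)
  have "p * ((norm (R - S))\<^sup>2 / N) = p * (\<bar>trace R - trace S\<bar>\<^sup>2 / (d * N)) + p * ((norm (dev R - dev S))\<^sup>2 / N)"
    using N d by (subst norm_dev_trace)
      (simp add: dev_diff linear_diff[OF linear_trace] d_def[symmetric] field_simps)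
  also have "\<dots> \<le> (power_field p (trace R) - power_field p (trace S)) * (trace R - trace S) +
      (power_field p (dev R) - power_field p (dev S)) \<bullet> (dev R - dev S)"
    using 1 2 by linarith
  also have "\<dots> = ((power_field p (trace R) *\<^sub>R mat 1 + power_field p (dev R)) -
      (power_field p (trace S) *\<^sub>R mat 1 + power_field p (dev S))) \<bullet> (R - S)"
    by (simp add: power_field_def split_trace_dev)
  finally have "p * (p * ((norm (R - S))\<^sup>2 / N)) \<le> p * (((power_field p (trace R) *\<^sub>R mat 1 + power_field p (dev R)) -
      (power_field p (trace S) *\<^sub>R mat 1 + power_field p (dev S))) \<bullet> (R - S))"
    using p by (intro mult_left_mono) auto
  also have "\<dots> = (tensor_a n R - tensor_a n S) \<bullet> (R - S)"
    unfolding tensor_a_def p_def[symmetric] scaleR_diff_right[symmetric] by simp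
  finally show ?thesis by (simp add: p_def N_def power2_eq_square)
next
  case True
  then have "R = 0" "S = 0" by (auto simp: add_nonneg_eq_0_iff)
  then show ?thesis by simp
qed

lemma material_monotone:
  assumes "material_functions lam mu"
  shows "r \<le> s \<Longrightarrow> lam r * r \<le> lam s * s"
    and "0 \<le> r \<Longrightarrow> r \<le> s \<Longrightarrow> mu r * r \<le> mu s * s"
    and "0 < s \<Longrightarrow> 0 \<le> mu s"
proof -
  obtain C\<^sub>1 C\<^sub>2 \<kappa> \<alpha> where c: "C\<^sub>1 > 0" "C\<^sub>2 > 0" "\<kappa> > 0" "\<alpha> > 0"
    and A1: "\<forall>s. C\<^sub>1 * s\<^sup>2 / (\<kappa> + \<bar>s\<bar>) \<le> lam s * s\<^sup>2 \<and> lam s * s\<^sup>2 \<le> C\<^sub>2 * \<bar>s\<bar>"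
    and A2: "\<forall>s \<ge> 0. C\<^sub>1 * s\<^sup>2 / (\<kappa> + s) \<le> mu s * s\<^sup>2 \<and> mu s * s\<^sup>2 \<le> C\<^sub>2 * s"
    and A3: "\<forall>s. 0 \<le> deriv (\<lambda>t. lam t * t) s"
    and A4: "\<forall>s > 0. (\<lambda>t. mu t * t) differentiable (at s) \<and>
           C\<^sub>1 / (\<kappa> + s) powr (\<alpha> + 1) \<le> deriv (\<lambda>t. mu t * t) s"
    using assms unfolding material_functions_def by (elim exE conjE) (rule that)
  have dl: "(\<lambda>s. lam s * s) differentiable (at s)" for s
    using assms C1_differentiable_on_eq[of "\<lambda>s. lam s * s" UNIV] by (auto simp: material_functions_def)
  have A3': "((\<lambda>t. lam t * t) has_real_derivative deriv (\<lambda>t. lam t * t) s) (at s)" for s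
    using dl[of s] by (simp add: DERIV_deriv_iff_real_differentiable)
  show "lam r * r \<le> lam s * s" if "r \<le> s" for r s
    using that by (rule DERIV_nonneg_imp_nondecreasing) (use A3 A3' in blast)
  show mu: "0 \<le> mu s" if "0 < s" for s
  proof -
    have "0 \<le> C\<^sub>1 * s\<^sup>2 / (\<kappa> + s)" using that c by simp
    also have "\<dots> \<le> mu s * s\<^sup>2" using A2 that by simp
    finally show ?thesis using that by (simp add: zero_le_mult_iff)
  qed
  show "mu r * r \<le> mu s * s" if rs: "0 \<le> r" "r \<le> s" for r s
  \<comment> \<open>The derivative of \<open>mu t * t\<close> is controlled for positive arguments
    only; from zero the comparison uses the sign of \<open>mu\<close>, which follows from the lower
    bound in (A2).\<close>
  proof (cases "r = 0")
    case True
    then show ?thesis using mu[of s] rs by (cases "s = 0") auto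
  next
    case False
    show ?thesis
    proof (rule DERIV_nonneg_imp_nondecreasing[OF rs(2)])
      fix x assume x: "r \<le> x" "x \<le> s"
      then have "x > 0" using False rs by auto
      then have "((\<lambda>t. mu t * t) has_real_derivative deriv (\<lambda>t. mu t * t) x) (at x)"
        using A4 by (simp add: DERIV_deriv_iff_real_differentiable)
      moreover have "0 \<le> deriv (\<lambda>t. mu t * t) x"
        using A4[rule_format, OF \<open>x > 0\<close>] c by (smt (verit) divide_nonneg_nonneg powr_ge_zero)
      ultimately show "\<exists>y. ((\<lambda>t. mu t * t) has_real_derivative y) (at x) \<and> 0 \<le> y" by blast
    qed
  qed
qed

lemma tensor_c_monotone:
  fixes R S :: "real ^ 'd ^ 'd"
  assumes "material_functions lam mu"
  shows "0 \<le> (tensor_c lam mu R - tensor_c lam mu S) \<bullet> (R - S)"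
proof -
  have "0 \<le> (lam (trace R) * trace R - lam (trace S) * trace S) * (trace R - trace S)"
    using material_monotone(1)[OF assms, of "trace R" "trace S"]
      material_monotone(1)[OF assms, of "trace S" "trace R"]
    by (cases "trace R \<le> trace S") (auto intro: mult_nonpos_nonpos mult_nonneg_nonneg)
  moreover have "0 \<le> (mu (norm (dev R)) *\<^sub>R dev R - mu (norm (dev S)) *\<^sub>R dev S) \<bullet> (dev R - dev S)"
    using material_monotone(2,3)[OF assms] by (intro radial_monotone) auto
  ultimately show ?thesis by (simp add: tensor_c_def split_trace_dev)
qed

text \<open>In the constant, one d comes from the bound of the trace by the norm, one from the norm
  of the identity, and the 1 from the deviatoric part. \<open>g\<close> is controlled at the two
  given deviators only, since the condition on \<open>mu\<close> concerns symmetric tensors.\<close>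

lemma trace_dev_hoelder:
  fixes R S :: "real ^ 'd ^ 'd" and f :: "real \<Rightarrow> real" and g :: "real ^ 'd ^ 'd \<Rightarrow> real ^ 'd ^ 'd"
  assumes L: "0 \<le> L" and q: "0 < q" "q \<le> 1"
    and f: "\<And>r s. \<bar>f r - f s\<bar> \<le> L * \<bar>r - s\<bar> powr q"
    and g: "norm (g (dev R) - g (dev S)) \<le> L * norm (dev R - dev S) powr q"
  shows "norm ((f (trace R) *\<^sub>R mat 1 + g (dev R)) - (f (trace S) *\<^sub>R mat 1 + g (dev S)))
    \<le> ((real CARD('d))\<^sup>2 + 1) * L * norm (R - S) powr q"
proof -
  define d where "d = real CARD('d)"
  have d: "d \<ge> 1" by (auto simp: d_def Suc_leI)
  have "\<bar>f (trace R) - f (trace S)\<bar> \<le> L * \<bar>trace R - trace S\<bar> powr q" by (rule f)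
  also have "\<dots> \<le> L * (d * norm (R - S)) powr q"
    using L q abs_trace_le[of "R - S"]
    by (intro mult_left_mono powr_mono2) (auto simp: linear_diff[OF linear_trace] d_def)
  also have "\<dots> \<le> L * (d * norm (R - S) powr q)"
  proof -
    have "d powr q \<le> d powr 1" using d q by (intro powr_mono) auto
    then show ?thesis using L d by (simp add: powr_mult mult_mono)
  qed
  finally have 1: "norm ((f (trace R) - f (trace S)) *\<^sub>R (mat 1 :: real ^ 'd ^ 'd)) \<le> L * (d * norm (R - S) powr q) * d"
    using sqrt_le_self[OF d] d L by (auto simp: norm_mat1 d_def[symmetric] intro!: mult_mono)
  have "L * norm (dev R - dev S) powr q \<le> L * norm (R - S) powr q"
    using L q norm_dev_le[of "R - S"] by (intro mult_left_mono powr_mono2) (auto simp: dev_diff)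
  with g have 2: "norm (g (dev R) - g (dev S)) \<le> L * norm (R - S) powr q" by linarith
  have "(f (trace R) *\<^sub>R mat 1 + g (dev R)) - (f (trace S) *\<^sub>R mat 1 + g (dev S)) =
      (f (trace R) - f (trace S)) *\<^sub>R mat 1 + (g (dev R) - g (dev S))"
    by (simp add: algebra_simps)
  also have "norm \<dots> \<le> L * (d * norm (R - S) powr q) * d + L * norm (R - S) powr q"
    by (rule norm_triangle_le[OF add_mono[OF 1 2]])
  finally show ?thesis by (simp add: d_def algebra_simps power2_eq_square)
qed

lemma tensor_c_hoelder:
  fixes R S :: "real ^ 'd ^ 'd"
  assumes h: "hoelder_material \<Lambda> \<beta> lam mu TYPE('d)" and \<beta>: "0 < \<beta>" "\<beta> \<le> 1" and \<Lambda>: "\<Lambda> > 0"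
    and sym: "sym_tensor R" "sym_tensor S"
  shows "norm (tensor_c lam mu R - tensor_c lam mu S) \<le> ((real CARD('d))\<^sup>2 + 1) * \<Lambda> * norm (R - S) powr \<beta>"
  unfolding tensor_c_def
proof (rule trace_dev_hoelder[where f = "\<lambda>r. lam r * r" and g = "\<lambda>S. mu (norm S) *\<^sub>R S"])
  show "\<bar>lam r * r - lam s * s\<bar> \<le> \<Lambda> * \<bar>r - s\<bar> powr \<beta>" for r s
    using h by (simp add: hoelder_material_def)
  show "norm (mu (norm (dev R)) *\<^sub>R dev R - mu (norm (dev S)) *\<^sub>R dev S) \<le> \<Lambda> * norm (dev R - dev S) powr \<beta>"
    using h sym_tensor_dev[OF sym(1)] sym_tensor_dev[OF sym(2)] unfolding hoelder_material_def by blast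
qed (use \<beta> \<Lambda> in auto)

lemma tensor_a_hoelder:
  fixes R S :: "real ^ 'd ^ 'd"
  assumes n: "n \<ge> 1"
  shows "norm (tensor_a n R - tensor_a n S) \<le> 2 * ((real CARD('d))\<^sup>2 + 1) * norm (R - S) powr (1 / real n)"
proof -
  define p where "p = 1 / real n"
  have p: "0 < p" "p \<le> 1" using n by (auto simp: p_def)
  define V where "V S = power_field p (trace S) *\<^sub>R mat 1 + power_field p (dev S)" for S :: "real ^ 'd ^ 'd"
  have "norm (tensor_a n R - tensor_a n S) = p * norm (V R - V S)"
    using p by (simp add: tensor_a_def p_def[symmetric] V_def flip: scaleR_diff_right)
  also have "\<dots> \<le> norm (V R - V S)" using p by (simp add: mult_left_le_one_le)
  also have "\<dots> \<le> ((real CARD('d))\<^sup>2 + 1) * 2 * norm (R - S) powr p"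
    unfolding V_def
  proof (rule trace_dev_hoelder[where f = "power_field p" and g = "power_field p"])
    show "\<bar>power_field p r - power_field p s\<bar> \<le> 2 * \<bar>r - s\<bar> powr p" for r s :: real
      using power_field_hoelder[OF p, of r s] by simp
  qed (use p power_field_hoelder[OF p] in auto)
  finally show ?thesis by (simp add: p_def mult_ac)
qed

section \<open>Smooth bump functions\<close>

lemma C_k_SucI:
  assumes "\<And>x. (f has_derivative D x) (at x)" "\<And>i. i \<in> Basis \<Longrightarrow> C_k k (\<lambda>x. D x i)"
  shows "C_k (Suc k) f"
  using assms frechet_derivative_at[OF assms(1), symmetric] by (auto simp: differentiable_def)

lemma C_k_Suc_has_derivative:
  "C_k (Suc k) f \<Longrightarrow> (f has_derivative frechet_derivative f (at x)) (at x)"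
  by (simp add: frechet_derivative_works)

lemma C_k_SucD: "C_k (Suc k) f \<Longrightarrow> C_k k f"
proof (induction k arbitrary: f)
  case 0
  then show ?case
    by (auto intro!: differentiable_imp_continuous_on differentiable_at_imp_differentiable_on)
qed auto

lemma C_k_const: "C_k k (\<lambda>x. c)"
proof (induction k arbitrary: c)
  case (Suc k)
  show ?case by (rule C_k_SucI[where D = "\<lambda>_ _. 0"]) (use Suc in auto)
qed auto

lemma C_k_add: "C_k k f \<Longrightarrow> C_k k g \<Longrightarrow> C_k k (\<lambda>x. f x + g x)"
proof (induction k arbitrary: f g)
  case (Suc k)
  show ?case
    by (rule C_k_SucI, rule has_derivative_add; (rule C_k_Suc_has_derivative, fact)?)
      (use Suc in auto)
qed (auto intro: continuous_on_add)

lemma C_k_mult: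
  fixes f g :: "'a::euclidean_space \<Rightarrow> real"
  shows "C_k k f \<Longrightarrow> C_k k g \<Longrightarrow> C_k k (\<lambda>x. f x * g x)"
proof (induction k arbitrary: f g)
  case (Suc k)
  show ?case
    by (rule C_k_SucI, rule has_derivative_mult; (rule C_k_Suc_has_derivative, fact)?)
      (use Suc C_k_SucD[OF Suc.prems(1)] C_k_SucD[OF Suc.prems(2)] in \<open>auto intro!: C_k_add\<close>)
qed (auto intro: continuous_on_mult)

lemma C_k_prod:
  fixes f :: "'i \<Rightarrow> 'a::euclidean_space \<Rightarrow> real"
  shows "(\<And>i. i \<in> I \<Longrightarrow> C_k k (f i)) \<Longrightarrow> C_k k (\<lambda>x. \<Prod>i\<in>I. f i x)"
  by (induction I rule: infinite_finite_induct) (auto intro: C_k_mult C_k_const)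

text \<open>A whole chain of successive derivatives is carried along, because differentiating the
  ridge function of \<open>F m\<close> produces that of \<open>F (Suc m)\<close>.\<close>

lemma C_k_ridge:
  fixes v :: "'a::euclidean_space" and F :: "nat \<Rightarrow> real \<Rightarrow> real"
  assumes F: "\<And>m t. (F m has_real_derivative F (Suc m) t) (at t)"
  shows "C_k k (\<lambda>x. F m (x \<bullet> v + c))"
proof (induction k arbitrary: m)
  case 0
  have "continuous_on UNIV (F m)" using F by (meson DERIV_continuous_on has_field_derivative_at_within)
  then show ?case by (auto intro!: continuous_on_compose2[of UNIV "F m"] continuous_intros)
next
  case (Suc k)
  have D: "((\<lambda>x. F m (x \<bullet> v + c)) has_derivative (\<lambda>h. F (Suc m) (x \<bullet> v + c) * (h \<bullet> v))) (at x)" for x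
    by (rule has_derivative_compose[OF _ F[unfolded has_field_derivative_def], of "\<lambda>x. x \<bullet> v + c"])
      (auto intro!: derivative_eq_intros)
  show ?case
    by (rule C_k_SucI[OF D]) (intro C_k_mult Suc.IH C_k_const)
qed

text \<open>The classical flat function exp(-c/t). The polynomial in 1/t closes the family under
  differentiation, and the parameter \<open>c\<close> is kept because c -> 0 yields the indicator of
  the half-line.\<close>

definition flat_exp :: "real \<Rightarrow> real poly \<Rightarrow> real \<Rightarrow> real" where
  "flat_exp c q t = (if t > 0 then poly q (1 / t) * exp (- c / t) else 0)"

lemma poly_times_exp_tendsto_0:
  assumes "c > 0"
  shows "((\<lambda>x::real. poly q x * exp (- c * x)) \<longlongrightarrow> 0) at_top"
proof -
  have pow: "((\<lambda>x::real. x ^ k * exp (- c * x)) \<longlongrightarrow> 0) at_top" for k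
  proof -
    have "filterlim (\<lambda>x::real. c * x) at_top at_top"
      using assms by (intro filterlim_tendsto_pos_mult_at_top[OF tendsto_const]) (auto simp: filterlim_ident)
    from filterlim_compose[OF tendsto_power_div_exp_0 this, of k]
    have "((\<lambda>x::real. (1 / c ^ k) * ((c * x) ^ k / exp (c * x))) \<longlongrightarrow> (1 / c ^ k) * 0) at_top"
      by (intro tendsto_mult tendsto_const)
    moreover have "(1 / c ^ k) * ((c * x) ^ k / exp (c * x)) = x ^ k * exp (- c * x)" for x
      using assms by (simp add: power_mult_distrib exp_minus field_simps)
    ultimately show ?thesis by simp
  qed
  have "((\<lambda>x::real. \<Sum>k\<le>degree q. coeff q k * (x ^ k * exp (- c * x))) \<longlongrightarrow> (\<Sum>k\<le>degree q. coeff q k * 0)) at_top"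
    by (intro tendsto_sum tendsto_mult tendsto_const pow)
  then show ?thesis by (simp add: poly_altdef sum_distrib_right mult.assoc)
qed

text \<open>The chain rule with (1/t)' = -1/t^2 turns \<open>q\<close> into x^2 (c q - q') evaluated
  at x = 1/t. At zero the exponential beats every polynomial in 1/t.\<close>

lemma flat_exp_derivative:
  assumes c: "c > 0"
  shows "(flat_exp c q has_real_derivative flat_exp c ([:0, 0, 1:] * (smult c q - pderiv q)) t) (at t)"
proof -
  consider "t > 0" | "t < 0" | "t = 0" by linarith
  then show ?thesis
  proof cases
    case 1
    have "((\<lambda>t. poly q (1 / t) * exp (- c / t)) has_real_derivative
        poly q (1 / t) * (exp (- c / t) * (c / t\<^sup>2)) + poly (pderiv q) (1 / t) * (- 1 / t\<^sup>2) * exp (- c / t)) (at t)"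
      using 1 by (auto intro!: derivative_eq_intros DERIV_chain2[OF poly_DERIV] simp: power2_eq_square)
    moreover have "poly q (1 / t) * (exp (- c / t) * (c / t\<^sup>2)) + poly (pderiv q) (1 / t) * (- 1 / t\<^sup>2) * exp (- c / t)
        = flat_exp c ([:0, 0, 1:] * (smult c q - pderiv q)) t"
      using 1 by (simp add: flat_exp_def power2_eq_square field_simps)
    moreover have "eventually (\<lambda>s. flat_exp c q s = poly q (1 / s) * exp (- c / s)) (nhds t)"
      using 1 by (intro eventually_mono[OF eventually_nhds_in_open[of "{0<..}" t]]) (auto simp: flat_exp_def)
    ultimately show ?thesis by (simp add: DERIV_cong_ev[OF refl])
  next
    case 2
    have "eventually (\<lambda>s. flat_exp c q s = 0) (nhds t)"
      using 2 by (intro eventually_mono[OF eventually_nhds_in_open[of "{..<0}" t]]) (auto simp: flat_exp_def)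
    then show ?thesis using 2 by (simp add: DERIV_cong_ev[OF refl] flat_exp_def[of _ _ t])
  next
    case 3
    have "((\<lambda>h. flat_exp c q h / h) \<longlongrightarrow> 0) (at_right 0)"
    proof (rule Lim_transform_eventually)
      \<comment> \<open>Dividing by \<open>h\<close> contributes one more factor 1/h, hence the
        multiplication of \<open>q\<close> by the monomial x.\<close>
      show "((\<lambda>h. poly ([:0, 1:] * q) (inverse h) * exp (- c * inverse h)) \<longlongrightarrow> 0) (at_right 0)"
        by (rule filterlim_compose[OF poly_times_exp_tendsto_0[OF c] filterlim_inverse_at_top_right])
      show "\<forall>\<^sub>F h in at_right 0. poly ([:0, 1:] * q) (inverse h) * exp (- c * inverse h) = flat_exp c q h / h"
        using eventually_at_right_less[of "0::real"] by eventually_elim (simp add: flat_exp_def divide_inverse)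
    qed
    moreover have "((\<lambda>h. flat_exp c q h / h) \<longlongrightarrow> 0) (at_left 0)"
    proof (rule Lim_transform_eventually[OF tendsto_const])
      show "\<forall>\<^sub>F h in at_left 0. 0 = flat_exp c q h / h"
        using eventually_at_left_real[of "-1" "0::real"] by (auto elim!: eventually_mono simp: flat_exp_def)
    qed
    ultimately have "((\<lambda>h. flat_exp c q h / h) \<longlongrightarrow> 0) (at 0)" by (simp add: filterlim_split_at)
    then show ?thesis using 3 by (simp add: DERIV_def flat_exp_def[of _ _ 0])
  qed
qed

definition box_bump :: "real \<Rightarrow> 'a::euclidean_space \<Rightarrow> 'a \<Rightarrow> 'a \<Rightarrow> real" where
  "box_bump c a b x = (\<Prod>i\<in>Basis. flat_exp c 1 (x \<bullet> i - a \<bullet> i) * flat_exp c 1 (b \<bullet> i - x \<bullet> i))"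

lemma C_k_box_bump:
  assumes c: "c > 0"
  shows "C_k k (box_bump c a b)"
proof -
  \<comment> \<open>\<open>T\<close> acts on the polynomial factor as differentiation acts on
    \<open>flat_exp\<close>; its iterates supply the chain of derivatives for
    \<open>C_k_ridge\<close>.\<close>
  define T where "T q = [:0, 0, 1:] * (smult c q - pderiv q)" for q
  define F where "F m = flat_exp c ((T ^^ m) 1)" for m
  have F: "(F m has_real_derivative F (Suc m) t) (at t)" for m t
    unfolding F_def using flat_exp_derivative[OF c, of "(T ^^ m) 1" t] by (simp add: T_def)
  have "C_k k (\<lambda>x. F 0 (x \<bullet> i + - (a \<bullet> i)) * F 0 (x \<bullet> (- i) + b \<bullet> i))" for i
    by (intro C_k_mult C_k_ridge F)
  then have "C_k k (\<lambda>x. \<Prod>i\<in>Basis. F 0 (x \<bullet> i + - (a \<bullet> i)) * F 0 (x \<bullet> (- i) + b \<bullet> i))"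
    by (intro C_k_prod)
  then show ?thesis by (simp add: box_bump_def[abs_def] F_def)
qed

lemma box_bump_bounds:
  assumes "c > 0"
  shows "0 \<le> box_bump c a b x" "box_bump c a b x \<le> 1"
  unfolding box_bump_def using assms
  by (auto intro!: prod_nonneg prod_le_1 mult_le_one simp: flat_exp_def)

lemma box_bump_nonzero_iff: "box_bump c a b x \<noteq> 0 \<longleftrightarrow> x \<in> box a b"
  by (auto simp: box_bump_def flat_exp_def mem_box)

lemma box_bump_tendsto:
  "(\<lambda>k. box_bump (1 / real (Suc k)) a b x) \<longlonglongrightarrow> indicator (box a b) x"
proof (cases "x \<in> box a b")
  case True
  have lim: "(\<lambda>k. flat_exp (1 / real (Suc k)) 1 t) \<longlonglongrightarrow> 1" if "t > 0" for t
  proof -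
    have "(\<lambda>k. exp (- (1 / real (Suc k)) / t)) \<longlonglongrightarrow> exp (- 0 / t)"
      by (intro tendsto_intros LIMSEQ_Suc[OF lim_1_over_n]) (use that in auto)
    then show ?thesis using that by (simp add: flat_exp_def)
  qed
  have "(\<lambda>k. box_bump (1 / real (Suc k)) a b x) \<longlonglongrightarrow> (\<Prod>i\<in>(Basis::'a set). 1 * 1)"
    unfolding box_bump_def using True by (intro tendsto_prod tendsto_mult lim) (auto simp: mem_box)
  then show ?thesis using True by simp
next
  case False
  then have "box_bump c a b x = 0" for c using box_bump_nonzero_iff by blast
  then show ?thesis using False by simp
qed

lemma test_function_box_bump:
  assumes "c > 0" "cbox a b \<subseteq> \<Omega>"
  shows "test_function \<Omega> (box_bump c a b)"
proof -
  have "closure {x. box_bump c a b x \<noteq> 0} \<subseteq> cbox a b"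
    by (intro closure_minimal) (auto simp: box_bump_nonzero_iff box_subset_cbox[THEN subsetD])
  moreover from this have "compact (closure {x. box_bump c a b x \<noteq> 0})"
    by (metis bounded_cbox bounded_subset closed_closure compact_eq_bounded_closed)
  ultimately show ?thesis using assms C_k_box_bump by (auto simp: test_function_def)
qed

lemma continuous_C_k: "C_k k f \<Longrightarrow> continuous_on UNIV f"
  by (induction k arbitrary: f) (auto dest: C_k_SucD simp del: C_k.simps(2))

lemma borel_measurable_C_k: "C_k k f \<Longrightarrow> f \<in> borel_measurable borel"
  by (rule borel_measurable_continuous_onI[OF continuous_C_k])

section \<open>Integrals and null sets on subsets\<close>

lemma lebesgue_on_integral:
  fixes f :: "'a::euclidean_space \<Rightarrow> 'b::euclidean_space"
  assumes "S \<in> sets lebesgue"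
  shows "integral\<^sup>L (lebesgue_on S) f = (LINT x|lebesgue. indicator S x *\<^sub>R f x)"
    and "integrable (lebesgue_on S) f \<longleftrightarrow> integrable lebesgue (\<lambda>x. indicator S x *\<^sub>R f x)"
  using assms by (auto simp: integral_restrict_space integrable_restrict_space)

lemma integrable_lebesgue_onI:
  fixes f :: "'a::euclidean_space \<Rightarrow> 'b::euclidean_space"
  shows "integrable lebesgue f \<Longrightarrow> S \<in> sets lebesgue \<Longrightarrow> integrable (lebesgue_on S) f"
  unfolding lebesgue_on_integral(2) by (rule integrable_mult_indicator)

lemma AE_lebesgue_on_iff:
  assumes "S \<in> sets lebesgue"
  shows "(AE x in lebesgue_on S. P x) \<longleftrightarrow> negligible {x \<in> S. \<not> P x}"
proof -
  have "(AE x in lebesgue_on S. P x) \<longleftrightarrow> (AE x in lebesgue. x \<in> S \<longrightarrow> P x)"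
    using assms by (subst AE_restrict_space_iff) auto
  also have "\<dots> \<longleftrightarrow> negligible {x \<in> S. \<not> P x}"
  proof
    assume "AE x in lebesgue. x \<in> S \<longrightarrow> P x"
    then obtain N where "N \<in> null_sets lebesgue" "{x \<in> space lebesgue. \<not> (x \<in> S \<longrightarrow> P x)} \<subseteq> N"
      by (auto elim: AE_E simp: eventually_ae_filter)
    then show "negligible {x \<in> S. \<not> P x}"
      by (auto simp: negligible_iff_null_sets[symmetric] elim!: negligible_subset)
  next
    assume "negligible {x \<in> S. \<not> P x}"
    then have "{x \<in> S. \<not> P x} \<in> null_sets lebesgue" by (simp add: negligible_iff_null_sets)
    from AE_not_in[OF this] show "AE x in lebesgue. x \<in> S \<longrightarrow> P x" by eventually_elim auto
  qed
  finally show ?thesis .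
qed

section \<open>Uniqueness of weak gradients\<close>

text \<open>The fundamental lemma of the calculus of variations. Bumps converge boundedly to
  indicators of boxes, so \<open>g\<close> integrates to zero over every subbox, and Lebesgue
  differentiation gives g = 0 almost everywhere.\<close>

lemma negligible_if_integral_bump_0:
  fixes g :: "'a::euclidean_space \<Rightarrow> real"
  assumes int: "integrable (lebesgue_on (cbox a b)) g"
    and zero: "\<And>c d e. cbox c d \<subseteq> cbox a b \<Longrightarrow> e > 0 \<Longrightarrow> (LINT x|lebesgue_on (cbox a b). g x * box_bump e c d x) = 0"
  shows "negligible {x \<in> box a b. g x \<noteq> 0}"
proof -
  define g' where "g' x = indicator (cbox a b) x *\<^sub>R g x" for x
  have g': "integrable lebesgue g'"
    using int by (simp add: lebesgue_on_integral g'_def[abs_def])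
  have box0: "integral (cbox c d) g' = 0" if cd: "cbox c d \<subseteq> cbox a b" for c d
  proof -
    have "(\<lambda>k. LINT x|lebesgue. g' x * box_bump (1 / real (Suc k)) c d x) \<longlonglongrightarrow> (LINT x|lebesgue. g' x * indicator (box c d) x)"
    proof (rule integral_dominated_convergence)
      show "integrable lebesgue (\<lambda>x. norm (g' x))" using g' by simp
      show "AE x in lebesgue. (\<lambda>k. g' x * box_bump (1 / real (Suc k)) c d x) \<longlonglongrightarrow> g' x * indicator (box c d) x"
        by (intro AE_I2 tendsto_mult tendsto_const box_bump_tendsto)
      have "box_bump e c d \<in> borel_measurable lebesgue" if "e > 0" for e
        using borel_measurable_C_k[OF C_k_box_bump[OF that, of 0 c d]] by (intro measurable_completion) simp
      then show "(\<lambda>x. g' x * box_bump (1 / real (Suc k)) c d x) \<in> borel_measurable lebesgue" for k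
        using g' by (intro borel_measurable_times) auto
      show "AE x in lebesgue. norm (g' x * box_bump (1 / real (Suc k)) c d x) \<le> norm (g' x)" for k
        using box_bump_bounds[of "1 / real (Suc k)" c d] by (auto intro!: AE_I2 simp: abs_mult mult_left_le)
      show "(\<lambda>x. g' x * indicator (box c d) x) \<in> borel_measurable lebesgue"
        using g' by (intro borel_measurable_times borel_measurable_indicator) auto
    qed
    moreover have "(LINT x|lebesgue. g' x * box_bump (1 / real (Suc k)) c d x) = 0" for k
      using zero[OF cd, of "1 / real (Suc k)"] by (simp add: lebesgue_on_integral g'_def mult.assoc)
    ultimately have "(LINT x|lebesgue. g' x * indicator (box c d) x) = 0"
      by (simp add: LIMSEQ_const_iff)
    then have "(LINT x|lebesgue_on (box c d). g' x) = 0"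
      by (simp add: lebesgue_on_integral mult.commute)
    moreover have "integrable (lebesgue_on (box c d)) g'"
      using g' by (intro integrable_lebesgue_onI) auto
    ultimately have "integral (box c d) g' = 0" by (simp add: lebesgue_integral_eq_integral)
    then show ?thesis by (simp add: integral_open_interval)
  qed
  have "g' integrable_on cbox c d" for c d
  proof -
    have "integrable (lebesgue_on (cbox c d)) g'"
      using g' by (intro integrable_lebesgue_onI) auto
    then show ?thesis by (rule integrable_on_lebesgue_on) simp
  qed
  \<comment> \<open>Lebesgue differentiation along cubes with corner \<open>x\<close>. A vanishing
    cube average cannot be closer to g'(x) than |g'(x)|, which excludes g'(x) nonzero outside
    \<open>N\<close>.\<close>
  then obtain N where N: "negligible N" and lim: "\<And>x e. \<lbrakk>x \<notin> N; 0 < e\<rbrakk> \<Longrightarrow>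
      \<exists>d>0. \<forall>h. 0 < h \<and> h < d \<longrightarrow> norm (integral (cbox x (x + h *\<^sub>R One)) g' /\<^sub>R h ^ DIM('a) - g' x) < e"
    using integrable_ccontinuous_explicit[of g'] by blast
  have "{x \<in> box a b. g x \<noteq> 0} \<subseteq> N"
  proof clarify
    fix x assume x: "x \<in> box a b" "g x \<noteq> 0"
    show "x \<in> N"
    proof (rule ccontr)
      assume "x \<notin> N"
      have g'x: "g' x \<noteq> 0" using x box_subset_cbox[of a b] by (auto simp: g'_def)
      then obtain d where d: "d > 0" "\<And>h. 0 < h \<and> h < d \<Longrightarrow> norm (integral (cbox x (x + h *\<^sub>R One)) g' /\<^sub>R h ^ DIM('a) - g' x) < norm (g' x)"
        using lim[OF \<open>x \<notin> N\<close>, of "norm (g' x)"] by auto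
      define m where "m = Min ((\<lambda>i. b \<bullet> i - x \<bullet> i) ` (Basis :: 'a set))"
      have m: "m > 0" "\<And>i. i \<in> Basis \<Longrightarrow> m \<le> b \<bullet> i - x \<bullet> i"
        using x(1) by (auto simp: m_def mem_box)
      define h where "h = min m d / 2"
      have h: "0 < h" "h < d" "h \<le> m" using m d by (auto simp: h_def)
      have "cbox x (x + h *\<^sub>R One) \<subseteq> cbox a b"
        using x(1) m(2) h by (auto simp: subset_box mem_box inner_add_left less_imp_le) (smt (verit))+
      then show False using d(2)[of h] h box0 by auto
    qed
  qed
  then show ?thesis using N negligible_subset by blast
qed

text \<open>This makes the choice in \<open>weak_gradient\<close> harmless: any known weak gradient
  may replace it under an integral. Local integrability confines the argument to closed boxes,
  countably many of which fill the open set.\<close>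

lemma weak_gradient_unique:
  assumes \<Omega>: "open \<Omega>" and G: "has_weak_gradient \<Omega> u G" and G': "has_weak_gradient \<Omega> u G'"
  shows "AE x in lebesgue_on \<Omega>. G x = G' x"
proof -
  have comp: "negligible {x \<in> box a b. G x $ i $ j - G' x $ i $ j \<noteq> 0}" if ab: "cbox a b \<subseteq> \<Omega>" for a b i j
  proof (rule negligible_if_integral_bump_0)
    have loc: "integrable (lebesgue_on (cbox a b)) (\<lambda>x. H x $ i $ j)" if "has_weak_gradient \<Omega> u H" for H
    proof -
      have "integrable (lebesgue_on (cbox a b)) H"
        using that ab compact_cbox by (auto simp: has_weak_gradient_def locally_integrable_on_def)
      then show ?thesis by (intro integrable_bounded_linear[OF bounded_linear_vec_nth])
    qed
    show "integrable (lebesgue_on (cbox a b)) (\<lambda>x. G x $ i $ j - G' x $ i $ j)"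
      using loc[OF G] loc[OF G'] by simp
    fix c d :: "real ^ 'a" and e :: real assume cd: "cbox c d \<subseteq> cbox a b" and e: "e > 0"
    let ?\<phi> = "box_bump e c d"
    have test: "test_function \<Omega> ?\<phi>" using cd ab e by (intro test_function_box_bump) auto
    have meas: "?\<phi> \<in> borel_measurable (lebesgue_on (cbox a b))"
      using borel_measurable_C_k[OF C_k_box_bump[OF e, of 0 c d]]
      by (intro measurable_restrict_space1 measurable_completion) simp
    have prod: "integrable (lebesgue_on (cbox a b)) (\<lambda>x. H x $ i $ j * ?\<phi> x)" if "has_weak_gradient \<Omega> u H" for H
      by (rule Bochner_Integration.integrable_bound[OF loc[OF that]])
        (use meas loc[OF that] box_bump_bounds[OF e, of c d] in \<open>auto intro!: AE_I2 simp: abs_mult mult_left_le\<close>)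
    \<comment> \<open>The bump vanishes off its box, which moves the integral to a compact box where
      the gradient entries are integrable.\<close>
    have restr: "(LINT x|lebesgue_on \<Omega>. H x $ i $ j * ?\<phi> x) = (LINT x|lebesgue_on (cbox a b). H x $ i $ j * ?\<phi> x)" for H
    proof -
      have "indicator \<Omega> x *\<^sub>R (H x $ i $ j * ?\<phi> x) = indicator (cbox a b) x *\<^sub>R (H x $ i $ j * ?\<phi> x)" for x
        using box_bump_nonzero_iff[of e c d x] box_subset_cbox[of c d] cd ab by (auto simp: indicator_def)
      then have "(LINT x|lebesgue. indicator \<Omega> x *\<^sub>R (H x $ i $ j * ?\<phi> x)) =
          (LINT x|lebesgue. indicator (cbox a b) x *\<^sub>R (H x $ i $ j * ?\<phi> x))" by presburger
      then show ?thesis using \<Omega> by (subst (1 2) lebesgue_on_integral(1)) (auto simp: borel_open)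
    qed
    have "(LINT x|lebesgue_on \<Omega>. u x $ i * frechet_derivative ?\<phi> (at x) (axis j 1)) =
        - (LINT x|lebesgue_on \<Omega>. H x $ i $ j * ?\<phi> x)" if "has_weak_gradient \<Omega> u H" for H
      using that test unfolding has_weak_gradient_def by blast
    from this[OF G] this[OF G']
    have "(LINT x|lebesgue_on \<Omega>. G x $ i $ j * ?\<phi> x) = (LINT x|lebesgue_on \<Omega>. G' x $ i $ j * ?\<phi> x)"
      by linarith
    then show "(LINT x|lebesgue_on (cbox a b). (G x $ i $ j - G' x $ i $ j) * ?\<phi> x) = 0"
      using prod[OF G] prod[OF G'] by (simp add: left_diff_distrib restr)
  qed
  have neg: "negligible {x \<in> X. G x \<noteq> G' x}" if X: "X \<subseteq> \<Omega>" "X = cbox a b" for X a b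
  proof (rule negligible_subset)
    show "negligible ((cbox a b - box a b) \<union> (\<Union>i. \<Union>j. {x \<in> box a b. G x $ i $ j - G' x $ i $ j \<noteq> 0}))"
      using comp X by (intro negligible_Un negligible_frontier_interval negligible_Union) (auto intro!: negligible_Union)
    show "{x \<in> X. G x \<noteq> G' x} \<subseteq> (cbox a b - box a b) \<union> (\<Union>i. \<Union>j. {x \<in> box a b. G x $ i $ j - G' x $ i $ j \<noteq> 0})"
      using X by (auto simp: vec_eq_iff)
  qed
  obtain \<D> where \<D>: "countable \<D>" "\<D> \<subseteq> Pow \<Omega>" "\<And>X. X \<in> \<D> \<Longrightarrow> \<exists>a b. X = cbox a b" "\<Union>\<D> = \<Omega>"
    using open_countable_Union_open_cbox[OF \<Omega>] by metis
  have "negligible (\<Union>X\<in>\<D>. {x \<in> X. G x \<noteq> G' x})"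
    using \<D>(1-3) neg by (intro negligible_countable_Union) blast+
  moreover have "(\<Union>X\<in>\<D>. {x \<in> X. G x \<noteq> G' x}) = {x \<in> \<Omega>. G x \<noteq> G' x}" using \<D>(4) by blast
  ultimately show ?thesis using \<Omega> by (simp add: AE_lebesgue_on_iff borel_open)
qed

section \<open>Mollification\<close>

lemma lborel_distr_reflect: "distr lborel borel (\<lambda>z. x - z) = (lborel :: 'a::euclidean_space measure)"
  using lborel_affine[of "-1" x] by (simp add: density_1)

lemma LINT_lborel_reflect:
  fixes f :: "'a::euclidean_space \<Rightarrow> 'b::euclidean_space"
  assumes "f \<in> borel_measurable borel"
  shows "(LINT y|lborel. f y) = (LINT z|lborel. f (x - z))"
  using integral_distr[of "\<lambda>z. x - z" lborel borel f] assms by (simp add: lborel_distr_reflect)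

lemma LINT_lborel_translate:
  fixes f :: "'a::euclidean_space \<Rightarrow> 'b::euclidean_space"
  assumes "f \<in> borel_measurable borel"
  shows "(LINT y|lborel. f y) = (LINT z|lborel. f (x + z))"
  using integral_distr[of "(+) x" lborel borel f] assms by (simp add: lborel_distr_plus)

lemma integrable_lborel_cont_support:
  fixes f :: "'a::euclidean_space \<Rightarrow> 'b::euclidean_space"
  assumes "continuous_on UNIV f" "compact S" "\<And>x. x \<notin> S \<Longrightarrow> f x = 0"
  shows "integrable lborel f"
proof -
  have "integrable lborel (\<lambda>x. indicator S x *\<^sub>R f x)"
    using assms by (intro borel_integrable_compact) (auto intro: continuous_on_subset)
  moreover have "(\<lambda>x. indicator S x *\<^sub>R f x) = f" using assms(3) by (auto simp: indicator_def)
  ultimately show ?thesis by simp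
qed

definition convolution :: "('a::euclidean_space \<Rightarrow> real) \<Rightarrow> ('a \<Rightarrow> 'b::euclidean_space) \<Rightarrow> 'a \<Rightarrow> 'b" where
  "convolution \<rho> w x = (LINT y|lborel. \<rho> (x - y) *\<^sub>R w y)"

text \<open>Passage to the gauge integral over one fixed box, the setting in which continuity and
  differentiation under the integral are applied.\<close>

lemma convolution_eq_integral:
  fixes w :: "'a::euclidean_space \<Rightarrow> 'b::euclidean_space"
  assumes \<rho>: "continuous_on UNIV \<rho>" and w: "continuous_on UNIV w" "\<And>y. y \<notin> cbox a b \<Longrightarrow> w y = 0"
  shows "convolution \<rho> w x = integral (cbox a b) (\<lambda>y. \<rho> (x - y) *\<^sub>R w y)"
proof -
  have c: "continuous_on UNIV (\<lambda>y. \<rho> (x - y) *\<^sub>R w y)"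
    using w(1) by (intro continuous_intros continuous_on_compose2[OF \<rho>]) auto
  have "set_integrable lborel (cbox a b) (\<lambda>y. \<rho> (x - y) *\<^sub>R w y)"
    unfolding set_integrable_def by (intro borel_integrable_compact continuous_on_subset[OF c]) auto
  from set_borel_integral_eq_integral(2)[OF this]
  have "integral (cbox a b) (\<lambda>y. \<rho> (x - y) *\<^sub>R w y) = (LINT y|lborel. indicator (cbox a b) y *\<^sub>R (\<rho> (x - y) *\<^sub>R w y))"
    by (simp add: set_lebesgue_integral_def)
  also have "(\<lambda>y. indicator (cbox a b) y *\<^sub>R (\<rho> (x - y) *\<^sub>R w y)) = (\<lambda>y. \<rho> (x - y) *\<^sub>R w y)"
    by (rule ext) (use w(2) in \<open>auto simp: indicator_def of_bool_def\<close>)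
  finally show ?thesis by (simp add: convolution_def)
qed

text \<open>All derivatives fall on the kernel: a partial derivative of the convolution is the
  convolution with that partial derivative of \<open>\<rho>\<close>. The induction therefore
  generalizes over \<open>\<rho>\<close> while \<open>w\<close> stays merely continuous.\<close>

lemma C_k_convolution:
  fixes w :: "'a::euclidean_space \<Rightarrow> 'b::euclidean_space"
  assumes \<rho>: "\<And>k. C_k k \<rho>" and w: "continuous_on UNIV w" "\<And>y. y \<notin> cbox a b \<Longrightarrow> w y = 0"
  shows "C_k k (convolution \<rho> w)"
proof -
  have conv: "convolution \<rho> w = (\<lambda>x. integral (cbox a b) (\<lambda>y. \<rho> (x - y) *\<^sub>R w y))"
    if "continuous_on UNIV \<rho>" for \<rho>
    by (rule ext) (rule convolution_eq_integral[OF that w])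
  show ?thesis
    using \<rho>
  proof (induction k arbitrary: \<rho>)
    case 0
    have "continuous_on (UNIV \<times> cbox a b) (\<lambda>p. \<rho> (fst p - snd p) *\<^sub>R w (snd p))"
      by (intro continuous_intros continuous_on_compose2[OF continuous_C_k[OF 0[of 0]]]
          continuous_on_compose2[OF w(1)]) auto
    then have "continuous_on UNIV (\<lambda>x. integral (cbox a b) (\<lambda>y. \<rho> (x - y) *\<^sub>R w y))"
      by (intro integral_continuous_on_param) (simp add: case_prod_beta)
    then show ?case
      unfolding C_k.simps conv[OF continuous_C_k[OF 0[of 0]]] .
  next
    case (Suc k)
    define d where "d i x = frechet_derivative \<rho> (at x) i" for i x
    have Cd: "C_k m (d i)" if "i \<in> Basis" for m i
      using Suc.prems[of "Suc m"] that by (simp add: d_def[abs_def])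
    have cd: "continuous_on UNIV (d i)" if "i \<in> Basis" for i using continuous_C_k[OF Cd[OF that, of 0]] .
    have D: "(\<rho> has_derivative frechet_derivative \<rho> (at x)) (at x)" for x
      by (rule C_k_Suc_has_derivative[OF Suc.prems[of 1, unfolded One_nat_def]])
    \<comment> \<open>The derivative as a bounded linear map, expanded over the basis so that its
      joint continuity follows from that of the partial derivatives.\<close>
    define fx where "fx x t = (\<Sum>i\<in>Basis. d i (x - t) *\<^sub>R (blinfun_scaleR_left (w t) o\<^sub>L blinfun_inner_left i))" for x t
    have fx: "blinfun_apply (fx x t) h = frechet_derivative \<rho> (at (x - t)) h *\<^sub>R w t" for x t h
    proof -
      interpret linear "frechet_derivative \<rho> (at (x - t))" by (rule has_derivative_linear[OF D])
      have "frechet_derivative \<rho> (at (x - t)) h = frechet_derivative \<rho> (at (x - t)) (\<Sum>i\<in>Basis. (h \<bullet> i) *\<^sub>R i)"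
        by (simp add: euclidean_representation)
      also have "\<dots> = (\<Sum>i\<in>Basis. (h \<bullet> i) * d i (x - t))" by (simp add: sum scale d_def)
      finally show ?thesis
        by (simp add: fx_def blinfun.sum_left blinfun.scaleR_left scaleR_sum_left mult.commute)
    qed
    have cfx: "continuous_on (UNIV \<times> cbox a b) (\<lambda>p. fx (fst p) (snd p))"
      unfolding fx_def
      by (intro continuous_intros continuous_on_compose2[OF cd] continuous_on_compose2[OF w(1)]
          bounded_linear.continuous_on[OF bounded_linear_blinfun_scaleR_left]) auto
    have der: "((\<lambda>x. integral (cbox a b) (\<lambda>y. \<rho> (x - y) *\<^sub>R w y)) has_derivative integral (cbox a b) (fx x0)) (at x0)" for x0
    proof (rule leibniz_rule[where U = UNIV])
      fix x t :: 'a
      have "((\<lambda>x. x - t) has_derivative (\<lambda>h. h)) (at x)" by (auto intro!: derivative_eq_intros)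
      from has_derivative_compose[OF this D]
      have "((\<lambda>x. \<rho> (x - t)) has_derivative frechet_derivative \<rho> (at (x - t))) (at x)" .
      then have "((\<lambda>x. \<rho> (x - t) *\<^sub>R w t) has_derivative (\<lambda>h. frechet_derivative \<rho> (at (x - t)) h *\<^sub>R w t)) (at x)"
        by (rule has_derivative_scaleR_left)
      then show "((\<lambda>x. \<rho> (x - t) *\<^sub>R w t) has_derivative blinfun_apply (fx x t)) (at x)"
        using fx[of x t] by (metis (no_types, lifting) ext)
      show "(\<lambda>y. \<rho> (x - y) *\<^sub>R w y) integrable_on cbox a b"
        by (intro integrable_continuous continuous_intros continuous_on_compose2[OF continuous_C_k[OF Suc.prems[of 0]]]
            continuous_on_subset[OF w(1)]) auto
    qed (use cfx in \<open>auto simp: case_prod_beta\<close>)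
    have "fx x integrable_on cbox a b" for x
    proof (rule integrable_continuous)
      show "continuous_on (cbox a b) (fx x)"
        using continuous_on_compose2[OF cfx continuous_on_Pair[OF continuous_on_const[of _ x] continuous_on_id, of "cbox a b"]]
        by auto
    qed
    from integral_linear[OF this bounded_linear_apply_blinfun]
    have app: "blinfun_apply (integral (cbox a b) (fx x)) i = integral (cbox a b) (\<lambda>t. d i (x - t) *\<^sub>R w t)" for x i
      by (simp add: o_def fx d_def)
    show ?case
    proof (rule C_k_SucI)
      show "(convolution \<rho> w has_derivative blinfun_apply (integral (cbox a b) (fx x))) (at x)" for x
        using der unfolding conv[OF continuous_C_k[OF Suc.prems[of 0]]] .
      fix i :: 'a assume i: "i \<in> Basis"
      have "C_k k (convolution (d i) w)" by (rule Suc.IH) (rule Cd[OF i])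
      then show "C_k k (\<lambda>x. blinfun_apply (integral (cbox a b) (fx x)) i)"
        unfolding conv[OF cd[OF i]] app .
    qed
  qed
qed

section \<open>Mollifiers and their averages\<close>

definition mollifier :: "real \<Rightarrow> ('a::euclidean_space \<Rightarrow> real) \<Rightarrow> bool" where
  "mollifier r \<rho> \<longleftrightarrow> (\<forall>k. C_k k \<rho>) \<and> (\<forall>z. 0 \<le> \<rho> z) \<and> (\<forall>z. \<rho> z \<noteq> 0 \<longrightarrow> norm z \<le> r) \<and>
     (LINT z|lborel. \<rho> z) = 1"

lemma mollifier_exists:
  assumes "r > 0"
  obtains \<rho> :: "'a::euclidean_space \<Rightarrow> real" where "mollifier r \<rho>"
proof -
  obtain a b :: 'a where ab: "cbox a b \<subseteq> ball 0 r" "0 \<in> box a b"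
    using open_contains_cbox[of "ball 0 r" 0] assms by (metis centre_in_ball open_ball)
  define \<phi> where "\<phi> = box_bump 1 a b"
  have C: "C_k k \<phi>" for k unfolding \<phi>_def by (rule C_k_box_bump) simp
  have pos: "0 \<le> \<phi> z" for z using box_bump_bounds[of 1 a b z] by (simp add: \<phi>_def)
  have nz: "\<phi> z \<noteq> 0 \<longleftrightarrow> z \<in> box a b" for z by (simp add: \<phi>_def box_bump_nonzero_iff)
  have int: "integrable lborel \<phi>"
    using nz box_subset_cbox[of a b]
    by (intro integrable_lborel_cont_support[OF continuous_C_k[OF C[of 0]] compact_cbox[of a b]]) blast
  \<comment> \<open>Normalization divides by this integral. Were it zero, the nonnegative bump would
    vanish almost everywhere, although it is nonzero on a nonempty open box.\<close>
  have "(LINT z|lborel. \<phi> z) \<noteq> 0"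
  proof
    assume "(LINT z|lborel. \<phi> z) = 0"
    then have "AE z in lborel. \<phi> z = 0" using int pos by (subst (asm) integral_nonneg_eq_0_iff_AE) auto
    then have "{z. \<phi> z \<noteq> 0} \<in> null_sets lborel"
      using borel_measurable_C_k[OF C[of 0]] by (subst AE_iff_null_sets) auto
    then have "negligible (box a b)"
      by (simp add: nz negligible_iff_null_sets null_sets_completionI)
    then show False using ab(2) open_not_negligible[OF open_box] by blast
  qed
  moreover have "0 \<le> (LINT z|lborel. \<phi> z)" using pos by (intro integral_nonneg_AE) auto
  ultimately have I: "0 < (LINT z|lborel. \<phi> z)" by simp
  have "C_k k (\<lambda>z. \<phi> z / (LINT z|lborel. \<phi> z))" for k
    using C_k_mult[OF C_k_const C, of k "1 / (LINT z|lborel. \<phi> z)"] by simp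
  then have "mollifier r (\<lambda>z. \<phi> z / (LINT z|lborel. \<phi> z))"
    using I pos nz ab(1) box_subset_cbox[of a b]
    by (auto simp: mollifier_def subset_iff intro!: less_imp_le)
  then show ?thesis by (rule that)
qed

lemma convolution_flip:
  fixes w :: "'a::euclidean_space \<Rightarrow> 'b::euclidean_space"
  assumes \<rho>: "mollifier r \<rho>" and w: "continuous_on UNIV w"
  shows "convolution \<rho> w x = (LINT z|lborel. \<rho> z *\<^sub>R w (x - z))"
proof -
  have c: "continuous_on UNIV \<rho>" using \<rho> continuous_C_k unfolding mollifier_def by blast
  have "continuous_on UNIV (\<lambda>y. \<rho> (x - y) *\<^sub>R w y)"
    by (intro continuous_intros continuous_on_compose2[OF c] w) auto
  from LINT_lborel_reflect[OF borel_measurable_continuous_onI[OF this], of x] show ?thesis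
    by (simp add: convolution_def)
qed

lemma mollifier_integrable:
  fixes h :: "'a::euclidean_space \<Rightarrow> 'b::euclidean_space"
  assumes \<rho>: "mollifier r \<rho>" and h: "continuous_on UNIV h"
  shows "integrable lborel (\<lambda>z. \<rho> z *\<^sub>R h z)"
proof (rule integrable_lborel_cont_support)
  have c: "continuous_on UNIV \<rho>" using \<rho> continuous_C_k unfolding mollifier_def by blast
  show "continuous_on UNIV (\<lambda>z. \<rho> z *\<^sub>R h z)" by (intro continuous_intros c h)
  show "\<rho> z *\<^sub>R h z = 0" if "z \<notin> cball 0 r" for z using \<rho> that by (auto simp: mollifier_def)
qed simp

lemma mollifier_average_const:
  fixes c :: "'b::euclidean_space"
  assumes \<rho>: "mollifier r \<rho>"
  shows "(LINT z|lborel. \<rho> z *\<^sub>R c) = c"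
proof -
  have "integrable lborel \<rho>" using mollifier_integrable[OF \<rho>, of "\<lambda>_. 1::real"] by simp
  then show ?thesis using \<rho> by (simp add: mollifier_def)
qed

lemma mollifier_average_le:
  fixes h :: "'a::euclidean_space \<Rightarrow> 'b::euclidean_space"
  assumes \<rho>: "mollifier r \<rho>" and h: "continuous_on UNIV h" and le: "\<And>z. norm z \<le> r \<Longrightarrow> norm (h z) \<le> B"
  shows "norm (LINT z|lborel. \<rho> z *\<^sub>R h z) \<le> B"
proof -
  have "norm (LINT z|lborel. \<rho> z *\<^sub>R h z) \<le> (LINT z|lborel. norm (\<rho> z *\<^sub>R h z))" by (rule integral_norm_bound)
  also have "\<dots> \<le> (LINT z|lborel. \<rho> z *\<^sub>R B)"
  proof (rule integral_mono)
    show "integrable lborel (\<lambda>z. norm (\<rho> z *\<^sub>R h z))" using integrable_norm[OF mollifier_integrable[OF \<rho> h]] .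
    show "integrable lborel (\<lambda>z. \<rho> z *\<^sub>R B)" by (rule mollifier_integrable[OF \<rho>]) simp
    show "norm (\<rho> z *\<^sub>R h z) \<le> \<rho> z *\<^sub>R B" for z
      using \<rho> le[of z] by (cases "\<rho> z = 0") (auto simp: mollifier_def intro: mult_left_mono)
  qed
  also have "\<dots> = B" by (rule mollifier_average_const[OF \<rho>])
  finally show ?thesis .
qed

text \<open>After the substitution of \<open>convolution_flip\<close> the convolution is an average
  of translates of \<open>w\<close>, all with the same Lipschitz constant.\<close>

lemma convolution_lipschitz:
  fixes w :: "'a::euclidean_space \<Rightarrow> 'b::euclidean_space"
  assumes \<rho>: "mollifier r \<rho>" and w: "L-lipschitz_on UNIV w"
  shows "norm (convolution \<rho> w x - convolution \<rho> w y) \<le> L * norm (x - y)"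
proof -
  have c: "continuous_on UNIV w" by (rule lipschitz_on_continuous_on[OF w])
  have c': "continuous_on UNIV (\<lambda>z. w (x - z))" for x by (intro continuous_on_compose2[OF c] continuous_intros) auto
  have "convolution \<rho> w x - convolution \<rho> w y = (LINT z|lborel. \<rho> z *\<^sub>R (w (x - z) - w (y - z)))"
    using mollifier_integrable[OF \<rho> c'] by (simp add: convolution_flip[OF \<rho> c] scaleR_diff_right)
  also have "norm \<dots> \<le> L * norm (x - y)"
  proof (rule mollifier_average_le[OF \<rho>])
    show "continuous_on UNIV (\<lambda>z. w (x - z) - w (y - z))" by (intro continuous_intros c')
    show "norm (w (x - z) - w (y - z)) \<le> L * norm (x - y)" for z
      using lipschitz_onD[OF w, of "x - z" "y - z"] by (simp add: dist_norm)
  qed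
  finally show ?thesis .
qed

lemma convolution_close:
  fixes w :: "'a::euclidean_space \<Rightarrow> 'b::euclidean_space"
  assumes \<rho>: "mollifier r \<rho>" and w: "L-lipschitz_on UNIV w" and L: "0 \<le> L"
  shows "norm (convolution \<rho> w x - w x) \<le> L * r"
proof -
  have c: "continuous_on UNIV w" by (rule lipschitz_on_continuous_on[OF w])
  have c': "continuous_on UNIV (\<lambda>z. w (x - z))" by (intro continuous_on_compose2[OF c] continuous_intros) auto
  have "w x = (LINT z|lborel. \<rho> z *\<^sub>R w x)" by (simp add: mollifier_average_const[OF \<rho>])
  then have "convolution \<rho> w x - w x = (LINT z|lborel. \<rho> z *\<^sub>R (w (x - z) - w x))"
    using mollifier_integrable[OF \<rho> c'] mollifier_integrable[OF \<rho>, of "\<lambda>_. w x"]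
    by (simp add: convolution_flip[OF \<rho> c] scaleR_diff_right)
  also have "norm \<dots> \<le> L * r"
  proof (rule mollifier_average_le[OF \<rho>])
    show "continuous_on UNIV (\<lambda>z. w (x - z) - w x)" by (intro continuous_intros c')
    fix z :: 'a assume z: "norm z \<le> r"
    have "norm (w (x - z) - w x) \<le> L * norm z" using lipschitz_onD[OF w, of "x - z" x] by (simp add: dist_norm)
    also have "\<dots> \<le> L * r" using z L by (rule mult_left_mono)
    finally show "norm (w (x - z) - w x) \<le> L * r" .
  qed
  finally show ?thesis .
qed

lemma convolution_support:
  fixes w :: "'a::euclidean_space \<Rightarrow> 'b::euclidean_space"
  assumes \<rho>: "mollifier r \<rho>" and nz: "convolution \<rho> w x \<noteq> 0"
  obtains y where "w y \<noteq> 0" "norm (x - y) \<le> r"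
proof -
  have "\<exists>y. \<rho> (x - y) *\<^sub>R w y \<noteq> 0"
  proof (rule ccontr)
    assume "\<not> ?thesis"
    then have "(\<lambda>y. \<rho> (x - y) *\<^sub>R w y) = (\<lambda>y. 0)" by blast
    then show False using nz by (simp add: convolution_def)
  qed
  then show ?thesis using \<rho> that by (auto simp: mollifier_def)
qed

text \<open>Points near \<open>x\<close> average only over values in the ball where \<open>w\<close>
  is affine. The linear part is reproduced exactly, not merely in the limit; only the constant
  changes.\<close>

lemma convolution_affine_derivative:
  fixes w :: "'a::euclidean_space \<Rightarrow> 'b::euclidean_space"
  assumes \<rho>: "mollifier r \<rho>" and w: "continuous_on UNIV w" and A: "linear A"
    and aff: "\<And>y. y \<in> ball x R \<Longrightarrow> w y = A y + c" and r: "r < R"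
  shows "(convolution \<rho> w has_derivative A) (at x)"
proof -
  have cA: "continuous_on UNIV A" using A by (simp add: linear_continuous_on linear_linear)
  \<comment> \<open>The kernel is not assumed even, so its first moment may be nonzero and is
    collected in the constant.\<close>
  define e where "e = c - (LINT z|lborel. \<rho> z *\<^sub>R A z)"
  have eq: "A y + e = convolution \<rho> w y" if y: "y \<in> ball x (R - r)" for y
  proof -
    have "\<rho> z *\<^sub>R w (y - z) = \<rho> z *\<^sub>R (A y + c) - \<rho> z *\<^sub>R A z" for z
    proof (cases "\<rho> z = 0")
      case False
      then have "norm z \<le> r" using \<rho> by (auto simp: mollifier_def)
      moreover have "dist x (y - z) \<le> dist x y + norm z" using dist_triangle[of x "y - z" y] by (simp add: dist_norm)
      ultimately have "y - z \<in> ball x R" using y by simp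
      then show ?thesis by (simp add: aff linear_diff[OF A] algebra_simps)
    qed simp
    then have "convolution \<rho> w y = (LINT z|lborel. \<rho> z *\<^sub>R (A y + c) - \<rho> z *\<^sub>R A z)"
      by (simp add: convolution_flip[OF \<rho> w])
    also have "\<dots> = (LINT z|lborel. \<rho> z *\<^sub>R (A y + c)) - (LINT z|lborel. \<rho> z *\<^sub>R A z)"
      by (intro Bochner_Integration.integral_diff mollifier_integrable[OF \<rho>] cA continuous_on_const)
    also have "(LINT z|lborel. \<rho> z *\<^sub>R (A y + c)) = A y + c"
      by (rule mollifier_average_const[OF \<rho>])
    finally show ?thesis by (simp add: e_def)
  qed
  have "((\<lambda>y. A y + e) has_derivative A) (at x)"
    using has_derivative_add[OF linear_imp_has_derivative[OF A] has_derivative_const] by simp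
  then show ?thesis
    by (rule has_derivative_transform_within_open[where s = "ball x (R - r)"]) (use eq r in auto)
qed

section \<open>Integration by parts for Lipschitz functions\<close>

lemma directional_quotient_tendsto:
  fixes f :: "'a::real_normed_vector \<Rightarrow> 'b::real_normed_vector"
  assumes "(f has_derivative D) (at x)"
  shows "(\<lambda>k. (f (x + (1 / real (Suc k)) *\<^sub>R v) - f x) /\<^sub>R (1 / real (Suc k))) \<longlonglongrightarrow> D v"
proof -
  have lin: "linear D" using assms by (rule has_derivative_linear)
  have "((\<lambda>s. x + s *\<^sub>R v) has_derivative (\<lambda>s. s *\<^sub>R v)) (at 0)" by (auto intro!: derivative_eq_intros)
  from has_derivative_compose[OF this, of f D] assms
  have "((\<lambda>s. f (x + s *\<^sub>R v)) has_vector_derivative D v) (at 0)"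
    by (simp add: has_vector_derivative_def linear_scale[OF lin])
  then have "((\<lambda>s. norm (f (x + s *\<^sub>R v) - f x - s *\<^sub>R D v) / norm s) \<longlongrightarrow> 0) (at 0)"
    by (simp add: has_vector_derivative_def has_derivative_at)
  then have "((\<lambda>s. norm ((f (x + s *\<^sub>R v) - f x) /\<^sub>R s - D v)) \<longlongrightarrow> 0) (at 0)"
  proof (rule Lim_transform_eventually)
    have "norm (a - s *\<^sub>R D v) / norm s = norm (a /\<^sub>R s - D v)" if "s \<noteq> 0" for s a
    proof -
      have "a /\<^sub>R s - D v = (a - s *\<^sub>R D v) /\<^sub>R s" using that by (simp add: scaleR_diff_right)
      then show ?thesis by (simp add: divide_inverse mult.commute)
    qed
    then show "\<forall>\<^sub>F s in at 0. norm (f (x + s *\<^sub>R v) - f x - s *\<^sub>R D v) / norm s = norm ((f (x + s *\<^sub>R v) - f x) /\<^sub>R s - D v)"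
      by (auto simp: eventually_at_filter)
  qed
  then have lim: "((\<lambda>s. (f (x + s *\<^sub>R v) - f x) /\<^sub>R s) \<longlongrightarrow> D v) (at 0)"
    by (simp add: tendsto_norm_zero_iff LIM_zero_iff)
  have "filterlim (\<lambda>k. 1 / real (Suc k)) (at 0) sequentially"
    unfolding filterlim_at using LIMSEQ_Suc[OF lim_1_over_n[where 'a = real]] by (simp del: of_nat_Suc)
  from filterlim_compose[OF lim this] show ?thesis .
qed

lemma derivative_le_lipschitz:
  fixes f :: "'a::real_normed_vector \<Rightarrow> 'b::real_normed_vector"
  assumes D: "(f has_derivative D) (at x)" and L: "\<And>y. norm (f y - f x) \<le> L * norm (y - x)"
  shows "norm (D v) \<le> L * norm v"
proof (rule Lim_bounded[OF tendsto_norm[OF directional_quotient_tendsto[OF D]]])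
  show "\<forall>k\<ge>0. norm ((f (x + (1 / real (Suc k)) *\<^sub>R v) - f x) /\<^sub>R (1 / real (Suc k))) \<le> L * norm v"
  proof (intro allI impI)
    fix k
    have "norm (f (x + (1 / real (Suc k)) *\<^sub>R v) - f x) \<le> L * norm ((1 / real (Suc k)) *\<^sub>R v)"
      using L[of "x + (1 / real (Suc k)) *\<^sub>R v"] by simp
    then have "norm (f (x + (1 / real (Suc k)) *\<^sub>R v) - f x) * real (Suc k) \<le> L * norm ((1 / real (Suc k)) *\<^sub>R v) * real (Suc k)"
      by (rule mult_right_mono) simp
    then show "norm ((f (x + (1 / real (Suc k)) *\<^sub>R v) - f x) /\<^sub>R (1 / real (Suc k))) \<le> L * norm v"
      by (simp add: mult.commute)
  qed
qed

lemma test_function_zero: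
  "test_function \<Omega> \<phi> \<Longrightarrow> x \<notin> \<Omega> \<Longrightarrow> \<phi> x = 0"
  using closure_subset[of "{x. \<phi> x \<noteq> 0}"] by (auto simp: test_function_def)

lemma test_function_derivative_zero:
  assumes "x \<notin> closure {x. \<phi> x \<noteq> 0}"
  shows "frechet_derivative \<phi> (at x) = (\<lambda>_. 0)"
proof -
  have "(\<phi> has_derivative (\<lambda>_. 0)) (at x)"
    by (rule has_derivative_transform_within_open[OF has_derivative_const[of 0], of "- closure {x. \<phi> x \<noteq> 0}"])
      (use assms closure_subset[of "{x. \<phi> x \<noteq> 0}"] in auto)
  then show ?thesis by (rule frechet_derivative_at[symmetric])
qed

lemma continuous_frechet_C_k:
  "C_k (Suc k) \<phi> \<Longrightarrow> i \<in> Basis \<Longrightarrow> continuous_on UNIV (\<lambda>x. frechet_derivative \<phi> (at x) i)"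
  using continuous_C_k by auto

lemma test_function_lipschitz:
  assumes "test_function \<Omega> \<phi>"
  obtains M where "M-lipschitz_on UNIV \<phi>"
proof -
  define S where "S = closure {x. \<phi> x \<noteq> 0}"
  have S: "compact S" and C: "C_k 1 \<phi>" using assms by (auto simp: test_function_def S_def)
  have D: "(\<phi> has_derivative frechet_derivative \<phi> (at x)) (at x)" for x
    by (rule C_k_Suc_has_derivative[OF C[unfolded One_nat_def]])
  have "\<exists>B. \<forall>x. norm (frechet_derivative \<phi> (at x) i) \<le> B" if i: "i \<in> Basis" for i
  proof -
    have "continuous_on S (\<lambda>x. frechet_derivative \<phi> (at x) i)"
      by (rule continuous_on_subset[OF continuous_frechet_C_k[OF C[unfolded One_nat_def] i]]) simp
    then have "bounded ((\<lambda>x. frechet_derivative \<phi> (at x) i) ` S)"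
      by (intro compact_imp_bounded compact_continuous_image S)
    then obtain B where B: "B > 0" "\<And>x. x \<in> S \<Longrightarrow> norm (frechet_derivative \<phi> (at x) i) \<le> B"
      unfolding bounded_pos by auto
    have "norm (frechet_derivative \<phi> (at x) i) \<le> B" for x
      using B test_function_derivative_zero[of x \<phi>] by (cases "x \<in> S") (auto simp: S_def)
    then show ?thesis by blast
  qed
  then obtain B where B: "\<And>i x. i \<in> Basis \<Longrightarrow> norm (frechet_derivative \<phi> (at x) i) \<le> B i" by metis
  have B0: "0 \<le> B i" if "i \<in> Basis" for i using B[OF that] norm_ge_zero order_trans by blast
  have "norm (frechet_derivative \<phi> (at x) h) \<le> (\<Sum>i\<in>Basis. B i) * norm h" for x h
  proof -
    interpret linear "frechet_derivative \<phi> (at x)" by (rule has_derivative_linear[OF D])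
    have "frechet_derivative \<phi> (at x) h = frechet_derivative \<phi> (at x) (\<Sum>i\<in>Basis. (h \<bullet> i) *\<^sub>R i)"
      by (simp add: euclidean_representation)
    also have "\<dots> = (\<Sum>i\<in>Basis. (h \<bullet> i) *\<^sub>R frechet_derivative \<phi> (at x) i)" by (simp add: sum scale)
    also have "norm \<dots> \<le> (\<Sum>i\<in>Basis. norm h * B i)"
      using B B0 Basis_le_norm by (intro sum_norm_le) (auto intro!: mult_mono)
    finally show ?thesis by (simp add: sum_distrib_left mult.commute)
  qed
  then have "onorm (frechet_derivative \<phi> (at x)) \<le> (\<Sum>i\<in>Basis. B i)" for x
    using B0 by (intro onorm_bound sum_nonneg) auto
  then have "(\<Sum>i\<in>Basis. B i)-lipschitz_on UNIV \<phi>"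
    using D B0 by (intro bounded_derivative_imp_lipschitz[where f' = "\<lambda>x. frechet_derivative \<phi> (at x)"]) (auto intro: sum_nonneg has_derivative_at_withinI)
  then show ?thesis by (rule that)
qed

lemma lebesgue_integral_lborel:
  fixes f :: "'a::euclidean_space \<Rightarrow> 'b::euclidean_space"
  assumes "f \<in> borel_measurable borel"
  shows "integral\<^sup>L lebesgue f = integral\<^sup>L lborel f"
  using assms by (intro integral_completion) simp

text \<open>Translation invariance moves a difference quotient from \<open>\<phi>\<close> to
  \<open>f\<close>, and dominated convergence passes to the limit, the Lipschitz constants
  furnishing the bounds. The almost everywhere derivative of \<open>f\<close> is an assumption,
  which piecewise affine functions satisfy by inspection, so Rademacher's theorem is
  avoided.\<close>

lemma lipschitz_integration_by_parts:
  fixes f \<phi> :: "'a::euclidean_space \<Rightarrow> real"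
  assumes \<Omega>: "open \<Omega>" and f: "L-lipschitz_on UNIV f" "compact S" "\<And>x. x \<notin> S \<Longrightarrow> f x = 0"
    and g: "g \<in> borel_measurable (lebesgue_on \<Omega>)"
    and der: "AE x in lebesgue_on \<Omega>. \<exists>D. (f has_derivative D) (at x) \<and> D e = g x"
    and \<phi>: "test_function \<Omega> \<phi>" and e: "e \<in> Basis"
  shows "(LINT x|lebesgue_on \<Omega>. f x * frechet_derivative \<phi> (at x) e) = - (LINT x|lebesgue_on \<Omega>. g x * \<phi> x)"
proof -
  define t where "t k = 1 / real (Suc k)" for k
  have t: "t k > 0" for k by (simp add: t_def)
  define \<phi>' where "\<phi>' x = frechet_derivative \<phi> (at x) e" for x
  have C: "C_k k \<phi>" for k using \<phi> by (simp add: test_function_def)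
  have cf: "continuous_on UNIV f" by (rule lipschitz_on_continuous_on[OF f(1)])
  have c\<phi>: "continuous_on UNIV \<phi>" by (rule continuous_C_k[OF C])
  have c\<phi>': "continuous_on UNIV \<phi>'" unfolding \<phi>'_def by (rule continuous_frechet_C_k[OF C[of "Suc 0"] e])
  have [measurable]: "f \<in> borel_measurable borel" "\<phi> \<in> borel_measurable borel" "\<phi>' \<in> borel_measurable borel"
    using cf c\<phi> c\<phi>' by (auto intro: borel_measurable_continuous_onI)
  obtain M where M: "M-lipschitz_on UNIV \<phi>" using test_function_lipschitz[OF \<phi>] .
  have L0: "0 \<le> L" "0 \<le> M" using f(1) M by (auto simp: lipschitz_on_def)
  have supp: "compact (closure {x. \<phi> x \<noteq> 0})" using \<phi> by (simp add: test_function_def)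
  have out: "\<phi> x = 0" if "x \<notin> closure {x. \<phi> x \<noteq> 0}" for x
    using that closure_subset[of "{x. \<phi> x \<noteq> 0}"] by blast
  have int\<phi>: "integrable lborel \<phi>" by (rule integrable_lborel_cont_support[OF c\<phi> supp out])
  have intf: "integrable lborel f" by (rule integrable_lborel_cont_support[OF cf f(2,3)])
  \<comment> \<open>\<open>Q\<close> shifts \<open>\<phi>\<close> forwards and \<open>R\<close>
    shifts \<open>f\<close> backwards; the reversed direction is the source of the minus sign in the
    limit.\<close>
  define Q where "Q k x = f x * ((\<phi> (x + t k *\<^sub>R e) - \<phi> x) / t k)" for k x
  define R where "R k x = (f (x + t k *\<^sub>R (- e)) - f x) / t k * \<phi> x" for k x
  have QR: "(LINT x|lborel. Q k x) = (LINT x|lborel. R k x)" for k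
  proof -
    have shift: "continuous_on UNIV (\<lambda>x. h (x + s *\<^sub>R e))" if "continuous_on UNIV h" for h :: "'a \<Rightarrow> real" and s
      by (intro continuous_on_compose2[OF that] continuous_intros) auto
    have i1: "integrable lborel (\<lambda>x. f x * \<phi> (x + s *\<^sub>R e))" for s
      by (rule integrable_lborel_cont_support[OF continuous_on_mult[OF cf shift[OF c\<phi>]] f(2)]) (simp add: f(3))
    have i2: "integrable lborel (\<lambda>x. f (x + s *\<^sub>R e) * \<phi> x)" for s
      by (rule integrable_lborel_cont_support[OF continuous_on_mult[OF shift[OF cf] c\<phi>] supp])
        (drule out, simp only: mult_zero_right)
    have tr: "(LINT x|lborel. f x * \<phi> (x + t k *\<^sub>R e)) = (LINT x|lborel. f (x + t k *\<^sub>R (- e)) * \<phi> x)"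
      using LINT_lborel_translate[of "\<lambda>x. f x * \<phi> (x + t k *\<^sub>R e)" "t k *\<^sub>R (- e)"] by (simp add: add.commute)
    have "(LINT x|lborel. Q k x) = ((LINT x|lborel. f x * \<phi> (x + t k *\<^sub>R e)) - (LINT x|lborel. f x * \<phi> x)) / t k"
      using i1[of "t k"] i1[of 0] by (simp add: Q_def right_diff_distrib)
    also have "\<dots> = ((LINT x|lborel. f (x + t k *\<^sub>R (- e)) * \<phi> x) - (LINT x|lborel. f x * \<phi> x)) / t k"
      by (simp add: tr)
    also have "\<dots> = (LINT x|lborel. R k x)"
      using i2[of "- t k"] i2[of 0] by (simp add: R_def left_diff_distrib)
    finally show ?thesis .
  qed
  have limQ: "(\<lambda>k. LINT x|lborel. Q k x) \<longlonglongrightarrow> (LINT x|lborel. f x * \<phi>' x)"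
  proof (rule integral_dominated_convergence)
    show "integrable lborel (\<lambda>x. M * norm e * \<bar>f x\<bar>)" using intf by simp
    show "AE x in lborel. (\<lambda>k. Q k x) \<longlonglongrightarrow> f x * \<phi>' x"
    proof (intro AE_I2)
      fix x
      have "(\<lambda>k. (\<phi> (x + t k *\<^sub>R e) - \<phi> x) /\<^sub>R t k) \<longlonglongrightarrow> \<phi>' x"
        unfolding t_def \<phi>'_def by (rule directional_quotient_tendsto[OF C_k_Suc_has_derivative[OF C[of "Suc 0"]]])
      then show "(\<lambda>k. Q k x) \<longlonglongrightarrow> f x * \<phi>' x"
        unfolding Q_def by (intro tendsto_mult tendsto_const) (simp add: divide_inverse mult.commute)
    qed
    show "AE x in lborel. norm (Q k x) \<le> M * norm e * \<bar>f x\<bar>" for k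
    proof (intro AE_I2)
      fix x
      have "\<bar>\<phi> (x + t k *\<^sub>R e) - \<phi> x\<bar> / t k \<le> M * norm e"
        using lipschitz_onD[OF M, of "x + t k *\<^sub>R e" x] t[of k] by (simp add: dist_norm divide_le_eq mult_ac)
      then show "norm (Q k x) \<le> M * norm e * \<bar>f x\<bar>"
        using mult_left_mono[of "\<bar>\<phi> (x + t k *\<^sub>R e) - \<phi> x\<bar> / t k" "M * norm e" "\<bar>f x\<bar>"] t[of k]
        by (simp add: Q_def abs_mult mult_ac)
    qed
  qed (simp_all add: Q_def)
  \<comment> \<open>Only values on \<Omega> are known for \<open>g\<close>. Extension by zero agrees
    with the limit of \<open>R\<close> everywhere, because \<open>\<phi>\<close> vanishes outside
    \<Omega>.\<close>
  define g' where "g' x = indicator \<Omega> x *\<^sub>R g x" for x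
  have g'[measurable]: "g' \<in> borel_measurable lebesgue"
    using g \<Omega> unfolding g'_def[abs_def] by (subst (asm) borel_measurable_restrict_space_iff) (auto simp: borel_open)
  have [measurable]: "h \<in> borel_measurable lebesgue" if "h \<in> borel_measurable borel" for h :: "'a \<Rightarrow> real"
    using that by (intro measurable_completion) simp
  have limR: "(\<lambda>k. LINT x|lebesgue. R k x) \<longlonglongrightarrow> (LINT x|lebesgue. - (g' x * \<phi> x))"
  proof (rule integral_dominated_convergence)
    show "integrable lebesgue (\<lambda>x. L * norm e * \<bar>\<phi> x\<bar>)"
      using int\<phi> by (intro integrable_mult_right integrable_abs) (simp add: integrable_completion)
    have "AE x in lebesgue. x \<in> \<Omega> \<longrightarrow> (\<exists>D. (f has_derivative D) (at x) \<and> D e = g x)"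
      using der \<Omega> by (subst (asm) AE_restrict_space_iff) (auto simp: borel_open)
    then show "AE x in lebesgue. (\<lambda>k. R k x) \<longlonglongrightarrow> - (g' x * \<phi> x)"
    proof eventually_elim
      case (elim x)
      show ?case
      proof (cases "x \<in> \<Omega>")
        case True
        then obtain D where D: "(f has_derivative D) (at x)" "D e = g x" using elim by blast
        have "(\<lambda>k. (f (x + t k *\<^sub>R (- e)) - f x) /\<^sub>R t k) \<longlonglongrightarrow> D (- e)"
          unfolding t_def by (rule directional_quotient_tendsto[OF D(1)])
        then have "(\<lambda>k. (f (x + t k *\<^sub>R (- e)) - f x) / t k * \<phi> x) \<longlonglongrightarrow> D (- e) * \<phi> x"
          by (intro tendsto_mult tendsto_const) (simp add: divide_inverse mult.commute)
        moreover have "D (- e) = - g x" using D linear_neg[OF has_derivative_linear[OF D(1)]] by simp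
        ultimately show ?thesis using True by (simp add: R_def g'_def)
      next
        case False
        then show ?thesis using test_function_zero[OF \<phi> False] by (simp add: R_def)
      qed
    qed
    show "AE x in lebesgue. norm (R k x) \<le> L * norm e * \<bar>\<phi> x\<bar>" for k
    proof (intro AE_I2)
      fix x
      have "\<bar>f (x + t k *\<^sub>R (- e)) - f x\<bar> / t k \<le> L * norm e"
        using lipschitz_onD[OF f(1), of "x + t k *\<^sub>R (- e)" x] t[of k] by (simp add: dist_norm divide_le_eq mult_ac)
      then show "norm (R k x) \<le> L * norm e * \<bar>\<phi> x\<bar>"
        using mult_right_mono[of "\<bar>f (x + t k *\<^sub>R (- e)) - f x\<bar> / t k" "L * norm e" "\<bar>\<phi> x\<bar>"] t[of k]
        by (simp add: R_def abs_mult mult_ac)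
    qed
    show "R k \<in> borel_measurable lebesgue" for k
      by (intro measurable_completion) (simp add: R_def[abs_def])
  qed measurable
  have "(LINT x|lebesgue. R k x) = (LINT x|lborel. R k x)" for k
    by (rule lebesgue_integral_lborel) (simp add: R_def[abs_def])
  then have "(LINT x|lborel. f x * \<phi>' x) = (LINT x|lebesgue. - (g' x * \<phi> x))"
    using limQ limR QR by (intro LIMSEQ_unique[of "\<lambda>k. LINT x|lborel. Q k x"]) auto
  moreover have "(LINT x|lebesgue_on \<Omega>. f x * \<phi>' x) = (LINT x|lborel. f x * \<phi>' x)"
  proof -
    have z: "\<phi>' x = 0" if "x \<notin> \<Omega>" for x
    proof -
      have "x \<notin> closure {x. \<phi> x \<noteq> 0}" using that \<phi> unfolding test_function_def by blast
      from test_function_derivative_zero[OF this] show ?thesis unfolding \<phi>'_def by (rule fun_cong)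
    qed
    have "indicator \<Omega> x *\<^sub>R (f x * \<phi>' x) = f x * \<phi>' x" for x
      using z[of x] by (cases "x \<in> \<Omega>") simp_all
    then have "(LINT x|lebesgue. indicator \<Omega> x *\<^sub>R (f x * \<phi>' x)) = (LINT x|lebesgue. f x * \<phi>' x)" by presburger
    also have "\<dots> = (LINT x|lborel. f x * \<phi>' x)" by (rule lebesgue_integral_lborel) simp
    finally show ?thesis using \<Omega> by (subst lebesgue_on_integral) (auto simp: borel_open)
  qed
  moreover have "(LINT x|lebesgue_on \<Omega>. g x * \<phi> x) = (LINT x|lebesgue. g' x * \<phi> x)"
    using \<Omega> by (subst lebesgue_on_integral) (auto simp: borel_open g'_def mult.assoc)
  ultimately show ?thesis by (simp add: \<phi>'_def)
qed

text \<open>Along the segment from \<open>x\<close> to \<open>y\<close> the cover becomes one of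
  [0,1] by finitely many closed sets, where Lipschitz bounds glue without loss. One of the sets will
  be the complement of the domain, which need not be convex.\<close>

lemma lipschitz_on_closed_cover:
  fixes f :: "'a::real_normed_vector \<Rightarrow> 'b::metric_space"
  assumes fin: "finite \<S>" and cl: "\<And>S. S \<in> \<S> \<Longrightarrow> closed S" and cov: "\<Union>\<S> = UNIV"
    and lip: "\<And>S. S \<in> \<S> \<Longrightarrow> L-lipschitz_on S f" and L: "0 \<le> L"
  shows "L-lipschitz_on UNIV f"
proof (rule lipschitz_onI[OF _ L])
  fix x y :: 'a
  define p where "p s = x + s *\<^sub>R (y - x)" for s
  have cp: "continuous_on UNIV p" unfolding p_def by (intro continuous_intros)
  have "(L * norm (y - x))-lipschitz_on {0..1} (f \<circ> p)"
  proof (rule lipschitz_on_closed_Union[where I = \<S> and U = "\<lambda>S. p -` S"])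
    fix S assume S: "S \<in> \<S>"
    show "closed (p -` S)" by (rule closed_vimage[OF cl[OF S] cp])
    show "(L * norm (y - x))-lipschitz_on (p -` S) (f \<circ> p)"
    proof (rule lipschitz_onI)
      fix s t assume st: "s \<in> p -` S" "t \<in> p -` S"
      have "p s - p t = (s - t) *\<^sub>R (y - x)" by (simp add: p_def algebra_simps)
      then have "dist (p s) (p t) = \<bar>s - t\<bar> * norm (y - x)" by (simp add: dist_norm)
      then show "dist ((f \<circ> p) s) ((f \<circ> p) t) \<le> L * norm (y - x) * dist s t"
        using lipschitz_onD[OF lip[OF S], of "p s" "p t"] st by (simp add: dist_norm mult_ac)
    qed (use L in simp)
  next
    show "{0..1} \<subseteq> (\<Union>S\<in>\<S>. p -` S)" using cov by blast
  qed (use fin L in auto)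
  from lipschitz_onD[OF this, of 0 1] show "dist (f x) (f y) \<le> L * dist x y"
    by (simp add: p_def dist_norm norm_minus_commute)
qed

section \<open>Meshes, piecewise affine functions and elementwise means\<close>

text \<open>Step functions have the same form as \<open>mesh_mean\<close>, so facts about them apply
  to elementwise means directly. On the faces the value is zero, which concerns a null set
  only.\<close>

abbreviation mesh_step :: "'a::topological_space set set \<Rightarrow> ('a set \<Rightarrow> 'b::real_vector) \<Rightarrow> 'a \<Rightarrow> 'b" where
  "mesh_step \<T> c x \<equiv> \<Sum>K\<in>\<T>. indicator (interior K) x *\<^sub>R c K"

lemma mesh_step_bound:
  fixes c :: "_ \<Rightarrow> 'b::real_normed_vector"
  shows "norm (mesh_step \<T> c x) \<le> (\<Sum>K\<in>\<T>. norm (c K))"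
  by (rule order_trans[OF norm_sum sum_mono]) (auto simp: indicator_def)

lemma borel_measurable_mesh_step:
  fixes c :: "_ \<Rightarrow> 'b::euclidean_space"
  shows "mesh_step \<T> c \<in> borel_measurable borel"
  by (intro borel_measurable_sum borel_measurable_scaleR borel_measurable_indicator) auto

text \<open>Soft thresholding. It kills small values, so a function vanishing at the boundary gains
  compact support, and elsewhere it is a translation by a constant, so gradients are kept.\<close>

definition soft :: "real \<Rightarrow> real \<Rightarrow> real" where
  "soft \<delta> t = t - max (- \<delta>) (min t \<delta>)"

lemma soft_lipschitz: "\<bar>soft \<delta> s - soft \<delta> t\<bar> \<le> \<bar>s - t\<bar>"
  by (auto simp: soft_def max_def min_def)

lemma soft_close: "0 \<le> \<delta> \<Longrightarrow> \<bar>soft \<delta> t - t\<bar> \<le> \<delta>"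
  by (auto simp: soft_def max_def min_def)

lemma soft_nonzero: "soft \<delta> t \<noteq> 0 \<Longrightarrow> \<delta> < \<bar>t\<bar>"
  by (auto simp: soft_def max_def min_def split: if_splits)

definition soft_vec :: "real \<Rightarrow> real ^ 'd \<Rightarrow> real ^ 'd" where
  "soft_vec \<delta> y = (\<chi> i. soft \<delta> (y $ i))"

lemma soft_vec_lipschitz: "norm (soft_vec \<delta> x - soft_vec \<delta> y) \<le> norm (x - y)"
  by (rule norm_le_componentwise_cart) (simp add: soft_vec_def soft_lipschitz)

lemma soft_vec_close:
  fixes y :: "real ^ 'd"
  assumes "0 \<le> \<delta>"
  shows "norm (soft_vec \<delta> y - y) \<le> real CARD('d) * \<delta>"
proof -
  have "norm (soft_vec \<delta> y - y) \<le> (\<Sum>i\<in>UNIV. \<bar>(soft_vec \<delta> y - y) $ i\<bar>)" by (rule norm_le_l1_cart)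
  also have "\<dots> \<le> (\<Sum>i\<in>(UNIV :: 'd set). \<delta>)" by (intro sum_mono) (simp add: soft_vec_def soft_close[OF assms])
  finally show ?thesis by simp
qed

lemma soft_vec_nonzero:
  assumes "soft_vec \<delta> y \<noteq> 0"
  shows "\<delta> < norm y"
proof -
  obtain i where "soft \<delta> (y $ i) \<noteq> 0" using assms by (auto simp: soft_vec_def vec_eq_iff)
  then show ?thesis using soft_nonzero component_le_norm_cart[of y i] by fastforce
qed

text \<open>Where f x is nonzero its sign is locally constant and |f| exceeds small thresholds, so
  thresholding shifts by a constant; where \<open>f\<close> vanishes locally it has no effect. Only
  points where \<open>f\<close> changes from zero to nonzero are left out.\<close>

lemma soft_eventually_translation:
  fixes f :: "'a::metric_space \<Rightarrow> real"
  assumes f: "isCont f x" and alt: "f x \<noteq> 0 \<or> (\<exists>e>0. \<forall>y\<in>ball x e. f y = 0)"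
  shows "\<exists>e>0. \<forall>\<delta>. 0 < \<delta> \<and> \<delta> < e \<longrightarrow> (\<exists>s. \<forall>y\<in>ball x e. soft \<delta> (f y) = f y + s)"
proof (cases "f x = 0")
  case True
  with alt obtain e where "e > 0" "\<forall>y\<in>ball x e. f y = 0" by blast
  then show ?thesis by (intro exI[of _ e]) (auto simp: soft_def intro!: exI[of _ 0])
next
  case False
  obtain r where r: "r > 0" "\<And>y. dist y x < r \<Longrightarrow> dist (f y) (f x) < \<bar>f x\<bar> / 2"
    using f False unfolding continuous_at_eps_delta by (metis half_gt_zero zero_less_abs_iff)
  \<comment> \<open>The same \<open>e\<close> bounds the radius and the threshold: nearby |f y| > |f
    x| / 2 > \<delta>.\<close>
  define e where "e = min r (\<bar>f x\<bar> / 2)"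
  have "e > 0" using r False by (simp add: e_def)
  moreover have "\<exists>s. \<forall>y\<in>ball x e. soft \<delta> (f y) = f y + s" if \<delta>: "0 < \<delta>" "\<delta> < e" for \<delta>
  proof (intro exI ballI)
    fix y assume "y \<in> ball x e"
    then have "dist (f y) (f x) < \<bar>f x\<bar> / 2" using r(2)[of y] by (auto simp: e_def dist_commute)
    moreover have "\<delta> < \<bar>f x\<bar> / 2" using \<delta> by (simp add: e_def)
    ultimately show "soft \<delta> (f y) = f y + (if f x > 0 then - \<delta> else \<delta>)"
      using False \<delta> by (auto simp: soft_def dist_real_def max_def min_def abs_if split: if_splits)
  qed
  ultimately show ?thesis by blast
qed

lemma norm_matrix_le:
  fixes D :: "real ^ 'd \<Rightarrow> real ^ 'd"
  assumes "\<And>h. norm (D h) \<le> L * norm h"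
  shows "norm (matrix D) \<le> (real CARD('d))\<^sup>2 * L"
proof -
  have "norm (matrix D) \<le> (\<Sum>i\<in>UNIV. norm (matrix D $ i))" by (simp add: norm_vec_def L2_set_le_sum)
  also have "\<dots> \<le> (\<Sum>i\<in>UNIV. \<Sum>j\<in>UNIV. \<bar>matrix D $ i $ j\<bar>)" by (intro sum_mono norm_le_l1_cart)
  also have "\<dots> \<le> (\<Sum>i\<in>(UNIV::'d set). \<Sum>j\<in>(UNIV::'d set). L)"
  proof (intro sum_mono)
    fix i j :: 'd
    have "\<bar>matrix D $ i $ j\<bar> \<le> norm (D (axis j 1))" by (simp add: matrix_def component_le_norm_cart)
    then show "\<bar>matrix D $ i $ j\<bar> \<le> L" using assms[of "axis j 1"] by simp
  qed
  finally show ?thesis by (simp add: power2_eq_square)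
qed

lemma continuous_jacobian_C_k:
  fixes \<phi> :: "real ^ 'd \<Rightarrow> real ^ 'd"
  assumes "C_k (Suc k) \<phi>"
  shows "continuous_on UNIV (\<lambda>x. jacobian \<phi> (at x))"
  unfolding jacobian_def matrix_def
  by (intro continuous_on_vec_lambda continuous_on_component continuous_frechet_C_k[OF assms]) simp

text \<open>Condition \<open>good\<close> excludes the zero hyperplane of every nonconstant
  component. A component with zero row is constant near \<open>x\<close>, so a zero value there
  means that it vanishes identically.\<close>

lemma X_disc_locally_translated:
  fixes A :: "real ^ 'd ^ 'd" and w :: "real ^ 'd \<Rightarrow> real ^ 'd"
  assumes w: "continuous_on UNIV w" and K: "x \<in> interior K" and aff: "\<And>y. y \<in> K \<Longrightarrow> w y = A *v y + b"
    and good: "\<And>i. A $ i = 0 \<or> (A *v x + b) $ i \<noteq> 0"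
  shows "\<exists>e>0. \<forall>\<delta>. 0 < \<delta> \<and> \<delta> < e \<longrightarrow> (\<exists>c. \<forall>y\<in>ball x e. soft_vec \<delta> (w y) = A *v y + c)"
proof -
  obtain r where r: "r > 0" "ball x r \<subseteq> K" using K by (auto simp: mem_interior)
  have "\<exists>e>0. \<forall>\<delta>. 0 < \<delta> \<and> \<delta> < e \<longrightarrow> (\<exists>s. \<forall>y\<in>ball x e. soft \<delta> (w y $ i) = w y $ i + s)" for i
  proof (rule soft_eventually_translation)
    show "isCont (\<lambda>y. w y $ i) x"
      using w by (intro continuous_intros) (simp add: continuous_on_eq_continuous_at)
    show "w x $ i \<noteq> 0 \<or> (\<exists>e>0. \<forall>y\<in>ball x e. w y $ i = 0)"
    proof (cases "w x $ i = 0")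
      case True
      have wx: "w x = A *v x + b" using aff r centre_in_ball by blast
      have A0: "A $ i = 0" using good[of i] True wx by simp
      have "(A *v y) $ i = 0" for y using A0 by (simp add: matrix_vector_mul_component)
      then have "w y $ i = 0" if "y \<in> ball x r" for y using aff[of y] r that True wx by auto
      then show ?thesis using r by blast
    qed simp
  qed
  then obtain e where e: "\<And>i. e i > 0"
    "\<And>i \<delta>. 0 < \<delta> \<Longrightarrow> \<delta> < e i \<Longrightarrow> \<exists>s. \<forall>y\<in>ball x (e i). soft \<delta> (w y $ i) = w y $ i + s" by metis
  \<comment> \<open>One radius for all components, of which there are finitely many, and for staying
    inside the cell.\<close>
  define m where "m = min r (Min (range e))"
  have m: "m > 0" "m \<le> r" "\<And>i. m \<le> e i" using r e(1) by (auto simp: m_def min_le_iff_disj)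
  have "\<exists>c. \<forall>y\<in>ball x m. soft_vec \<delta> (w y) = A *v y + c" if \<delta>: "0 < \<delta>" "\<delta> < m" for \<delta>
  proof -
    have "\<exists>s. \<forall>y\<in>ball x (e i). soft \<delta> (w y $ i) = w y $ i + s" for i
      by (rule e(2)[OF \<delta>(1)]) (use \<delta>(2) m(3)[of i] in linarith)
    then obtain s where s: "\<And>i y. y \<in> ball x (e i) \<Longrightarrow> soft \<delta> (w y $ i) = w y $ i + s i" by metis
    have "soft_vec \<delta> (w y) = A *v y + (b + (\<chi> i. s i))" if y: "y \<in> ball x m" for y
    proof -
      have "soft \<delta> (w y $ i) = w y $ i + s i" for i using s[of y i] y m(3)[of i] by auto
      moreover have "y \<in> K" using r(2) y m(2) by (auto simp: subset_iff)
      then have "w y = A *v y + b" by (rule aff)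
      ultimately show ?thesis by (simp add: soft_vec_def vec_eq_iff)
    qed
    then show ?thesis by blast
  qed
  then show ?thesis using m(1) by blast
qed

lemma negligible_affine_zero:
  fixes A :: "real ^ 'd ^ 'd"
  assumes "A $ i \<noteq> 0"
  shows "negligible {x. (A *v x + b) $ i = 0}"
proof -
  have "{x. (A *v x + b) $ i = 0} = {x. A $ i \<bullet> x = - b $ i}"
    by (auto simp: matrix_vector_mul_component algebra_simps)
  then show ?thesis using negligible_hyperplane[of "A $ i"] assms by simp
qed

section \<open>Almost everywhere modifications and null boundaries\<close>

lemma weak_gradient_has:
  "has_weak_gradient \<Omega> u G \<Longrightarrow> has_weak_gradient \<Omega> u (weak_gradient \<Omega> u)"
  unfolding weak_gradient_def by (rule someI[of "has_weak_gradient \<Omega> u"])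

lemma measurable_lebesgue_on_AE:
  fixes f g :: "'a::euclidean_space \<Rightarrow> 'b::euclidean_space"
  assumes S: "S \<in> sets lebesgue" and f: "f \<in> borel_measurable (lebesgue_on S)" and eq: "AE x in lebesgue_on S. f x = g x"
  shows "g \<in> borel_measurable (lebesgue_on S)"
proof -
  define N where "N = {x \<in> S. f x \<noteq> g x}"
  have N: "negligible N" using eq S by (simp add: AE_lebesgue_on_iff N_def)
  show ?thesis
  proof (rule measurableI)
    fix A :: "'b set" assume A: "A \<in> sets borel"
    have "f -` A \<inter> space (lebesgue_on S) \<in> sets (lebesgue_on S)" using f A by (rule measurable_sets)
    then have "f -` A \<inter> S \<in> sets lebesgue" using S by (simp add: sets_restrict_space_iff)
    moreover have "N \<in> sets lebesgue" "N \<inter> g -` A \<in> sets lebesgue"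
      using N negligible_subset[OF N, of "N \<inter> g -` A"] by (auto intro: negligible_imp_sets)
    \<comment> \<open>Completeness of Lebesgue measure: whatever \<open>g\<close> does on the null
      set \<open>N\<close>, that part of the preimage is measurable.\<close>
    ultimately have "(f -` A \<inter> S - N) \<union> (N \<inter> g -` A) \<in> sets lebesgue" by auto
    moreover have "(f -` A \<inter> S - N) \<union> (N \<inter> g -` A) = g -` A \<inter> S" by (auto simp: N_def)
    ultimately show "g -` A \<inter> space (lebesgue_on S) \<in> sets (lebesgue_on S)"
      using S by (simp add: sets_restrict_space_iff)
  qed simp
qed

lemma negligible_frontier_polyhedral:
  fixes \<Omega> :: "'a::euclidean_space set"
  assumes "polyhedral_boundary \<Omega>"
  shows "negligible (frontier \<Omega>)"
proof -
  obtain \<P> where P: "finite \<P>" "\<And>P. P \<in> \<P> \<Longrightarrow> polytope P \<and> aff_dim P = int DIM('a) - 1" "frontier \<Omega> = \<Union>\<P>"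
    using assms by (auto simp: polyhedral_boundary_def)
  have "negligible P" if "P \<in> \<P>" for P
  proof -
    have "interior P = {}" using P(2)[OF that] aff_dim_nonempty_interior[of P] by auto
    then show ?thesis using P(2)[OF that] by (simp add: negligible_convex_interior polytope_imp_convex)
  qed
  then show ?thesis using P by (auto intro: negligible_Union)
qed

lemma lebesgue_on_AE_eq_integral:
  fixes f g :: "'a::euclidean_space \<Rightarrow> 'b::euclidean_space"
  assumes S: "S \<in> sets lebesgue" and g: "integrable (lebesgue_on S) g" and eq: "AE x in lebesgue_on S. g x = f x"
  shows "integrable (lebesgue_on S) f" "integral\<^sup>L (lebesgue_on S) f = integral\<^sup>L (lebesgue_on S) g"
proof -
  have m: "f \<in> borel_measurable (lebesgue_on S)"
    using S borel_measurable_integrable[OF g] eq by (rule measurable_lebesgue_on_AE)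
  show "integrable (lebesgue_on S) f" using g m eq by (rule integrable_cong_AE_imp)
  show "integral\<^sup>L (lebesgue_on S) f = integral\<^sup>L (lebesgue_on S) g"
    using m borel_measurable_integrable[OF g] eq by (intro integral_cong_AE) auto
qed

text \<open>Like \<open>M_disc\<close>, but for values of any type and without symmetry, so that
  error tensors, their norms and discrete strains are all covered.\<close>

definition mesh_constant :: "'a::topological_space set set \<Rightarrow> ('a \<Rightarrow> 'b) \<Rightarrow> bool" where
  "mesh_constant \<T> S \<longleftrightarrow> (\<forall>K\<in>\<T>. \<exists>A. \<forall>x\<in>interior K. S x = A)"

lemma mesh_constant_compose:
  "mesh_constant \<T> f \<Longrightarrow> mesh_constant \<T> g \<Longrightarrow> mesh_constant \<T> (\<lambda>x. F (f x) (g x))"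
  unfolding mesh_constant_def by (metis (no_types, lifting))

text \<open>A single mesh is fixed, and the polyhedral boundary enters as a null set. All constants
  obtained over this locale are thereby uniform in the mesh unless the mesh appears in them.\<close>

locale mesh_domain =
  fixes \<Omega> :: "(real ^ 'd) set" and \<T> :: "(real ^ 'd) set set"
  assumes open_domain: "open \<Omega>" and bounded_domain: "bounded \<Omega>"
    and frontier_domain: "negligible (frontier \<Omega>)" and mesh: "simplicial_mesh \<Omega> \<T>"
begin

lemma lmeasurable_domain: "\<Omega> \<in> lmeasurable"
  using open_domain bounded_domain by (intro lmeasurable_open) auto

lemma sets_domain: "\<Omega> \<in> sets lebesgue"
  using lmeasurable_domain by auto

abbreviation dx :: "(real ^ 'd) measure" where
  "dx \<equiv> lebesgue_on \<Omega>"

sublocale finite_measure dx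
  by (rule finite_measure_lebesgue_on[OF lmeasurable_domain])

lemma borel_measurable_dx: "f \<in> borel_measurable borel \<Longrightarrow> f \<in> borel_measurable dx"
  by (intro measurable_restrict_space1 measurable_completion) simp

lemma bounded_Lp:
  fixes f :: "real ^ 'd \<Rightarrow> 'b::euclidean_space"
  assumes f: "f \<in> borel_measurable dx" and B: "AE x in dx. norm (f x) \<le> B" and p: "p \<ge> 0"
  shows "f \<in> Lp p \<Omega>"
proof -
  have [measurable]: "f \<in> borel_measurable dx" by (rule f)
  have "integrable dx (\<lambda>x. norm (f x) powr p)"
  proof (rule integrable_const_bound[where B = "B powr p"])
    show "AE x in dx. norm (norm (f x) powr p) \<le> B powr p"
      using B by eventually_elim (use p in \<open>auto intro!: powr_mono2\<close>)
  qed measurable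
  then show ?thesis using f by (simp add: Lp_def)
qed

lemma mesh_cell:
  assumes K: "K \<in> \<T>"
  shows "compact K" "convex K" "interior K \<noteq> {}" "K \<subseteq> closure \<Omega>" "negligible (frontier K)"
    "measure lebesgue K > 0" "K \<in> lmeasurable"
proof -
  have s: "int CARD('d) simplex K" using mesh K by (auto simp: simplicial_mesh_def)
  then obtain C where C: "finite C" "K = convex hull C" by (auto simp: simplex)
  show cc: "compact K" "convex K" using C by (auto simp: finite_imp_compact_convex_hull)
  show "negligible (frontier K)" by (rule negligible_convex_frontier[OF cc(2)])
  show "K \<subseteq> closure \<Omega>" using mesh K by (auto simp: simplicial_mesh_def)
  have "aff_dim K = int CARD('d)" using s by (rule aff_dim_simplex)
  \<comment> \<open>A full-dimensional simplex spans the space, so its relative interior, nonempty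
    by convexity, is its interior.\<close>
  then have full: "affine hull K = UNIV" using aff_dim_eq_full[of K] by simp
  then have "K \<noteq> {}" by auto
  then have "rel_interior K \<noteq> {}" using cc(2) by (simp add: rel_interior_eq_empty)
  then show int: "interior K \<noteq> {}" using full by (simp add: rel_interior_interior)
  show lm: "K \<in> lmeasurable" using cc(1) by (rule lmeasurable_compact)
  have "\<not> negligible K"
    using int open_not_negligible[OF open_interior int] negligible_subset[OF _ interior_subset] by blast
  then show "measure lebesgue K > 0"
    using lm by (simp add: negligible_iff_measure zero_less_measure_iff)
qed

text \<open>Conformity makes the intersection of two cells a face of each. A face that meets the
  relative interior is the whole cell, so each cell lies in the other.\<close>

lemma cell_interior_disjoint:
  assumes K: "K \<in> \<T>" "K' \<in> \<T>"
    and x: "x \<in> interior K" "x \<in> interior K'"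
  shows "K = K'"
proof -
  have tri: "triangulation \<T>" using mesh by (simp add: simplicial_mesh_def)
  have sub: "K \<subseteq> K'" if K: "K \<in> \<T>" "K' \<in> \<T>" and x: "x \<in> interior K" "x \<in> interior K'" for K K'
  proof -
    have face: "K \<inter> K' face_of K" using tri K by (auto simp: triangulation_def)
    have "x \<in> rel_interior K" using x(1) interior_subset_rel_interior by blast
    then have "K \<inter> K' \<inter> rel_interior K \<noteq> {}" using x interior_subset by blast
    with face have "K \<inter> K' = K" by (metis face_of_disjoint_rel_interior)
    then show ?thesis by blast
  qed
  show ?thesis using sub[of K K'] sub[of K' K] K x by blast
qed

lemma finite_mesh: "finite \<T>"
  using mesh by (simp add: simplicial_mesh_def triangulation_def)

lemma negligible_mesh_skeleton: "negligible (closure \<Omega> - (\<Union>K\<in>\<T>. interior K))"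
proof (rule negligible_subset)
  show "negligible (\<Union>K\<in>\<T>. frontier K)"
    using finite_mesh mesh_cell(5) by (intro negligible_Union) auto
  show "closure \<Omega> - (\<Union>K\<in>\<T>. interior K) \<subseteq> (\<Union>K\<in>\<T>. frontier K)"
  proof
    fix x assume x: "x \<in> closure \<Omega> - (\<Union>K\<in>\<T>. interior K)"
    then have "x \<in> \<Union>\<T>" using mesh by (simp add: simplicial_mesh_def)
    then obtain K where K: "K \<in> \<T>" "x \<in> K" by blast
    then have "x \<in> frontier K" using x mesh_cell(1)[OF K(1)]
      by (auto simp: frontier_def closure_closed compact_imp_closed)
    then show "x \<in> (\<Union>K\<in>\<T>. frontier K)" using K by blast
  qed
qed

lemma mesh_step_eq:
  fixes c :: "_ \<Rightarrow> 'b::real_vector"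
  assumes K: "K \<in> \<T>" "x \<in> interior K"
  shows "mesh_step \<T> c x = c K"
proof -
  have "(\<Sum>K'\<in>\<T>. indicator (interior K') x *\<^sub>R c K') = (\<Sum>K'\<in>\<T>. if K' = K then c K else 0)"
  proof (rule sum.cong[OF refl])
    fix K' assume K': "K' \<in> \<T>"
    show "indicator (interior K') x *\<^sub>R c K' = (if K' = K then c K else 0)"
    proof (cases "x \<in> interior K'")
      case True
      with cell_interior_disjoint[OF K' K(1) _ K(2)] have "K' = K" by blast
      then show ?thesis using K(2) by simp
    next
      case False
      then have "K' \<noteq> K" using K(2) by blast
      then show ?thesis using False by simp
    qed
  qed
  then show ?thesis using finite_mesh K by simp
qed

text \<open>Extension by zero keeps the affine formula on closed cells and is constant on the
  complement of the domain. These closed sets cover the space, so the piecewise Lipschitz bounds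
  glue to a global one.\<close>

lemma X_disc_extension:
  assumes v: "v \<in> X_disc \<Omega> \<T>"
  obtains A b L where "\<And>K x. K \<in> \<T> \<Longrightarrow> x \<in> K \<Longrightarrow> indicator \<Omega> x *\<^sub>R v x = A K *v x + b K"
    and "L-lipschitz_on UNIV (\<lambda>x. indicator \<Omega> x *\<^sub>R v x)"
proof -
  define w where "w x = indicator \<Omega> x *\<^sub>R v x" for x
  have fr: "v x = 0" if "x \<in> frontier \<Omega>" for x using v that by (auto simp: X_disc_def)
  obtain A b where Ab: "\<And>K x. K \<in> \<T> \<Longrightarrow> x \<in> K \<Longrightarrow> v x = A K *v x + b K"
    using v unfolding X_disc_def by (simp add: Bex_def Ball_def) metis
  have wAb: "w x = A K *v x + b K" if "K \<in> \<T>" "x \<in> K" for K x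
  proof (cases "x \<in> \<Omega>")
    case True
    then show ?thesis using Ab[OF that] by (simp add: w_def)
  next
    case False
    \<comment> \<open>Cells lie in the closure of the open domain, so a cell point outside it is a
      boundary point, where both v and the affine formula vanish.\<close>
    then have "x \<in> frontier \<Omega>"
      using mesh_cell(4)[OF that(1)] that open_domain by (auto simp: frontier_def interior_open)
    then show ?thesis using fr Ab[OF that] False by (simp add: w_def)
  qed
  \<comment> \<open>A sum over the finitely many cells dominates each operator norm and is valid for
    the empty family as well.\<close>
  define L where "L = (\<Sum>K\<in>\<T>. onorm ((*v) (A K)))"
  have on: "0 \<le> onorm ((*v) (A K))" for K by (intro onorm_pos_le) (rule matrix_vector_mul_bounded_linear)
  have L0: "0 \<le> L" unfolding L_def by (intro sum_nonneg on)
  have fin: "finite \<T>" by (rule finite_mesh)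
  have "L-lipschitz_on UNIV w"
  proof (rule lipschitz_on_closed_cover[where \<S> = "insert (- \<Omega>) \<T>"])
    show "\<Union>(insert (- \<Omega>) \<T>) = UNIV"
      using mesh closure_subset[of \<Omega>] by (auto simp: simplicial_mesh_def)
    fix S assume "S \<in> insert (- \<Omega>) \<T>"
    then consider "S = - \<Omega>" | "S \<in> \<T>" by blast
    note cases = this
    show "closed S"
      using cases mesh_cell(1) open_domain compact_imp_closed by cases auto
    show "L-lipschitz_on S w"
      using cases
    proof cases
      case 1
      then show ?thesis using L0 by (auto intro!: lipschitz_onI simp: w_def)
    next
      case 2
      show ?thesis
      proof (rule lipschitz_onI[OF _ L0])
        fix x y assume "x \<in> S" "y \<in> S"
        then have "w x - w y = A S *v (x - y)" using wAb[OF 2] by (simp add: matrix_vector_mult_diff_distrib)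
        then have "norm (w x - w y) \<le> onorm ((*v) (A S)) * norm (x - y)"
          using onorm[OF matrix_vector_mul_bounded_linear, of "A S" "x - y"] by simp
        also have "\<dots> \<le> L * norm (x - y)"
          unfolding L_def by (intro mult_right_mono member_le_sum 2 on fin) auto
        finally show "dist (w x) (w y) \<le> L * dist x y" by (simp add: dist_norm)
      qed
    qed
  qed (use fin L0 in auto)
  then show ?thesis using that wAb by (simp add: w_def)
qed

text \<open>Collects what the choice of weak gradient and membership in W_0 require. Threshold
  \<open>d k\<close> opens a gap to the boundary and mollification at the smaller scale
  \<open>r k\<close> does not close it. One bound \<open>B\<close> serves the limit gradient and all
  approximate gradients.\<close>

lemma X_disc_approximation:
  assumes v: "v \<in> X_disc \<Omega> \<T>"
  obtains G B C \<phi> where "G \<in> borel_measurable borel" "\<And>x. norm (G x) \<le> B" "has_weak_gradient \<Omega> v G"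
    "\<And>K. K \<in> \<T> \<Longrightarrow> \<exists>A. \<forall>x\<in>interior K. G x = A"
    "\<And>k. test_function \<Omega> (\<phi> k)" "\<And>k x. norm (jacobian (\<phi> k) (at x)) \<le> B"
    "AE x in dx. \<forall>\<^sub>F k in sequentially. jacobian (\<phi> k) (at x) = G x"
    "\<And>k x. x \<in> \<Omega> \<Longrightarrow> norm (\<phi> k x - v x) \<le> C / real (Suc k)"
proof -
  define w where "w x = indicator \<Omega> x *\<^sub>R v x" for x
  obtain A b L where aff: "\<And>K x. K \<in> \<T> \<Longrightarrow> x \<in> K \<Longrightarrow> w x = A K *v x + b K"
    and lip: "L-lipschitz_on UNIV w"
    using X_disc_extension[OF v] unfolding w_def by metis
  have L: "0 \<le> L" using lip by (rule lipschitz_on_nonneg)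
  have cw: "continuous_on UNIV w" by (rule lipschitz_on_continuous_on[OF lip])
  have w0: "w x = 0" if "x \<notin> \<Omega>" for x using that by (simp add: w_def)
  define G where "G x = mesh_step \<T> A x" for x
  have G_eq: "G x = A K" if "K \<in> \<T>" "x \<in> interior K" for x K
    unfolding G_def by (rule mesh_step_eq[OF that])
  have G_meas: "G \<in> borel_measurable borel" unfolding G_def by (rule borel_measurable_mesh_step)
  define B where "B = (\<Sum>K\<in>\<T>. norm (A K)) + (real CARD('d))\<^sup>2 * L"
  have G_le: "norm (G x) \<le> B" for x
    using mesh_step_bound[where c = A and \<T> = \<T> and x = x] L unfolding G_def B_def
    by (smt (verit) mult_nonneg_nonneg zero_le_power2)
  \<comment> \<open>The points where gradients may fail to be exact: the mesh skeleton and, on each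
    cell, the zero hyperplanes of the nonconstant components.\<close>
  define N where "N = (closure \<Omega> - (\<Union>K\<in>\<T>. interior K)) \<union>
    (\<Union>K\<in>\<T>. \<Union>i\<in>{i. A K $ i \<noteq> 0}. {x. (A K *v x + b K) $ i = 0})"
  have N: "negligible N" unfolding N_def
  proof (intro negligible_Un negligible_Union)
    show "negligible (closure \<Omega> - (\<Union>K\<in>\<T>. interior K))" by (rule negligible_mesh_skeleton)
    show "finite ((\<lambda>K. \<Union>i\<in>{i. A K $ i \<noteq> 0}. {x. (A K *v x + b K) $ i = 0}) ` \<T>)"
      using finite_mesh by simp
    fix M assume "M \<in> (\<lambda>K. \<Union>i\<in>{i. A K $ i \<noteq> 0}. {x. (A K *v x + b K) $ i = 0}) ` \<T>"
    then obtain K where M: "M = (\<Union>i\<in>{i. A K $ i \<noteq> 0}. {x. (A K *v x + b K) $ i = 0})" by blast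
    show "negligible M" unfolding M
    proof (rule negligible_Union)
      fix P assume "P \<in> (\<lambda>i. {x. (A K *v x + b K) $ i = 0}) ` {i. A K $ i \<noteq> 0}"
      then obtain i where "P = {x. (A K *v x + b K) $ i = 0}" "A K $ i \<noteq> 0" by blast
      then show "negligible P" by (simp only: negligible_affine_zero not_False_eq_True)
    qed simp
  qed
  have good: "\<exists>K\<in>\<T>. x \<in> interior K \<and> (\<forall>i. A K $ i = 0 \<or> (A K *v x + b K) $ i \<noteq> 0)"
    if "x \<in> \<Omega>" "x \<notin> N" for x
    using that closure_subset[of \<Omega>] unfolding N_def by blast
  have der: "(w has_derivative (\<lambda>h. G x *v h)) (at x)" if x: "x \<in> \<Omega>" "x \<notin> N" for x
  proof -
    obtain K where K: "K \<in> \<T>" "x \<in> interior K" using good[OF x] by blast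
    have "((\<lambda>y. A K *v y + b K) has_derivative (\<lambda>h. A K *v h)) (at x)"
      using has_derivative_add[OF linear_imp_has_derivative[OF matrix_vector_mul_linear] has_derivative_const] by simp
    then have "(w has_derivative (\<lambda>h. A K *v h)) (at x)"
    proof (rule has_derivative_transform_within_open[where s = "interior K"])
      show "A K *v y + b K = w y" if "y \<in> interior K" for y
        using aff[OF K(1), of y] interior_subset[of K] that by auto
    qed (use K in auto)
    then show ?thesis using G_eq[OF K] by simp
  qed
  have AE_N: "AE x in dx. x \<notin> N"
    using open_domain negligible_subset[OF N, of "{x \<in> \<Omega>. \<not> x \<notin> N}"] by (subst AE_lebesgue_on_iff) (auto simp: borel_open)
  have Gi: "(\<lambda>x. G x $ i $ j) \<in> borel_measurable borel" for i j
    by (rule measurable_compose[OF G_meas], rule borel_measurable_continuous_onI)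
      (intro continuous_intros)
  \<comment> \<open>The piecewise gradient has no jump contribution across faces, because
    integration by parts is done once for the globally Lipschitz extension.\<close>
  have wg: "has_weak_gradient \<Omega> v G"
    unfolding has_weak_gradient_def
  proof (intro conjI allI impI)
    show "locally_integrable_on v \<Omega>" unfolding locally_integrable_on_def
    proof (intro allI impI)
      fix K assume K: "compact K \<and> K \<subseteq> \<Omega>"
      have "continuous_on K w" using cw by (rule continuous_on_subset) simp
      then have i: "integrable lborel (\<lambda>x. indicator K x *\<^sub>R w x)"
        using K by (intro borel_integrable_compact) auto
      then have "integrable lebesgue (\<lambda>x. indicator K x *\<^sub>R w x)"
        using borel_measurable_integrable[OF i] by (simp only: integrable_completion)
      then have "integrable (lebesgue_on K) w"
        using K by (subst lebesgue_on_integral(2)) (auto simp: borel_compact)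
      moreover have "integrable (lebesgue_on K) w \<longleftrightarrow> integrable (lebesgue_on K) v"
        using K by (intro Bochner_Integration.integrable_cong) (auto simp: w_def)
      ultimately show "integrable (lebesgue_on K) v" by simp
    qed
    show "locally_integrable_on G \<Omega>" unfolding locally_integrable_on_def
    proof (intro allI impI)
      fix K assume K: "compact K \<and> K \<subseteq> \<Omega>"
      interpret finite_measure "lebesgue_on K" using K by (intro finite_measure_lebesgue_on lmeasurable_compact) simp
      have "G \<in> borel_measurable (lebesgue_on K)"
        using G_meas by (intro measurable_restrict_space1 measurable_completion) simp
      then show "integrable (lebesgue_on K) G"
        by (rule integrable_const_bound[where B = B, rotated]) (simp add: G_le)
    qed
    fix \<phi> :: "real ^ 'd \<Rightarrow> real" and i j assume \<phi>: "test_function \<Omega> \<phi>"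
    have "(LINT x|dx. w x $ i * frechet_derivative \<phi> (at x) (axis j 1)) =
        - (LINT x|dx. G x $ i $ j * \<phi> x)"
    proof (rule lipschitz_integration_by_parts[OF open_domain _ _ _ _ _ \<phi>])
      show "L-lipschitz_on UNIV (\<lambda>x. w x $ i)"
      proof (rule lipschitz_onI[OF _ L])
        fix x y
        have "dist (w x $ i) (w y $ i) \<le> dist (w x) (w y)" by (rule dist_vec_nth_le)
        also have "\<dots> \<le> L * dist x y" by (rule lipschitz_onD[OF lip]) auto
        finally show "dist (w x $ i) (w y $ i) \<le> L * dist x y" .
      qed
      show "compact (closure \<Omega>)" using bounded_domain by (simp add: compact_closure)
      show "w x $ i = 0" if "x \<notin> closure \<Omega>" for x using that closure_subset[of \<Omega>] w0[of x] by (metis subsetD zero_index)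
      show "(\<lambda>x. G x $ i $ j) \<in> borel_measurable (dx)"
        using Gi by (rule borel_measurable_dx)
      have "AE x in dx. x \<in> \<Omega>" using open_domain by (subst AE_lebesgue_on_iff) (auto simp: borel_open)
      with AE_N show "AE x in dx. \<exists>D. ((\<lambda>x. w x $ i) has_derivative D) (at x) \<and> D (axis j 1) = G x $ i $ j"
      proof eventually_elim
        case (elim x)
        have "((\<lambda>x. w x $ i) has_derivative (\<lambda>h. (G x *v h) $ i)) (at x)"
          by (rule bounded_linear.has_derivative[OF bounded_linear_vec_nth der]) (use elim in auto)
        moreover have "(G x *v axis j 1) $ i = G x $ i $ j"
          by (simp add: matrix_vector_mul_component inner_axis)
        ultimately show ?case by blast
      qed
    qed simp
    moreover have "(LINT x|dx. w x $ i * frechet_derivative \<phi> (at x) (axis j 1)) =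
        (LINT x|dx. v x $ i * frechet_derivative \<phi> (at x) (axis j 1))"
      by (intro Bochner_Integration.integral_cong) (auto simp: w_def)
    ultimately show "(LINT x|dx. v x $ i * frechet_derivative \<phi> (at x) (axis j 1)) =
        - (LINT x|dx. G x $ i $ j * \<phi> x)" by simp
  qed
  define d where "d k = 1 / real (Suc k)" for k
  have d: "d k > 0" for k by (simp add: d_def)
  \<comment> \<open>Within distance \<open>r k\<close> the Lipschitz function changes by less than
    the threshold. The summand 1 makes this strict and covers L = 0.\<close>
  define r where "r k = d k / (L + 1)" for k
  have r: "r k > 0" "r k \<le> d k" "L * r k < d k" for k
    using d[of k] L by (auto simp: r_def divide_simps mult_left_le algebra_simps)
  have "\<exists>\<rho> :: real ^ 'd \<Rightarrow> real. mollifier (r k) \<rho>" for k using mollifier_exists[OF r(1)[of k]] by metis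
  then obtain \<rho> :: "nat \<Rightarrow> real ^ 'd \<Rightarrow> real" where \<rho>: "\<And>k. mollifier (r k) (\<rho> k)" by metis
  define wk where "wk k x = soft_vec (d k) (w x)" for k x
  have lipk: "L-lipschitz_on UNIV (wk k)" for k
  proof (rule lipschitz_onI[OF _ L])
    fix x y
    have "dist (wk k x) (wk k y) \<le> dist (w x) (w y)" by (simp add: wk_def dist_norm soft_vec_lipschitz)
    also have "\<dots> \<le> L * dist x y" by (rule lipschitz_onD[OF lip]) auto
    finally show "dist (wk k x) (wk k y) \<le> L * dist x y" .
  qed
  have cwk: "continuous_on UNIV (wk k)" for k by (rule lipschitz_on_continuous_on[OF lipk])
  have wk_nz: "d k < norm (w y)" if "wk k y \<noteq> 0" for k y using soft_vec_nonzero that by (auto simp: wk_def)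
  obtain a' b' where box: "\<Omega> \<subseteq> cbox a' b'" using bounded_subset_cbox_symmetric[OF bounded_domain] by blast
  define \<phi> where "\<phi> k = convolution (\<rho> k) (wk k)" for k
  have C\<phi>: "C_k m (\<phi> k)" for m k
    unfolding \<phi>_def
  proof (rule C_k_convolution)
    show "C_k j (\<rho> k)" for j using \<rho>[of k] by (simp add: mollifier_def)
    show "wk k y = 0" if "y \<notin> cbox a' b'" for y
      using wk_nz[of k y] w0[of y] d[of k] that box by fastforce
  qed (rule cwk)
  have test: "test_function \<Omega> (\<phi> k)" for k
  proof -
    \<comment> \<open>If the mollified function is nonzero at x, then |w| exceeds \<open>d k\<close>
      at some point within \<open>r k\<close>, so |w x| is at least d k - L r k. This is positive,
      which puts the closed set \<open>S\<close> inside \<Omega>.\<close>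
    define S where "S = {x. d k - L * r k \<le> norm (w x)}"
    have "closed S" unfolding S_def by (intro closed_Collect_le continuous_intros cw)
    have S\<Omega>: "S \<subseteq> \<Omega>" using w0 r(3)[of k] by (force simp: S_def)
    have "{x. \<phi> k x \<noteq> 0} \<subseteq> S"
    proof clarify
      fix x assume "\<phi> k x \<noteq> 0"
      then obtain y where y: "wk k y \<noteq> 0" "norm (x - y) \<le> r k"
        using convolution_support[OF \<rho>] by (metis \<phi>_def)
      have "norm (w y) - norm (w x) \<le> norm (w y - w x)" by (rule norm_triangle_ineq2)
      also have "\<dots> \<le> L * norm (y - x)" using lipschitz_onD[OF lip, of y x] by (simp add: dist_norm)
      also have "\<dots> \<le> L * r k" using y(2) L by (intro mult_left_mono) (auto simp: norm_minus_commute)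
      finally show "x \<in> S" using wk_nz[OF y(1)] by (simp add: S_def)
    qed
    then have sub: "closure {x. \<phi> k x \<noteq> 0} \<subseteq> S" using \<open>closed S\<close> by (rule closure_minimal)
    then have "bounded (closure {x. \<phi> k x \<noteq> 0})" using S\<Omega> bounded_domain by (metis bounded_subset)
    then show ?thesis using sub S\<Omega> C\<phi> by (auto simp: test_function_def compact_eq_bounded_closed)
  qed
  have D\<phi>: "(\<phi> k has_derivative frechet_derivative (\<phi> k) (at x)) (at x)" for k x
    by (rule C_k_Suc_has_derivative[OF C\<phi>[of "Suc 0"]])
  have jac: "norm (jacobian (\<phi> k) (at x)) \<le> B" for k x
  proof -
    have "norm (frechet_derivative (\<phi> k) (at x) h) \<le> L * norm h" for h
      by (rule derivative_le_lipschitz[OF D\<phi>]) (simp add: \<phi>_def convolution_lipschitz[OF \<rho> lipk])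
    then have "norm (jacobian (\<phi> k) (at x)) \<le> (real CARD('d))\<^sup>2 * L"
      unfolding jacobian_def by (rule norm_matrix_le)
    also have "\<dots> \<le> B" by (simp add: B_def sum_nonneg)
    finally show ?thesis .
  qed
  have exact: "\<forall>\<^sub>F k in sequentially. jacobian (\<phi> k) (at x) = G x" if x: "x \<in> \<Omega>" "x \<notin> N" for x
  proof -
    obtain K where K: "K \<in> \<T>" "x \<in> interior K" and g: "\<And>i. A K $ i = 0 \<or> (A K *v x + b K) $ i \<noteq> 0"
      using good[OF x] by blast
    obtain e where e: "e > 0" "\<And>\<delta>. 0 < \<delta> \<Longrightarrow> \<delta> < e \<Longrightarrow> \<exists>c. \<forall>y\<in>ball x e. soft_vec \<delta> (w y) = A K *v y + c"
      using X_disc_locally_translated[OF cw K(2) aff[OF K(1)] g] by blast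
    have "\<forall>\<^sub>F k in sequentially. d k < e"
      unfolding d_def using LIMSEQ_Suc[OF lim_1_over_n[where 'a = real]] e(1) by (rule order_tendstoD(2))
    then show ?thesis
    proof eventually_elim
      case (elim k)
      then obtain c where "\<forall>y\<in>ball x e. soft_vec (d k) (w y) = A K *v y + c" using e(2)[OF d] by blast
      then have c: "wk k y = A K *v y + c" if "y \<in> ball x e" for y using that by (simp add: wk_def)
      have "(\<phi> k has_derivative (*v) (A K)) (at x)"
        unfolding \<phi>_def
        by (rule convolution_affine_derivative[OF \<rho> cwk matrix_vector_mul_linear c])
          (use r(2)[of k] elim in auto)
      then have "frechet_derivative (\<phi> k) (at x) = (*v) (A K)" by (rule frechet_derivative_at[symmetric])
      then show ?case using G_eq[OF K] by (simp add: jacobian_def)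
    qed
  qed
  \<comment> \<open>Mollification moves values by at most L r k < d k, thresholding each component
    by at most \<open>d k\<close>.\<close>
  have close: "norm (\<phi> k x - v x) \<le> (1 + real CARD('d)) / real (Suc k)" if "x \<in> \<Omega>" for k x
  proof -
    have "norm (\<phi> k x - wk k x) \<le> d k"
      using convolution_close[OF \<rho>[of k] lipk[of k] L, of x] r(3)[of k] by (simp add: \<phi>_def)
    moreover have "norm (wk k x - v x) \<le> real CARD('d) * d k"
      using soft_vec_close[of "d k" "w x"] d[of k] that by (simp add: wk_def w_def)
    ultimately have "norm (\<phi> k x - v x) \<le> d k + real CARD('d) * d k"
      using norm_triangle_ineq[of "\<phi> k x - wk k x" "wk k x - v x"] by simp
    then show ?thesis by (simp add: d_def add_divide_distrib)
  qed
  have "AE x in dx. x \<in> \<Omega>" using open_domain by (subst AE_lebesgue_on_iff) (auto simp: borel_open)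
  with AE_N have "AE x in dx. \<forall>\<^sub>F k in sequentially. jacobian (\<phi> k) (at x) = G x"
    by eventually_elim (rule exact)
  with G_meas G_le wg G_eq test jac close show ?thesis by (intro that[of G B \<phi> "1 + real CARD('d)"]) auto
qed

text \<open>On a bounded domain uniform convergence of the values and bounded, almost everywhere
  eventually exact gradients give convergence in every W^{1,p} by dominated convergence.\<close>

lemma X_disc_X_space:
  assumes v: "v \<in> X_disc \<Omega> \<T>"
  shows "v \<in> X_space n \<Omega>"
proof -
  define p where "p = real n + 1"
  have p: "p > 0" by (simp add: p_def)
  obtain G B C \<phi> where G: "G \<in> borel_measurable borel" "\<And>x. norm (G x) \<le> B" "has_weak_gradient \<Omega> v G"
    and "\<And>K. K \<in> \<T> \<Longrightarrow> \<exists>A. \<forall>x\<in>interior K. G x = A"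
    and \<phi>: "\<And>k. test_function \<Omega> (\<phi> k)" "\<And>k x. norm (jacobian (\<phi> k) (at x)) \<le> B"
      "AE x in dx. \<forall>\<^sub>F k in sequentially. jacobian (\<phi> k) (at x) = G x"
      "\<And>k x. x \<in> \<Omega> \<Longrightarrow> norm (\<phi> k x - v x) \<le> C / real (Suc k)"
    by (rule X_disc_approximation[OF v]) blast
  have cv: "continuous_on (closure \<Omega>) v" using v by (simp add: X_disc_def)
  have vm[measurable]: "v \<in> borel_measurable (dx)"
    by (intro continuous_imp_measurable_on_sets_lebesgue continuous_on_subset[OF cv] closure_subset)
      (use sets_domain in auto)
  have "bounded (v ` closure \<Omega>)" using bounded_domain cv by (intro compact_imp_bounded compact_continuous_image) (auto simp: compact_closure)
  then obtain V where V: "\<And>x. x \<in> \<Omega> \<Longrightarrow> norm (v x) \<le> V"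
    using closure_subset unfolding bounded_iff by blast
  have Gm[measurable]: "G \<in> borel_measurable (dx)"
    using G(1) by (rule borel_measurable_dx)
  have "v \<in> Lp p \<Omega>" by (rule bounded_Lp[OF vm, where B = V]) (use p V in auto)
  moreover have "G \<in> Lp p \<Omega>" by (rule bounded_Lp[OF Gm, where B = B]) (use p G(2) in auto)
  ultimately have W: "v \<in> W1p p \<Omega>" using G(3) by (auto simp: W1p_def)
  have Ck: "C_k m (\<phi> k)" for m k using \<phi>(1) by (simp add: test_function_def)
  have [measurable]: "\<phi> k \<in> borel_measurable (dx)" for k
    using borel_measurable_C_k[OF Ck[of 0]] by (rule borel_measurable_dx)
  have [measurable]: "(\<lambda>x. jacobian (\<phi> k) (at x)) \<in> borel_measurable (dx)" for k
    using borel_measurable_continuous_onI[OF continuous_jacobian_C_k[OF Ck[of "Suc 0"]]]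
    by (rule borel_measurable_dx)
  have C0: "C \<ge> 0" if "x \<in> \<Omega>" for x using order_trans[OF norm_ge_zero \<phi>(4)[OF that, of 0]] by simp
  have "(\<lambda>k. LINT x|dx. norm (\<phi> k x - v x) powr p) \<longlonglongrightarrow> (LINT x|dx. 0)"
  proof (rule integral_dominated_convergence)
    show "integrable (dx) (\<lambda>x. C powr p)" by simp
    show "AE x in dx. (\<lambda>k. norm (\<phi> k x - v x) powr p) \<longlonglongrightarrow> 0"
    proof (intro AE_I2)
      fix x assume "x \<in> space (dx)"
      then have x: "x \<in> \<Omega>" by simp
      have "(\<lambda>k. C / real (Suc k)) \<longlonglongrightarrow> 0" by (rule LIMSEQ_Suc[OF lim_const_over_n])
      then have "(\<lambda>k. norm (\<phi> k x - v x)) \<longlonglongrightarrow> 0"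
        by (rule tendsto_sandwich[OF _ _ tendsto_const, rotated 2]) (use \<phi>(4)[OF x] in auto)
      then have "(\<lambda>k. norm (\<phi> k x - v x) powr p) \<longlonglongrightarrow> 0 powr p"
        using p by (intro tendsto_powr') auto
      then show "(\<lambda>k. norm (\<phi> k x - v x) powr p) \<longlonglongrightarrow> 0" by simp
    qed
    show "AE x in dx. norm (norm (\<phi> k x - v x) powr p) \<le> C powr p" for k
    proof (intro AE_I2)
      fix x assume "x \<in> space (dx)"
      then have x: "x \<in> \<Omega>" by simp
      have "norm (\<phi> k x - v x) \<le> C / real (Suc k)" by (rule \<phi>(4)[OF x])
      also have "\<dots> \<le> C / 1" using C0[OF x] by (intro divide_left_mono) auto
      finally show "norm (norm (\<phi> k x - v x) powr p) \<le> C powr p" using p by (auto intro!: powr_mono2)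
    qed
  qed measurable
  then have 1: "(\<lambda>k. LINT x|dx. norm (\<phi> k x - v x) powr p) \<longlonglongrightarrow> 0" by simp
  have AEG: "AE x in dx. weak_gradient \<Omega> v x = G x"
    by (rule weak_gradient_unique[OF open_domain weak_gradient_has[OF G(3)] G(3)])
  have "(\<lambda>k. LINT x|dx. norm (jacobian (\<phi> k) (at x) - G x) powr p) \<longlonglongrightarrow> (LINT x|dx. 0)"
  proof (rule integral_dominated_convergence)
    show "integrable (dx) (\<lambda>x. (B + B) powr p)" by simp
    show "AE x in dx. (\<lambda>k. norm (jacobian (\<phi> k) (at x) - G x) powr p) \<longlonglongrightarrow> 0"
      using \<phi>(3)
    proof eventually_elim
      case (elim x)
      then have "\<forall>\<^sub>F k in sequentially. norm (jacobian (\<phi> k) (at x) - G x) powr p = 0"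
        by eventually_elim simp
      then show ?case by (rule tendsto_eventually)
    qed
    show "AE x in dx. norm (norm (jacobian (\<phi> k) (at x) - G x) powr p) \<le> (B + B) powr p" for k
    proof (intro AE_I2)
      fix x
      have "norm (jacobian (\<phi> k) (at x) - G x) \<le> B + B"
        using norm_triangle_ineq4[of "jacobian (\<phi> k) (at x)" "G x"] \<phi>(2)[of k x] G(2)[of x] by linarith
      then show "norm (norm (jacobian (\<phi> k) (at x) - G x) powr p) \<le> (B + B) powr p" using p by (auto intro!: powr_mono2)
    qed
  qed measurable
  \<comment> \<open>The Sobolev space is defined through the chosen weak gradient; uniqueness
    exchanges it for \<open>G\<close>.\<close>
  moreover have "(LINT x|dx. norm (jacobian (\<phi> k) (at x) - G x) powr p) =
      (LINT x|dx. norm (jacobian (\<phi> k) (at x) - weak_gradient \<Omega> v x) powr p)" for k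
  proof (rule integral_cong_AE)
    have "weak_gradient \<Omega> v \<in> borel_measurable (dx)"
      by (rule measurable_lebesgue_on_AE[OF sets_domain Gm]) (use AEG in \<open>auto simp: eq_commute\<close>)
    then show "(\<lambda>x. norm (jacobian (\<phi> k) (at x) - weak_gradient \<Omega> v x) powr p) \<in> borel_measurable (dx)" by measurable
    show "AE x in dx. norm (jacobian (\<phi> k) (at x) - G x) powr p = norm (jacobian (\<phi> k) (at x) - weak_gradient \<Omega> v x) powr p"
      using AEG by eventually_elim simp
  qed measurable
  ultimately have 2: "(\<lambda>k. LINT x|dx. norm (jacobian (\<phi> k) (at x) - weak_gradient \<Omega> v x) powr p) \<longlonglongrightarrow> 0"
    by simp
  show "v \<in> X_space n \<Omega>"
    unfolding X_space_def W1p_0_def p_def[symmetric] using W \<phi>(1) 1 2 by blast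
qed

text \<open>Means are taken over closed cells, all other integrals over the open domain. The two
  differ on the frontiers of the cell and of the domain, which are null sets.\<close>

lemma integral_cell:
  fixes f :: "real ^ 'd \<Rightarrow> 'b::euclidean_space"
  assumes K: "K \<in> \<T>"
    and f: "integrable (dx) f"
  shows "(LINT x|lebesgue_on K. f x) = (LINT x|dx. indicator (interior K) x *\<^sub>R f x)"
    and "integrable (dx) (\<lambda>x. indicator (interior K) x *\<^sub>R f x)"
proof -
  note cell = mesh_cell[OF K]
  have Ks: "K \<in> sets lebesgue" "interior K \<in> sets lebesgue" "\<Omega> \<in> sets lebesgue"
    using cell(7) open_domain by (auto simp: borel_open)
  have f': "integrable lebesgue (\<lambda>x. indicator \<Omega> x *\<^sub>R f x)" using f Ks by (simp add: lebesgue_on_integral)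
  let ?N = "{x \<in> UNIV. \<not> indicator (interior K) x *\<^sub>R (indicator \<Omega> x *\<^sub>R f x) = indicator K x *\<^sub>R f x}"
  let ?g = "\<lambda>x. indicator (interior K) x *\<^sub>R (indicator \<Omega> x *\<^sub>R f x)"
  have i: "integrable lebesgue ?g"
    by (rule integrable_mult_indicator[OF Ks(2) f'])
  have sw: "?g = (\<lambda>x. indicator \<Omega> x *\<^sub>R (indicator (interior K) x *\<^sub>R f x))"
    by (simp add: mult.commute)
  show "integrable (dx) (\<lambda>x. indicator (interior K) x *\<^sub>R f x)"
    using i Ks(3) unfolding sw by (subst lebesgue_on_integral(2))
  have "?N \<subseteq> frontier K \<union> frontier \<Omega>"
  proof
    fix x assume "x \<in> ?N"
    then have ne: "?g x \<noteq> indicator K x *\<^sub>R f x" by simp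
    have xK: "x \<in> K"
    proof (rule ccontr)
      assume "x \<notin> K"
      moreover have "x \<notin> interior K" using \<open>x \<notin> K\<close> interior_subset by blast
      ultimately show False using ne by simp
    qed
    show "x \<in> frontier K \<union> frontier \<Omega>"
    proof (cases "x \<in> interior K")
      case True
      then have "x \<notin> \<Omega>" using ne xK by auto
      then show ?thesis using xK cell(4) open_domain by (auto simp: frontier_def interior_open)
    next
      case False
      then show ?thesis using xK closure_subset by (auto simp: frontier_def)
    qed
  qed
  then have "negligible ?N"
    by (rule negligible_subset[OF negligible_Un[OF cell(5) frontier_domain]])
  then have "AE x in lebesgue_on UNIV. ?g x = indicator K x *\<^sub>R f x"
    by (subst AE_lebesgue_on_iff) auto
  from lebesgue_on_AE_eq_integral(2)[OF _ _ this, unfolded lebesgue_on_UNIV_eq, OF _ i]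
  have "(LINT x|lebesgue. indicator K x *\<^sub>R f x) = (LINT x|lebesgue. ?g x)"
    by simp
  also have "\<dots> = (LINT x|lebesgue. indicator \<Omega> x *\<^sub>R (indicator (interior K) x *\<^sub>R f x))" unfolding sw ..
  finally show "(LINT x|lebesgue_on K. f x) = (LINT x|dx. indicator (interior K) x *\<^sub>R f x)"
    using lebesgue_on_integral(1)[OF Ks(1), of f] lebesgue_on_integral(1)[OF Ks(3), of "\<lambda>x. indicator (interior K) x *\<^sub>R f x"] by simp
qed

lemma AE_cell: "AE x in dx. x \<in> \<Omega> \<and> (\<exists>K\<in>\<T>. x \<in> interior K)"
proof -
  have "{x \<in> \<Omega>. \<not> (x \<in> \<Omega> \<and> (\<exists>K\<in>\<T>. x \<in> interior K))} \<subseteq> closure \<Omega> - (\<Union>K\<in>\<T>. interior K)"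
    using closure_subset by auto
  then have "negligible {x \<in> \<Omega>. \<not> (x \<in> \<Omega> \<and> (\<exists>K\<in>\<T>. x \<in> interior K))}"
    by (rule negligible_subset[OF negligible_mesh_skeleton])
  then show ?thesis by (simp only: AE_lebesgue_on_iff[OF sets_domain])
qed

section \<open>Elementwise constant fields\<close>

lemma mesh_constant_step:
  fixes S :: "real ^ 'd \<Rightarrow> 'b::euclidean_space"
  assumes "mesh_constant \<T> S"
  obtains c where "AE x in dx. mesh_step \<T> c x = S x"
    "\<And>K x. K \<in> \<T> \<Longrightarrow> x \<in> interior K \<Longrightarrow> S x = c K"
proof -
  obtain c where c: "\<And>K x. K \<in> \<T> \<Longrightarrow> x \<in> interior K \<Longrightarrow> S x = c K"
    using assms unfolding mesh_constant_def by metis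
  have "AE x in dx. mesh_step \<T> c x = S x"
    using AE_cell
  proof eventually_elim
    case (elim x)
    then obtain K where K: "K \<in> \<T>" "x \<in> interior K" by blast
    then show ?case using mesh_step_eq[OF K, of c] c[OF K] by simp
  qed
  then show ?thesis using that c by blast
qed

lemma mesh_constant_measurable:
  fixes S :: "real ^ 'd \<Rightarrow> 'b::euclidean_space"
  assumes "mesh_constant \<T> S"
  shows "S \<in> borel_measurable (dx)"
proof -
  obtain c where c: "AE x in dx. mesh_step \<T> c x = S x"
    by (rule mesh_constant_step[OF assms]) blast
  have "mesh_step \<T> c \<in> borel_measurable (dx)"
    using borel_measurable_mesh_step by (rule borel_measurable_dx)
  from measurable_lebesgue_on_AE[OF sets_domain this c] show ?thesis .
qed

lemma mesh_constant_bounded: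
  fixes S :: "real ^ 'd \<Rightarrow> 'b::euclidean_space"
  assumes "mesh_constant \<T> S"
  obtains B where "AE x in dx. norm (S x) \<le> B"
proof -
  obtain c where c: "AE x in dx. mesh_step \<T> c x = S x"
    by (rule mesh_constant_step[OF assms]) blast
  have "AE x in dx. norm (S x) \<le> (\<Sum>K\<in>\<T>. norm (c K))"
    using c
  proof eventually_elim
    case (elim x)
    show ?case unfolding elim[symmetric] by (rule mesh_step_bound)
  qed
  then show ?thesis by (rule that)
qed

lemma mesh_constant_integrable:
  fixes S :: "real ^ 'd \<Rightarrow> 'b::euclidean_space"
  assumes "mesh_constant \<T> S"
  shows "integrable (dx) S"
proof -
  obtain B where "AE x in dx. norm (S x) \<le> B" by (rule mesh_constant_bounded[OF assms])
  then show ?thesis using mesh_constant_measurable[OF assms] by (rule integrable_const_bound)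
qed

lemma integrable_inner_mesh_constant:
  fixes f S :: "real ^ 'd \<Rightarrow> 'b::euclidean_space"
  assumes f: "integrable (dx) f" and S: "mesh_constant \<T> S"
  shows "integrable (dx) (\<lambda>x. f x \<bullet> S x)"
proof -
  obtain B where B: "AE x in dx. norm (S x) \<le> B" by (rule mesh_constant_bounded[OF S])
  have [measurable]: "f \<in> borel_measurable (dx)" "S \<in> borel_measurable (dx)"
    using f mesh_constant_measurable[OF S] by auto
  show ?thesis
  proof (rule Bochner_Integration.integrable_bound)
    show "integrable (dx) (\<lambda>x. norm (f x) * \<bar>B\<bar>)" using f by simp
    show "AE x in dx. norm (f x \<bullet> S x) \<le> norm (norm (f x) * \<bar>B\<bar>)"
      using B
    proof eventually_elim
      case (elim x)
      have "\<bar>f x \<bullet> S x\<bar> \<le> norm (f x) * norm (S x)" by (rule Cauchy_Schwarz_ineq2)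
      also have "\<dots> \<le> norm (f x) * \<bar>B\<bar>" using elim by (intro mult_left_mono) auto
      finally show ?case by simp
    qed
  qed measurable
qed

section \<open>Elementwise means\<close>

lemma mesh_mean_eq:
  "K \<in> \<T> \<Longrightarrow> x \<in> interior K \<Longrightarrow> mesh_mean \<T> f x = (1 / measure lebesgue K) *\<^sub>R (LINT y|lebesgue_on K. f y)"
  for f :: "real ^ 'd \<Rightarrow> 'b::euclidean_space"
  unfolding mesh_mean_def by (rule mesh_step_eq)

lemma mesh_constant_mean: "mesh_constant \<T> (mesh_mean \<T> f)" for f :: "real ^ 'd \<Rightarrow> 'b::euclidean_space"
  unfolding mesh_constant_def using mesh_mean_eq[of _ _ f] by blast

lemma integral_cell_const:
  assumes K: "K \<in> \<T>"
  shows "(LINT x|dx. indicator (interior K) x *\<^sub>R c) = measure lebesgue K *\<^sub>R (c :: 'b::euclidean_space)"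
proof -
  have "(LINT x|lebesgue_on K. c) = measure lebesgue K *\<^sub>R c"
    using mesh_cell(7)[OF K] measure_restrict_space[of K lebesgue K] by auto
  then show ?thesis
    unfolding integral_cell(1)[OF K integrable_const] .
qed

text \<open>The mean is the orthogonal projection onto elementwise constants: f minus its mean
  integrates to zero on every cell, and S contributes one constant factor per cell.\<close>

lemma integral_diff_mean:
  fixes f S :: "real ^ 'd \<Rightarrow> 'b::euclidean_space"
  assumes f: "integrable (dx) f" and S: "mesh_constant \<T> S"
  shows "(LINT x|dx. (f x - mesh_mean \<T> f x) \<bullet> S x) = 0"
proof -
  obtain c where c: "\<And>K x. K \<in> \<T> \<Longrightarrow> x \<in> interior K \<Longrightarrow> S x = c K"
    by (rule mesh_constant_step[OF S]) blast
  define m where "m K = (1 / measure lebesgue K) *\<^sub>R (LINT y|lebesgue_on K. f y)" for K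
  note cell = integral_cell
  have int: "integrable (dx) (\<lambda>x. indicator (interior K) x *\<^sub>R (f x - m K))" if "K \<in> \<T>" for K
    using f by (intro cell(2) that) auto
  have zero: "(LINT x|dx. indicator (interior K) x *\<^sub>R (f x - m K)) = 0" if K: "K \<in> \<T>" for K
  proof -
    have "(LINT x|dx. indicator (interior K) x *\<^sub>R (f x - m K)) =
        (LINT x|dx. indicator (interior K) x *\<^sub>R f x) - (LINT x|dx. indicator (interior K) x *\<^sub>R m K)"
      unfolding scaleR_diff_right using f by (intro Bochner_Integration.integral_diff cell(2) K) auto
    also have "\<dots> = (LINT x|lebesgue_on K. f x) - measure lebesgue K *\<^sub>R m K"
      by (simp only: cell(1)[OF K f] integral_cell_const[OF K])
    also have "\<dots> = 0" using mesh_cell(6)[OF K] by (simp add: m_def)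
    finally show ?thesis .
  qed
  have eq: "AE x in dx. (\<Sum>K\<in>\<T>. (indicator (interior K) x *\<^sub>R (f x - m K)) \<bullet> c K) = (f x - mesh_mean \<T> f x) \<bullet> S x"
    using AE_cell
  proof eventually_elim
    case (elim x)
    then obtain K where K: "K \<in> \<T>" "x \<in> interior K" by blast
    have "(\<Sum>K\<in>\<T>. (indicator (interior K) x *\<^sub>R (f x - m K)) \<bullet> c K) = (\<Sum>K\<in>\<T>. indicator (interior K) x *\<^sub>R ((f x - m K) \<bullet> c K))"
      by simp
    also have "\<dots> = (f x - m K) \<bullet> c K" by (rule mesh_step_eq[OF K])
    finally show ?case using mesh_mean_eq[OF K, of f] c[OF K] by (simp add: m_def)
  qed
  have "(LINT x|dx. (f x - mesh_mean \<T> f x) \<bullet> S x) =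
      (LINT x|dx. (\<Sum>K\<in>\<T>. (indicator (interior K) x *\<^sub>R (f x - m K)) \<bullet> c K))"
    using int by (intro lebesgue_on_AE_eq_integral(2)[OF sets_domain _ eq] Bochner_Integration.integrable_sum integrable_inner_left) auto
  also have "\<dots> = (\<Sum>K\<in>\<T>. LINT x|dx. (indicator (interior K) x *\<^sub>R (f x - m K)) \<bullet> c K)"
    using int by (intro Bochner_Integration.integral_sum integrable_inner_left) auto
  also have "\<dots> = (\<Sum>K\<in>\<T>. (LINT x|dx. indicator (interior K) x *\<^sub>R (f x - m K)) \<bullet> c K)"
    using int by (intro sum.cong refl integral_inner_left) auto
  also have "\<dots> = 0" using zero by simp
  finally show ?thesis .
qed

lemma norm_mesh_mean_le:
  fixes f :: "real ^ 'd \<Rightarrow> 'b::euclidean_space"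
  assumes f: "integrable (dx) f" and B: "AE x in dx. norm (f x) \<le> B"
  shows "AE x in dx. norm (mesh_mean \<T> f x) \<le> B"
  using AE_cell
proof eventually_elim
  case (elim x)
  then obtain K where K: "K \<in> \<T>" "x \<in> interior K" by blast
  note cell = integral_cell[OF K(1)]
  have "norm (LINT y|lebesgue_on K. f y) \<le> (LINT x|dx. norm (indicator (interior K) x *\<^sub>R f x))"
    unfolding cell(1)[OF f] by (rule integral_norm_bound)
  also have "\<dots> \<le> (LINT x|dx. indicator (interior K) x *\<^sub>R B)"
  proof (rule integral_mono_AE)
    show "integrable (dx) (\<lambda>x. norm (indicator (interior K) x *\<^sub>R f x))"
      by (rule integrable_norm[OF cell(2)[OF f]])
    show "integrable (dx) (\<lambda>x. indicator (interior K) x *\<^sub>R B)" by (rule cell(2)) simp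
    show "AE x in dx. norm (indicator (interior K) x *\<^sub>R f x) \<le> indicator (interior K) x *\<^sub>R B"
      using B by eventually_elim (auto simp: indicator_def)
  qed
  also have "\<dots> = measure lebesgue K * B" using integral_cell_const[OF K(1), of B] by simp
  finally show ?case
    using mesh_cell(6)[OF K(1)] by (simp add: mesh_mean_eq[OF K] divide_le_eq mult.commute)
qed

text \<open>Transposition is linear and bounded, so it commutes with the integral defining the
  mean.\<close>

lemma sym_tensor_mesh_mean:
  fixes T :: "real ^ 'd \<Rightarrow> real ^ 'd ^ 'd"
  assumes T: "integrable (dx) T" and sym: "AE x in dx. sym_tensor (T x)"
    and K: "K \<in> \<T>" "x \<in> interior K"
  shows "sym_tensor (mesh_mean \<T> T x)"
proof -
  note cell = integral_cell[OF K(1)]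
  have lin: "linear (transpose :: real ^ 'd ^ 'd \<Rightarrow> _)"
    by (intro linearI) (simp_all add: transpose_def vec_eq_iff)
  then have bl: "bounded_linear (transpose :: real ^ 'd ^ 'd \<Rightarrow> _)" by (simp add: linear_linear)
  have "AE x in dx. indicator (interior K) x *\<^sub>R T x = transpose (indicator (interior K) x *\<^sub>R T x)"
    using sym by eventually_elim (simp add: linear_scale[OF lin] sym_tensor_def)
  from lebesgue_on_AE_eq_integral(2)[OF sets_domain cell(2)[OF T] this]
  have "transpose (LINT x|dx. indicator (interior K) x *\<^sub>R T x) = (LINT x|dx. indicator (interior K) x *\<^sub>R T x)"
    using integral_bounded_linear[OF bl cell(2)[OF T]] by simp
  then show ?thesis
    by (simp add: sym_tensor_def mesh_mean_eq[OF K] linear_scale[OF lin] cell(1)[OF T])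
qed

end

section \<open>Integrability and gradients\<close>

lemma Lp_integrable:
  fixes f :: "'a::euclidean_space \<Rightarrow> 'b::euclidean_space"
  assumes \<Omega>: "\<Omega> \<in> lmeasurable" and f: "f \<in> Lp p \<Omega>" and p: "p \<ge> 1"
  shows "integrable (lebesgue_on \<Omega>) f"
proof -
  interpret finite_measure "lebesgue_on \<Omega>" by (rule finite_measure_lebesgue_on[OF \<Omega>])
  show ?thesis
  proof (rule Bochner_Integration.integrable_bound)
    show "integrable (lebesgue_on \<Omega>) (\<lambda>x. 1 + norm (f x) powr p)" using f by (simp add: Lp_def)
    show "AE x in lebesgue_on \<Omega>. norm (f x) \<le> norm (1 + norm (f x) powr p)"
    proof (intro AE_I2)
      fix x
      have "norm (f x) \<le> 1 + norm (f x) powr p"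
      proof (cases "norm (f x) \<le> 1")
        case False
        then have "norm (f x) powr 1 \<le> norm (f x) powr p" using p by (intro powr_mono) auto
        then show ?thesis by simp
      qed (simp add: add_increasing2)
      then show "norm (f x) \<le> norm (1 + norm (f x) powr p)" by simp
    qed
  qed (use f in \<open>simp add: Lp_def\<close>)
qed

lemma Lp_AE_eq:
  fixes f g :: "'a::euclidean_space \<Rightarrow> 'b::euclidean_space"
  assumes \<Omega>: "\<Omega> \<in> sets lebesgue" and f: "f \<in> Lp p \<Omega>" and eq: "AE x in lebesgue_on \<Omega>. f x = g x"
  shows "g \<in> Lp p \<Omega>"
proof -
  have "AE x in lebesgue_on \<Omega>. norm (f x) powr p = norm (g x) powr p" using eq by eventually_elim simp
  from lebesgue_on_AE_eq_integral(1)[OF \<Omega> _ this] f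
  have "integrable (lebesgue_on \<Omega>) (\<lambda>x. norm (g x) powr p)" by (simp add: Lp_def)
  then show ?thesis using f measurable_lebesgue_on_AE[OF \<Omega> _ eq] by (simp add: Lp_def)
qed

lemma Lp_dominated:
  fixes f :: "'a::euclidean_space \<Rightarrow> 'b::euclidean_space" and g :: "'a \<Rightarrow> 'c::euclidean_space"
  assumes f: "f \<in> Lp p \<Omega>" and g: "g \<in> borel_measurable (lebesgue_on \<Omega>)" and p: "p \<ge> 0"
    and le: "\<And>x. norm (g x) \<le> C * norm (f x)"
  shows "g \<in> Lp p \<Omega>"
proof -
  have [measurable]: "g \<in> borel_measurable (lebesgue_on \<Omega>)" by (rule g)
  have "integrable (lebesgue_on \<Omega>) (\<lambda>x. norm (g x) powr p)"
  proof (rule Bochner_Integration.integrable_bound)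
    show "integrable (lebesgue_on \<Omega>) (\<lambda>x. \<bar>C\<bar> powr p * norm (f x) powr p)" using f by (simp add: Lp_def)
    show "AE x in lebesgue_on \<Omega>. norm (norm (g x) powr p) \<le> norm (\<bar>C\<bar> powr p * norm (f x) powr p)"
    proof (intro AE_I2)
      fix x
      have "C * norm (f x) \<le> \<bar>C\<bar> * norm (f x)" by (intro mult_right_mono) auto
      then have "norm (g x) powr p \<le> (\<bar>C\<bar> * norm (f x)) powr p" using le[of x] p by (intro powr_mono2) auto
      then show "norm (norm (g x) powr p) \<le> norm (\<bar>C\<bar> powr p * norm (f x) powr p)" by (simp add: powr_mult)
    qed
  qed measurable
  then show ?thesis using g by (simp add: Lp_def)
qed

lemma Lp_diff:
  fixes f g :: "'a::euclidean_space \<Rightarrow> 'b::euclidean_space"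
  assumes f: "f \<in> Lp p \<Omega>" and g: "g \<in> Lp p \<Omega>" and p: "p \<ge> 0"
  shows "(\<lambda>x. f x - g x) \<in> Lp p \<Omega>"
proof -
  have [measurable]: "f \<in> borel_measurable (lebesgue_on \<Omega>)" "g \<in> borel_measurable (lebesgue_on \<Omega>)"
    using f g by (auto simp: Lp_def)
  have "integrable (lebesgue_on \<Omega>) (\<lambda>x. norm (f x - g x) powr p)"
  proof (rule Bochner_Integration.integrable_bound)
    show "integrable (lebesgue_on \<Omega>) (\<lambda>x. 2 powr p * (norm (f x) powr p + norm (g x) powr p))"
      using f g by (simp add: Lp_def)
    show "AE x in lebesgue_on \<Omega>. norm (norm (f x - g x) powr p) \<le> norm (2 powr p * (norm (f x) powr p + norm (g x) powr p))"
    proof (intro AE_I2)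
      fix x
      define m where "m = max (norm (f x)) (norm (g x))"
      have "norm (f x - g x) \<le> 2 * m" using norm_triangle_ineq4[of "f x" "g x"] by (simp add: m_def)
      then have "norm (f x - g x) powr p \<le> (2 * m) powr p" using p by (intro powr_mono2) auto
      also have "\<dots> = 2 powr p * m powr p" by (simp add: powr_mult m_def)
      also have "\<dots> \<le> 2 powr p * (norm (f x) powr p + norm (g x) powr p)"
        by (intro mult_left_mono) (auto simp: m_def max_def)
      finally show "norm (norm (f x - g x) powr p) \<le> norm (2 powr p * (norm (f x) powr p + norm (g x) powr p))"
        by simp
    qed
  qed measurable
  then show ?thesis by (simp add: Lp_def)
qed

text \<open>The growth bound s + 2^n s^(n + 1) matches the exponent of the strain space;
  integrability lets the integral be split and compared.\<close>

lemma Phi_conj_integrable: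
  fixes f :: "'a::euclidean_space \<Rightarrow> real"
  assumes \<Omega>: "\<Omega> \<in> lmeasurable" and n: "n \<ge> 1" and f: "f \<in> Lp (real n + 1) \<Omega>" and nn: "\<And>x. 0 \<le> f x"
  shows "integrable (lebesgue_on \<Omega>) (\<lambda>x. Phi_conj n (f x))"
proof (rule Bochner_Integration.integrable_bound)
  have "integrable (lebesgue_on \<Omega>) f" using Lp_integrable[OF \<Omega> f] by simp
  then show "integrable (lebesgue_on \<Omega>) (\<lambda>x. f x + 2 ^ n * norm (f x) powr (real n + 1))"
    using f by (simp add: Lp_def)
  show "(\<lambda>x. Phi_conj n (f x)) \<in> borel_measurable (lebesgue_on \<Omega>)"
    using f by (intro borel_measurable_Phi_conj n nn) (simp add: Lp_def)
  show "AE x in lebesgue_on \<Omega>. norm (Phi_conj n (f x)) \<le> norm (f x + 2 ^ n * norm (f x) powr (real n + 1))"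
  proof (intro AE_I2)
    fix x
    have "f x ^ (n + 1) = norm (f x) powr (real n + 1)"
      using nn[of x] powr_realpow'[of "f x" "n + 1"] by (simp add: add.commute)
    then have "Phi_conj n (f x) \<le> f x + 2 ^ n * norm (f x) powr (real n + 1)"
      using Phi_conj_le[OF n nn[of x]] by simp
    then show "norm (Phi_conj n (f x)) \<le> norm (f x + 2 ^ n * norm (f x) powr (real n + 1))"
      using Phi_conj_nonneg[OF n nn[of x]] by simp
  qed
qed

lemma continuous_on_hoelder:
  fixes f :: "'a::metric_space \<Rightarrow> 'b::metric_space"
  assumes p: "p > 0" and le: "\<And>x y. dist (f x) (f y) \<le> C * dist x y powr p"
  shows "continuous_on UNIV f"
proof -
  have "isCont f x" for x
  proof -
    have "((\<lambda>y. C * dist y x powr p) \<longlongrightarrow> C * 0 powr p) (at x)"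
      using p by (intro tendsto_mult tendsto_const tendsto_powr') (auto intro!: tendsto_eq_intros)
    then have "((\<lambda>y. C * dist y x powr p) \<longlongrightarrow> 0) (at x)" by simp
    then have "((\<lambda>y. dist (f y) (f x)) \<longlongrightarrow> 0) (at x)"
      by (rule tendsto_sandwich[OF _ _ tendsto_const, rotated 2]) (auto simp: le)
    then show ?thesis unfolding isCont_def using tendsto_dist_iff by blast
  qed
  then show ?thesis by (simp add: continuous_on_eq_continuous_at)
qed

lemma continuous_tensor_a:
  assumes "n \<ge> 1"
  shows "continuous_on UNIV (tensor_a n :: real ^ 'd ^ 'd \<Rightarrow> _)"
  using tensor_a_hoelder[OF assms] assms
  by (intro continuous_on_hoelder[of "1 / real n" _ "2 * ((real CARD('d))\<^sup>2 + 1)"]) (auto simp: dist_norm)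

lemma continuous_tensor_c:
  assumes "material_functions lam mu"
  shows "continuous_on UNIV (tensor_c lam mu :: real ^ 'd ^ 'd \<Rightarrow> _)"
proof -
  have l: "continuous_on UNIV lam" and m: "continuous_on {0..} mu" using assms by (auto simp: material_functions_def)
  have t: "continuous_on UNIV (trace :: real ^ 'd ^ 'd \<Rightarrow> real)" "continuous_on UNIV (dev :: real ^ 'd ^ 'd \<Rightarrow> _)"
    by (intro linear_continuous_on; simp add: linear_linear linear_trace linear_dev)+
  show ?thesis unfolding tensor_c_def
    by (intro continuous_intros t continuous_on_compose2[OF l] continuous_on_compose2[OF m]) auto
qed

lemma tensor_a_0 [simp]: "tensor_a n 0 = 0"
  by (simp add: tensor_a_def linear_0[OF linear_dev] linear_0[OF linear_trace])

lemma tensor_c_0 [simp]: "tensor_c lam mu 0 = 0"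
  by (simp add: tensor_c_def linear_0[OF linear_dev] linear_0[OF linear_trace])

lemma sym_tensor_0 [simp]: "sym_tensor 0"
  by (simp add: sym_tensor_def transpose_def vec_eq_iff)

lemma powr_le_one_plus: "0 \<le> x \<Longrightarrow> 0 \<le> a \<Longrightarrow> a \<le> b \<Longrightarrow> x powr a \<le> 1 + x powr b" for x :: real
proof (cases "x \<le> 1")
  case True
  assume "0 \<le> x" "0 \<le> a"
  then have "x powr a \<le> 1 powr a" using True by (intro powr_mono2) auto
  then show ?thesis by (simp add: add_increasing2)
next
  case False
  assume "a \<le> b"
  then have "x powr a \<le> x powr b" using False by (intro powr_mono) auto
  then show ?thesis by simp
qed

section \<open>Symmetrized weak gradients\<close>

definition sym_part :: "real ^ 'd ^ 'd \<Rightarrow> real ^ 'd ^ 'd" where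
  "sym_part G = (1 / 2) *\<^sub>R (G + transpose G)"

lemma sym_gradient_eq: "sym_gradient \<Omega> v x = sym_part (weak_gradient \<Omega> v x)"
  by (simp add: sym_gradient_def sym_part_def)

lemma linear_sym_part: "linear (sym_part :: real ^ 'd ^ 'd \<Rightarrow> _)"
  by (intro linearI) (simp_all add: sym_part_def transpose_def vec_eq_iff algebra_simps)

context mesh_domain
begin

lemma mesh_constant_Lp:
  fixes S :: "real ^ 'd \<Rightarrow> 'b::euclidean_space"
  assumes S: "mesh_constant \<T> S" and p: "p \<ge> 0"
  shows "S \<in> Lp p \<Omega>"
proof -
  obtain B where "AE x in dx. norm (S x) \<le> B" by (rule mesh_constant_bounded[OF S])
  then show ?thesis by (rule bounded_Lp[OF mesh_constant_measurable[OF S] _ p])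
qed

text \<open>Integrability over all of \<Omega> is demanded so that the integrals in the defining
  identity may be subtracted: test functions and their derivatives are bounded, hence every product
  is integrable.\<close>

lemma has_weak_gradient_diff:
  assumes int: "integrable (dx) v" "integrable (dx) u"
      "integrable (dx) G" "integrable (dx) H"
    and G: "has_weak_gradient \<Omega> v G" and H: "has_weak_gradient \<Omega> u H"
  shows "has_weak_gradient \<Omega> (\<lambda>x. v x - u x) (\<lambda>x. G x - H x)"
  unfolding has_weak_gradient_def
proof (intro conjI allI impI)
  show "locally_integrable_on (\<lambda>x. v x - u x) \<Omega>" "locally_integrable_on (\<lambda>x. G x - H x) \<Omega>"
    using G H by (auto simp: has_weak_gradient_def locally_integrable_on_def)
  fix \<phi> :: "real ^ 'd \<Rightarrow> real" and i j assume \<phi>: "test_function \<Omega> \<phi>"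
  define \<phi>' where "\<phi>' x = frechet_derivative \<phi> (at x) (axis j 1)" for x
  have C: "C_k k \<phi>" for k using \<phi> by (simp add: test_function_def)
  have bm: "f \<in> borel_measurable (dx)" if "continuous_on UNIV f" for f :: "real ^ 'd \<Rightarrow> real"
    using borel_measurable_continuous_onI[OF that] by (rule borel_measurable_dx)
  have m[measurable]: "\<phi> \<in> borel_measurable (dx)" "\<phi>' \<in> borel_measurable (dx)"
    unfolding \<phi>'_def by (intro bm continuous_C_k[OF C] continuous_frechet_C_k[OF C[of "Suc 0"]] axis_in_Basis_iff[THEN iffD2]; simp)+
  obtain M where M: "M-lipschitz_on UNIV \<phi>" by (rule test_function_lipschitz[OF \<phi>])
  have b': "\<bar>\<phi>' x\<bar> \<le> M" for x
  proof -
    have "norm (\<phi>' x) \<le> M * norm (axis j 1 :: real ^ 'd)" unfolding \<phi>'_def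
      by (rule derivative_le_lipschitz[OF C_k_Suc_has_derivative[OF C[of "Suc 0"]]])
        (use lipschitz_onD[OF M] in \<open>auto simp: dist_norm\<close>)
    then show ?thesis by simp
  qed
  have "bounded (\<phi> ` closure {x. \<phi> x \<noteq> 0})"
    using \<phi> by (intro compact_imp_bounded compact_continuous_image continuous_on_subset[OF continuous_C_k[OF C]])
      (auto simp: test_function_def)
  then obtain B where B: "\<And>x. x \<in> closure {x. \<phi> x \<noteq> 0} \<Longrightarrow> \<bar>\<phi> x\<bar> \<le> B" by (auto simp: bounded_iff)
  have b: "\<bar>\<phi> x\<bar> \<le> \<bar>B\<bar>" for x
    using B[of x] closure_subset[of "{x. \<phi> x \<noteq> 0}"] by (cases "\<phi> x = 0") force+
  have mult: "integrable (dx) (\<lambda>x. f x * g x)"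
    if "integrable (dx) f" "g \<in> borel_measurable (dx)" "\<And>x. \<bar>g x\<bar> \<le> c" for f g :: "real ^ 'd \<Rightarrow> real" and c
  proof (rule Bochner_Integration.integrable_bound)
    show "integrable (dx) (\<lambda>x. f x * c)" using that(1) by simp
    show "(\<lambda>x. f x * g x) \<in> borel_measurable (dx)" using that(1,2) by simp
    show "AE x in dx. norm (f x * g x) \<le> norm (f x * c)"
      by (intro AE_I2) (use order_trans[OF that(3) abs_ge_self] in \<open>auto simp: abs_mult intro!: mult_left_mono\<close>)
  qed
  have cu: "integrable (dx) (\<lambda>x. f x $ i)" if "integrable (dx) f" for f :: "real ^ 'd \<Rightarrow> real ^ 'd"
    by (rule integrable_bounded_linear[OF bounded_linear_vec_nth that])
  have cG: "integrable (dx) (\<lambda>x. f x $ i $ j)" if "integrable (dx) f" for f :: "real ^ 'd \<Rightarrow> real ^ 'd ^ 'd"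
    by (intro integrable_bounded_linear[OF bounded_linear_vec_nth] that)
  have eq: "(LINT x|dx. f x $ i * \<phi>' x) = - (LINT x|dx. F x $ i $ j * \<phi> x)"
    if "has_weak_gradient \<Omega> f F" for f F
    using that \<phi> unfolding has_weak_gradient_def \<phi>'_def by blast
  have "(LINT x|dx. (v x - u x) $ i * \<phi>' x) = (LINT x|dx. v x $ i * \<phi>' x) - (LINT x|dx. u x $ i * \<phi>' x)"
    unfolding vector_minus_component left_diff_distrib
    by (intro Bochner_Integration.integral_diff mult[OF _ m(2) b'] cu int)
  also have "\<dots> = - ((LINT x|dx. G x $ i $ j * \<phi> x) - (LINT x|dx. H x $ i $ j * \<phi> x))"
    using eq[OF G] eq[OF H] by simp
  also have "(LINT x|dx. G x $ i $ j * \<phi> x) - (LINT x|dx. H x $ i $ j * \<phi> x) =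
      (LINT x|dx. (G x - H x) $ i $ j * \<phi> x)"
    unfolding vector_minus_component left_diff_distrib
    by (intro Bochner_Integration.integral_diff[symmetric] mult[OF _ m(1) b] cG int)
  finally show "(LINT x|dx. (v x - u x) $ i * frechet_derivative \<phi> (at x) (axis j 1)) =
      - (LINT x|dx. (G x - H x) $ i $ j * \<phi> x)" by (simp add: \<phi>'_def)
qed

lemma X_space_gradient:
  assumes "u \<in> X_space n \<Omega>"
  obtains G where "u \<in> Lp (real n + 1) \<Omega>" "G \<in> Lp (real n + 1) \<Omega>" "has_weak_gradient \<Omega> u G"
    "AE x in dx. sym_gradient \<Omega> u x = sym_part (G x)"
proof -
  obtain G where G: "u \<in> Lp (real n + 1) \<Omega>" "G \<in> Lp (real n + 1) \<Omega>" "has_weak_gradient \<Omega> u G"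
    using assms by (auto simp: X_space_def W1p_0_def W1p_def)
  have "AE x in dx. weak_gradient \<Omega> u x = G x"
    by (rule weak_gradient_unique[OF open_domain weak_gradient_has[OF G(3)] G(3)])
  then have "AE x in dx. sym_gradient \<Omega> u x = sym_part (G x)"
    by eventually_elim (simp add: sym_gradient_eq)
  with G show ?thesis by (rule that)
qed

lemma Lp_sym_part:
  fixes G :: "real ^ 'd \<Rightarrow> real ^ 'd ^ 'd"
  assumes G: "G \<in> Lp p \<Omega>" and p: "p \<ge> 0"
  shows "(\<lambda>x. sym_part (G x)) \<in> Lp p \<Omega>"
proof -
  obtain C where C: "\<And>G :: real ^ 'd ^ 'd. norm (sym_part G) \<le> C * norm G"
    using linear_bounded[OF linear_sym_part] by blast
  have "sym_part \<in> borel_measurable (borel :: (real ^ 'd ^ 'd) measure)"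
    using linear_sym_part by (intro borel_measurable_continuous_onI linear_continuous_on) (simp add: linear_linear)
  then have "(\<lambda>x. sym_part (G x)) \<in> borel_measurable (dx)"
    using G by (intro measurable_compose[of G _ borel sym_part]) (auto simp: Lp_def)
  then show ?thesis by (rule Lp_dominated[OF G _ p C])
qed

lemma sym_gradient_Lp:
  assumes "u \<in> X_space n \<Omega>"
  shows "sym_gradient \<Omega> u \<in> Lp (real n + 1) \<Omega>"
proof -
  obtain G where G: "G \<in> Lp (real n + 1) \<Omega>" "AE x in dx. sym_gradient \<Omega> u x = sym_part (G x)"
    by (rule X_space_gradient[OF assms])
  from G(2) have "AE x in dx. sym_part (G x) = sym_gradient \<Omega> u x" by eventually_elim simp
  from Lp_AE_eq[OF sets_domain Lp_sym_part[OF G(1)] this] show ?thesis by simp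
qed

text \<open>\<open>weak_gradient\<close> picks some representative for each function separately, so
  it is linear only almost everywhere, through uniqueness.\<close>

lemma sym_gradient_diff:
  assumes v: "v \<in> X_space n \<Omega>" and u: "u \<in> X_space n \<Omega>"
  shows "AE x in dx. sym_gradient \<Omega> v x - sym_gradient \<Omega> u x = sym_gradient \<Omega> (\<lambda>y. v y - u y) x"
proof -
  obtain G where G: "v \<in> Lp (real n + 1) \<Omega>" "G \<in> Lp (real n + 1) \<Omega>" "has_weak_gradient \<Omega> v G"
    "AE x in dx. sym_gradient \<Omega> v x = sym_part (G x)"
    by (rule X_space_gradient[OF v])
  obtain H where H: "u \<in> Lp (real n + 1) \<Omega>" "H \<in> Lp (real n + 1) \<Omega>" "has_weak_gradient \<Omega> u H"
    "AE x in dx. sym_gradient \<Omega> u x = sym_part (H x)"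
    by (rule X_space_gradient[OF u])
  have D: "has_weak_gradient \<Omega> (\<lambda>x. v x - u x) (\<lambda>x. G x - H x)"
    using G H by (intro has_weak_gradient_diff Lp_integrable[OF lmeasurable_domain]) auto
  have "AE x in dx. weak_gradient \<Omega> (\<lambda>x. v x - u x) x = G x - H x"
    by (rule weak_gradient_unique[OF open_domain weak_gradient_has[OF D] D])
  with G(4) H(4) show ?thesis
    by eventually_elim (simp add: sym_gradient_eq linear_diff[OF linear_sym_part])
qed

lemma X_disc_sym_gradient:
  assumes v: "v \<in> X_disc \<Omega> \<T>"
  obtains S where "mesh_constant \<T> S" "AE x in dx. sym_gradient \<Omega> v x = S x"
proof -
  obtain G B C \<phi> where G: "G \<in> borel_measurable borel" "\<And>x. norm (G x) \<le> B" "has_weak_gradient \<Omega> v G"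
    and K: "\<And>K. K \<in> \<T> \<Longrightarrow> \<exists>A. \<forall>x\<in>interior K. G x = A"
    and "\<And>k. test_function \<Omega> (\<phi> k)" "\<And>k x. norm (jacobian (\<phi> k) (at x)) \<le> B"
      "AE x in dx. \<forall>\<^sub>F k in sequentially. jacobian (\<phi> k) (at x) = G x"
      "\<And>k x. x \<in> \<Omega> \<Longrightarrow> norm (\<phi> k x - v x) \<le> C / real (Suc k)"
    by (rule X_disc_approximation[OF v]) blast
  have "mesh_constant \<T> G" using K by (simp add: mesh_constant_def)
  then have "mesh_constant \<T> (\<lambda>x. sym_part (G x))"
    by (intro mesh_constant_compose[of \<T> G G "\<lambda>x _. sym_part x"])
  moreover have "AE x in dx. weak_gradient \<Omega> v x = G x"
    by (rule weak_gradient_unique[OF open_domain weak_gradient_has[OF G(3)] G(3)])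
  then have "AE x in dx. sym_gradient \<Omega> v x = sym_part (G x)"
    by eventually_elim (simp add: sym_gradient_eq)
  ultimately show ?thesis by (rule that)
qed

end

section \<open>The error estimate\<close>

text \<open>Here \<open>c\<close> is the coercivity constant of the operator and \<open>B\<close> its Hoelder constant. Each of the two
  applications of Young's inequality spends \<open>c / 4\<close> of the coercivity.\<close>

definition error_constant :: "real \<Rightarrow> real \<Rightarrow> nat \<Rightarrow> real \<Rightarrow> real \<Rightarrow> real" where
  "error_constant d \<Lambda> n M K =
     (let c = (1 / real n)\<^sup>2 / (2 * M); B = (d\<^sup>2 + 1) * (2 + \<Lambda>) * (2 * M)
      in K ^ nat \<lceil>1 / (c / 4)\<rceil> + K ^ nat \<lceil>B / (c / 4)\<rceil>)"

lemma error_constant_pos: "K > 2 \<Longrightarrow> 0 < error_constant d \<Lambda> n M K"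
  by (simp add: error_constant_def Let_def add_pos_pos)

text \<open>The regularizing part supplies the whole coercivity; the material part is merely
  monotone. For n = 1 the weight has exponent zero and Phi is the square, so any M >= 1 is
  admissible without a bound on \<open>S\<close>.\<close>

lemma operator_monotone:
  fixes R S :: "real ^ 'd ^ 'd"
  assumes n: "n \<ge> 1" and mat: "material_functions lam mu" and M: "M \<ge> 1" and S: "n = 1 \<or> norm S \<le> M"
  shows "(1 / real n)\<^sup>2 / (2 * M) * Phi n (norm (R - S)) \<le>
    ((tensor_a n R + tensor_c lam mu R) - (tensor_a n S + tensor_c lam mu S)) \<bullet> (R - S)"
proof -
  have "Phi n (norm (R - S)) / (2 * M) \<le> (norm (R - S))\<^sup>2 / (norm R + norm S) powr (1 - 1 / real n)"
  proof (cases "n = 1")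
    case True
    have "Phi n (norm (R - S)) / (2 * M) \<le> (norm (R - S))\<^sup>2 / 1"
      unfolding True Phi_1[OF norm_ge_zero] using M by (intro divide_left_mono) auto
    also have "\<dots> \<le> (norm (R - S))\<^sup>2 / (norm R + norm S) powr (1 - 1 / real n)"
    \<comment> \<open>\<open>0 powr 0\<close> is 0, so the weight is 1 only if the tensors do not
      both vanish.\<close>
    proof (cases "norm R + norm S = 0")
      case True
      then have "R = 0" "S = 0" by (auto simp: add_nonneg_eq_0_iff)
      then show ?thesis by simp
    qed (use True in simp)
    finally show ?thesis .
  next
    case False
    then show ?thesis using S by (intro Phi_le_quotient n M) auto
  qed
  then have "(1 / real n)\<^sup>2 * (Phi n (norm (R - S)) / (2 * M)) \<le>
      (1 / real n)\<^sup>2 * ((norm (R - S))\<^sup>2 / (norm R + norm S) powr (1 - 1 / real n))"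
    by (rule mult_left_mono) simp
  also have "\<dots> \<le> (tensor_a n R - tensor_a n S) \<bullet> (R - S)" by (rule tensor_a_strongly_monotone[OF n])
  also have "\<dots> \<le> (tensor_a n R - tensor_a n S) \<bullet> (R - S) + (tensor_c lam mu R - tensor_c lam mu S) \<bullet> (R - S)"
    using tensor_c_monotone[OF mat, of R S] by simp
  also have "\<dots> = ((tensor_a n R + tensor_c lam mu R) - (tensor_a n S + tensor_c lam mu S)) \<bullet> (R - S)"
    by (simp add: inner_diff_left inner_add_left)
  finally show ?thesis by simp
qed

text \<open>Lowers an exponent. Below 1 this is free; since \<open>D\<close> may reach 2 M, it costs
  a factor (2 M)^(x - m) <= 2 M.\<close>

lemma powr_le_bounded:
  fixes D :: real
  assumes D: "0 \<le> D" "D \<le> 2 * M" and M: "M \<ge> 1" and m: "0 < m" "m \<le> x" "x \<le> 1"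
  shows "D powr x \<le> 2 * M * D powr m"
proof -
  have "D powr x = D powr (x - m) * D powr m" by (simp flip: powr_add)
  also have "D powr (x - m) \<le> (2 * M) powr (x - m)" using D m by (intro powr_mono2) auto
  also have "(2 * M) powr (x - m) \<le> (2 * M) powr 1" using M m by (intro powr_mono) auto
  also have "\<dots> = 2 * M" using M by simp
  finally show ?thesis by (simp add: mult_right_mono)
qed

context mesh_domain
begin

text \<open>Comparison with the value at zero turns the Hoelder bound into at most linear growth, so
  integrability of \<open>T\<close> is inherited. Paired with a bounded \<open>E\<close>, the
  operator can then be split freely under the integral.\<close>

lemma tensor_a_integrable:
  fixes T :: "real ^ 'd \<Rightarrow> real ^ 'd ^ 'd"
  assumes n: "n \<ge> 1" and T: "integrable (dx) T"
  shows "integrable (dx) (\<lambda>x. tensor_a n (T x))"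
proof (rule Bochner_Integration.integrable_bound)
  define c where "c = 2 * ((real CARD('d))\<^sup>2 + 1)"
  show "integrable (dx) (\<lambda>x. c * (1 + norm (T x)))" using T by simp
  show "(\<lambda>x. tensor_a n (T x)) \<in> borel_measurable (dx)"
    using measurable_compose[OF borel_measurable_integrable[OF T] borel_measurable_continuous_onI[OF continuous_tensor_a[OF n]]] .
  show "AE x in dx. norm (tensor_a n (T x)) \<le> norm (c * (1 + norm (T x)))"
  proof (intro AE_I2)
    fix x
    have "norm (tensor_a n (T x)) \<le> c * norm (T x) powr (1 / real n)"
      using tensor_a_hoelder[OF n, of "T x" 0] by (simp add: c_def)
    also have "\<dots> \<le> c * (1 + norm (T x) powr 1)"
      using n by (intro mult_left_mono powr_le_one_plus) (auto simp: c_def)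
    finally show "norm (tensor_a n (T x)) \<le> norm (c * (1 + norm (T x)))" by simp
  qed
qed

lemma tensor_c_integrable:
  fixes T :: "real ^ 'd \<Rightarrow> real ^ 'd ^ 'd"
  assumes mat: "material_functions lam mu" and h: "hoelder_material \<Lambda> \<beta> lam mu TYPE('d)"
    and \<beta>: "0 < \<beta>" "\<beta> \<le> 1" and \<Lambda>: "\<Lambda> > 0"
    and T: "integrable (dx) T" and sym: "AE x in dx. sym_tensor (T x)"
  shows "integrable (dx) (\<lambda>x. tensor_c lam mu (T x))"
proof (rule Bochner_Integration.integrable_bound)
  define c where "c = ((real CARD('d))\<^sup>2 + 1) * \<Lambda>"
  have c: "c \<ge> 0" using \<Lambda> by (simp add: c_def)
  show "integrable (dx) (\<lambda>x. c * (1 + norm (T x)))" using T by simp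
  show "(\<lambda>x. tensor_c lam mu (T x)) \<in> borel_measurable (dx)"
    using measurable_compose[OF borel_measurable_integrable[OF T] borel_measurable_continuous_onI[OF continuous_tensor_c[OF mat]]] .
  show "AE x in dx. norm (tensor_c lam mu (T x)) \<le> norm (c * (1 + norm (T x)))"
    using sym
  proof eventually_elim
    case (elim x)
    have "norm (tensor_c lam mu (T x)) \<le> c * norm (T x) powr \<beta>"
      using tensor_c_hoelder[OF h \<beta> \<Lambda> elim sym_tensor_0] by (simp add: c_def)
    also have "\<dots> \<le> c * (1 + norm (T x) powr 1)"
      using \<beta> c by (intro mult_left_mono powr_le_one_plus) auto
    finally show ?case using c by simp
  qed
qed

text \<open>The comparison function \<open>v\<close> is fixed here and the infimum taken afterwards.
  \<open>M\<close> stands for the bound of the exact stress, or any number at least 1 when n =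
  1.\<close>

lemma error_estimate:
  fixes T T\<^sub>h F :: "real ^ 'd \<Rightarrow> real ^ 'd ^ 'd"
  assumes n: "n \<ge> 1" and mat: "material_functions lam mu" and h: "hoelder_material \<Lambda> \<beta> lam mu TYPE('d)"
    and \<beta>: "0 < \<beta>" "\<beta> \<le> 1" and \<Lambda>: "\<Lambda> > 0"
    and K: "K > 2" and dbl: "\<forall>s \<ge> 0. Phi_conj n (2 * s) \<le> K * Phi_conj n s"
    and sol: "solves_R n lam mu \<Omega> F T u" and sol\<^sub>h: "solves_R_disc n lam mu \<Omega> F \<T> T\<^sub>h u\<^sub>h"
    and M: "M \<ge> 1" and bd: "n \<ge> 2 \<Longrightarrow> AE x in dx. norm (T x) \<le> M"
    and v: "v \<in> X_disc \<Omega> \<T>"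
  shows "(LINT x|dx. Phi n (norm (T\<^sub>h x - mesh_mean \<T> T x))) \<le>
    error_constant (real CARD('d)) \<Lambda> n M K *
      ((LINT x|dx. Phi_conj n (norm (sym_gradient \<Omega> (\<lambda>y. v y - u y) x)))
       + (LINT x|dx. Phi_conj n (norm (T x - mesh_mean \<T> T x) powr min \<beta> (1 / real n))))"
proof -
  let ?I = "\<lambda>f :: real ^ 'd \<Rightarrow> real. LINT x|dx. f x"
  define P where "P = mesh_mean \<T> T"
  define E where "E x = T\<^sub>h x - P x" for x
  define A where "A S = tensor_a n S + tensor_c lam mu S" for S :: "real ^ 'd ^ 'd"
  define m where "m = min \<beta> (1 / real n)"
  define D where "D x = norm (T x - P x)" for x
  define p where "p = 1 + 1 / real n"
  have p: "p \<ge> 1" by (simp add: p_def)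
  have m: "0 < m" "m \<le> \<beta>" "m \<le> 1 / real n" using \<beta> n by (auto simp: m_def)
  have u: "u \<in> X_space n \<Omega>" and TM: "T \<in> M_space n \<Omega>"
    and eq1: "\<And>S. S \<in> M_space n \<Omega> \<Longrightarrow> form_a n \<Omega> T S + form_c lam mu \<Omega> T T S - form_b \<Omega> S u = 0"
    and eq2: "\<And>v. v \<in> X_space n \<Omega> \<Longrightarrow> form_b \<Omega> T v = (LINT x|dx. F x \<bullet> sym_gradient \<Omega> v x)"
    using sol by (auto simp: solves_R_def solves_def)
  have uh: "u\<^sub>h \<in> X_disc \<Omega> \<T>" and ThM: "T\<^sub>h \<in> M_disc \<T>"
    and eq1h: "\<And>S. S \<in> M_disc \<T> \<Longrightarrow> form_a n \<Omega> T\<^sub>h S + form_c lam mu \<Omega> T\<^sub>h T\<^sub>h S - form_b \<Omega> S u\<^sub>h = 0"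
    and eq2h: "\<And>v. v \<in> X_disc \<Omega> \<T> \<Longrightarrow> form_b \<Omega> T\<^sub>h v = (LINT x|dx. F x \<bullet> sym_gradient \<Omega> v x)"
    using sol\<^sub>h by (auto simp: solves_R_disc_def solves_def)
  have TLp: "T \<in> Lp p \<Omega>" and Tsym: "AE x in dx. sym_tensor (T x)"
    using TM by (auto simp: M_space_def p_def)
  have Tint: "integrable (dx) T" by (rule Lp_integrable[OF lmeasurable_domain TLp p])
  have Thc: "mesh_constant \<T> T\<^sub>h" using ThM unfolding M_disc_def mesh_constant_def by blast
  have Pc: "mesh_constant \<T> P" unfolding P_def by (rule mesh_constant_mean)
  have Ec: "mesh_constant \<T> E" unfolding E_def by (rule mesh_constant_compose[OF Thc Pc])
  have Thsym: "sym_tensor (T\<^sub>h x)" if "K \<in> \<T>" "x \<in> interior K" for K x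
    using ThM that unfolding M_disc_def by auto
  have Psym: "sym_tensor (P x)" if "K \<in> \<T>" "x \<in> interior K" for K x
    unfolding P_def by (rule sym_tensor_mesh_mean[OF Tint Tsym that])
  have AEsym: "AE x in dx. sym_tensor (T\<^sub>h x) \<and> sym_tensor (P x)"
    using AE_cell by eventually_elim (use Thsym Psym in blast)
  then have Thsym': "AE x in dx. sym_tensor (T\<^sub>h x)" and Psym': "AE x in dx. sym_tensor (P x)"
    by auto
  \<comment> \<open>\<open>E\<close> has to be a test tensor in the discrete and in the continuous
    problem, so symmetry is needed for the elementwise mean as well.\<close>
  have ED: "E \<in> M_disc \<T>"
    unfolding M_disc_def
  proof (clarify)
    fix K assume K: "K \<in> \<T>"
    obtain x where x: "x \<in> interior K" using mesh_cell(3)[OF K] by blast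
    have "sym_tensor (E x)" unfolding E_def by (intro sym_tensor_diff Thsym[OF K x] Psym[OF K x])
    moreover obtain B where "\<forall>y\<in>interior K. E y = B" using Ec K unfolding mesh_constant_def by blast
    ultimately show "\<exists>B. sym_tensor B \<and> (\<forall>x\<in>interior K. E x = B)" using x by metis
  qed
  have EM: "E \<in> M_space n \<Omega>"
  proof -
    have "E \<in> Lp p \<Omega>" using p by (intro mesh_constant_Lp Ec) auto
    moreover have "AE x in dx. sym_tensor (E x)"
      using AEsym by eventually_elim (simp add: E_def sym_tensor_diff)
    ultimately show ?thesis by (simp add: M_space_def p_def)
  qed
  note Thint = mesh_constant_integrable[OF Thc] and Pint = mesh_constant_integrable[OF Pc]
  note int = integrable_inner_mesh_constant[OF _ Ec]
  have Aint: "integrable (dx) (\<lambda>x. tensor_a n (S x) \<bullet> E x)" "integrable (dx) (\<lambda>x. tensor_c lam mu (S x) \<bullet> E x)"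
    if "integrable (dx) S" "AE x in dx. sym_tensor (S x)" for S
    using tensor_a_integrable[OF n that(1)] tensor_c_integrable[OF mat h \<beta> \<Lambda> that] by (auto intro: int)
  have AE_int: "integrable (dx) (\<lambda>x. A (S x) \<bullet> E x)"
    if "integrable (dx) S" "AE x in dx. sym_tensor (S x)" for S
    using Aint[OF that] by (simp add: A_def inner_add_left)
  have A_form: "form_a n \<Omega> S E + form_c lam mu \<Omega> S S E = ?I (\<lambda>x. A (S x) \<bullet> E x)"
    if "integrable (dx) S" "AE x in dx. sym_tensor (S x)" for S
    using Aint[OF that] by (simp add: form_a_eq form_c_eq A_def inner_add_left)
  \<comment> \<open>Both stresses have the same load on discrete displacements, and against an
    elementwise constant strain T may be exchanged for its mean. It is used for \<open>v\<close> and
    for \<open>u\<^sub>h\<close>.\<close>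
  have orth: "?I (\<lambda>x. E x \<bullet> sym_gradient \<Omega> w x) = 0" if w: "w \<in> X_disc \<Omega> \<T>" for w
  proof -
    obtain S where S: "mesh_constant \<T> S" "AE x in dx. sym_gradient \<Omega> w x = S x"
      by (rule X_disc_sym_gradient[OF w])
    have repl: "?I (\<lambda>x. R x \<bullet> sym_gradient \<Omega> w x) = ?I (\<lambda>x. R x \<bullet> S x)" if "integrable (dx) R" for R
    proof (rule lebesgue_on_AE_eq_integral(2)[OF sets_domain integrable_inner_mesh_constant[OF that S(1)]])
      show "AE x in dx. R x \<bullet> S x = R x \<bullet> sym_gradient \<Omega> w x" using S(2) by eventually_elim simp
    qed
    have "?I (\<lambda>x. T\<^sub>h x \<bullet> sym_gradient \<Omega> w x) = ?I (\<lambda>x. T x \<bullet> sym_gradient \<Omega> w x)"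
      using eq2h[OF w] eq2[OF X_disc_X_space[OF w]] by (simp add: form_b_def)
    then have 1: "?I (\<lambda>x. T\<^sub>h x \<bullet> S x) = ?I (\<lambda>x. T x \<bullet> S x)" by (simp only: repl[OF Thint] repl[OF Tint])
    have "?I (\<lambda>x. (T x - P x) \<bullet> S x) = 0" unfolding P_def by (rule integral_diff_mean[OF Tint S(1)])
    then have 2: "?I (\<lambda>x. T x \<bullet> S x) = ?I (\<lambda>x. P x \<bullet> S x)"
      using integrable_inner_mesh_constant[OF Tint S(1)] integrable_inner_mesh_constant[OF Pint S(1)]
      by (simp add: inner_diff_left)
    have "?I (\<lambda>x. E x \<bullet> sym_gradient \<Omega> w x) = ?I (\<lambda>x. E x \<bullet> S x)" by (rule repl[OF mesh_constant_integrable[OF Ec]])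
    also have "\<dots> = ?I (\<lambda>x. T\<^sub>h x \<bullet> S x) - ?I (\<lambda>x. P x \<bullet> S x)"
      unfolding E_def inner_diff_left
      by (rule Bochner_Integration.integral_diff[OF integrable_inner_mesh_constant[OF Thint S(1)] integrable_inner_mesh_constant[OF Pint S(1)]])
    finally show ?thesis using 1 2 by simp
  qed
  define e where "e = sym_gradient \<Omega> (\<lambda>y. v y - u y)"
  have vX: "v \<in> X_space n \<Omega>" by (rule X_disc_X_space[OF v])
  have gint: "integrable (dx) (sym_gradient \<Omega> w)" if "w \<in> X_space n \<Omega>" for w
    by (rule Lp_integrable[OF lmeasurable_domain sym_gradient_Lp[OF that]]) simp
  have e_eq: "AE x in dx. sym_gradient \<Omega> v x - sym_gradient \<Omega> u x = e x"
    unfolding e_def by (rule sym_gradient_diff[OF vX u])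
  have eLp: "e \<in> Lp (real n + 1) \<Omega>"
    by (rule Lp_AE_eq[OF sets_domain Lp_diff[OF sym_gradient_Lp[OF vX] sym_gradient_Lp[OF u]] e_eq]) simp
  have eint: "integrable (dx) e" by (rule Lp_integrable[OF lmeasurable_domain eLp]) simp
  have eE: "?I (\<lambda>x. e x \<bullet> E x) = - ?I (\<lambda>x. sym_gradient \<Omega> u x \<bullet> E x)"
  proof -
    have "?I (\<lambda>x. e x \<bullet> E x) = ?I (\<lambda>x. (sym_gradient \<Omega> v x - sym_gradient \<Omega> u x) \<bullet> E x)"
    proof (rule lebesgue_on_AE_eq_integral(2)[OF sets_domain int])
      show "integrable (dx) (\<lambda>x. sym_gradient \<Omega> v x - sym_gradient \<Omega> u x)"
        using gint[OF vX] gint[OF u] by simp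
      show "AE x in dx. (sym_gradient \<Omega> v x - sym_gradient \<Omega> u x) \<bullet> E x = e x \<bullet> E x"
        using e_eq by eventually_elim simp
    qed
    also have "\<dots> = ?I (\<lambda>x. sym_gradient \<Omega> v x \<bullet> E x) - ?I (\<lambda>x. sym_gradient \<Omega> u x \<bullet> E x)"
      unfolding inner_diff_left by (intro Bochner_Integration.integral_diff int gint vX u)
    finally show ?thesis using orth[OF v] by (simp add: inner_commute)
  qed
  have AT: "?I (\<lambda>x. A (T x) \<bullet> E x) = ?I (\<lambda>x. sym_gradient \<Omega> u x \<bullet> E x)"
    using eq1[OF EM] A_form[OF Tint Tsym] by (simp add: form_b_def inner_commute)
  have ATh: "?I (\<lambda>x. A (T\<^sub>h x) \<bullet> E x) = 0"
    using eq1h[OF ED] A_form[OF Thint Thsym'] orth[OF uh] by (simp add: form_b_def)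
  note iT = AE_int[OF Tint Tsym] and iTh = AE_int[OF Thint Thsym'] and iP = AE_int[OF Pint Psym']
  have key: "?I (\<lambda>x. (A (T\<^sub>h x) - A (P x)) \<bullet> E x) = ?I (\<lambda>x. (A (T x) - A (P x)) \<bullet> E x) + ?I (\<lambda>x. e x \<bullet> E x)"
    using iT iTh iP by (simp add: inner_diff_left AT ATh eE)
  \<comment> \<open>Averaging preserves the bound, and the mean is the argument for which
    \<open>operator_monotone\<close> requires it.\<close>
  have Pbd: "AE x in dx. n = 1 \<or> norm (P x) \<le> M"
  proof (cases "n = 1")
    case False
    then have "AE x in dx. norm (P x) \<le> M"
      unfolding P_def using n by (intro norm_mesh_mean_le[OF Tint] bd) simp
    then show ?thesis by eventually_elim simp
  qed simp
  define c where "c = (1 / real n)\<^sup>2 / (2 * M)"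
  have c: "c > 0" using n M by (simp add: c_def)
  \<comment> \<open>The Hoelder constants of the two operators add up to 2 + \<Lambda> times the
    dimensional factor; 2 M pays for lowering their exponents to \<open>m\<close>.\<close>
  define B where "B = ((real CARD('d))\<^sup>2 + 1) * (2 + \<Lambda>) * (2 * M)"
  have B: "B \<ge> 0" using M \<Lambda> by (simp add: B_def)
  have DLp: "(\<lambda>x. T x - P x) \<in> Lp p \<Omega>"
    using p by (intro Lp_diff TLp mesh_constant_Lp Pc) auto
  have [measurable]: "E \<in> borel_measurable (dx)" by (rule mesh_constant_measurable[OF Ec])
  have DmLp: "(\<lambda>x. D x powr m) \<in> Lp (real n + 1) \<Omega>"
  proof -
    have [measurable]: "D \<in> borel_measurable (dx)" using DLp unfolding D_def Lp_def by auto
    \<comment> \<open>Here m <= 1/n is used: raised to the power n + 1, the consistency term needs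
      no more integrability than T has.\<close>
    have le: "m * (real n + 1) \<le> p"
    proof -
      have "m * (real n + 1) \<le> 1 / real n * (real n + 1)" using m(3) by (intro mult_right_mono) auto
      also have "\<dots> = p" using n by (simp add: p_def field_simps)
      finally show ?thesis .
    qed
    have "integrable (dx) (\<lambda>x. norm (D x powr m) powr (real n + 1))"
    proof (rule Bochner_Integration.integrable_bound)
      show "integrable (dx) (\<lambda>x. 1 + D x powr p)" using DLp by (simp add: Lp_def D_def)
      show "AE x in dx. norm (norm (D x powr m) powr (real n + 1)) \<le> norm (1 + D x powr p)"
      proof (intro AE_I2)
        fix x
        have "norm (D x powr m) powr (real n + 1) = D x powr (m * (real n + 1))" by (simp add: powr_powr)
        also have "\<dots> \<le> 1 + D x powr p" using le m by (intro powr_le_one_plus) (auto simp: D_def)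
        finally show "norm (norm (D x powr m) powr (real n + 1)) \<le> norm (1 + D x powr p)" by simp
      qed
    qed measurable
    then show ?thesis by (simp add: Lp_def)
  qed
  have iDE: "integrable (dx) (\<lambda>x. B * (norm (E x) * D x powr m))"
  proof -
    have i: "integrable (dx) (\<lambda>x. D x powr m)"
      by (rule Lp_integrable[OF lmeasurable_domain DmLp]) simp
    have "mesh_constant \<T> (\<lambda>x. norm (E x))"
      by (rule mesh_constant_compose[OF Ec Ec, of "\<lambda>a _. norm a"])
    from integrable_inner_mesh_constant[OF i this] show ?thesis by (simp add: mult.commute)
  qed
  have consist: "?I (\<lambda>x. (A (T x) - A (P x)) \<bullet> E x) \<le> ?I (\<lambda>x. B * (norm (E x) * D x powr m))"
  proof (cases "n = 1")
    case True
    \<comment> \<open>For n = 1 the operator is linear, so its adjoint can be moved onto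
      \<open>E\<close>, which stays elementwise constant and is therefore orthogonal to T minus its
      mean.\<close>
    have "?I (\<lambda>x. (tensor_a n (T x) - tensor_a n (P x)) \<bullet> E x) = 0"
    proof -
      have lin: "linear (tensor_a n :: real ^ 'd ^ 'd \<Rightarrow> _)"
        unfolding True tensor_a_1
        by (intro linearI) (simp_all add: linear_add[OF linear_dev] linear_add[OF linear_trace]
          linear_scale[OF linear_dev] linear_scale[OF linear_trace] algebra_simps)
      have "(tensor_a n (T x) - tensor_a n (P x)) \<bullet> E x = (T x - P x) \<bullet> adjoint (tensor_a n) (E x)" for x
        using adjoint_works[OF lin, of "T x - P x" "E x"] by (simp add: linear_diff[OF lin])
      moreover have "mesh_constant \<T> (\<lambda>x. adjoint (tensor_a n) (E x))"
        by (rule mesh_constant_compose[OF Ec Ec, of "\<lambda>a _. adjoint (tensor_a n) a"])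
      ultimately show ?thesis using integral_diff_mean[OF Tint] by (simp add: P_def)
    qed
    then have "?I (\<lambda>x. (A (T x) - A (P x)) \<bullet> E x) = ?I (\<lambda>x. (tensor_c lam mu (T x) - tensor_c lam mu (P x)) \<bullet> E x)"
      using Aint[OF Tint Tsym] Aint[OF Pint Psym'] by (simp add: A_def inner_diff_left inner_add_left)
    also have "\<dots> \<le> ?I (\<lambda>x. B * (norm (E x) * D x powr m))"
    proof (rule integral_mono_AE[OF _ iDE])
      show "integrable (dx) (\<lambda>x. (tensor_c lam mu (T x) - tensor_c lam mu (P x)) \<bullet> E x)"
        using Aint[OF Tint Tsym] Aint[OF Pint Psym'] by (simp add: inner_diff_left)
      show "AE x in dx. (tensor_c lam mu (T x) - tensor_c lam mu (P x)) \<bullet> E x \<le> B * (norm (E x) * D x powr m)"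
        using Tsym Psym'
      proof eventually_elim
        case (elim x)
        \<comment> \<open>As 1/n = 1 here, the exponent of the material operator is already
          \<open>m\<close>; nothing has to be lowered, and no bound on T enters.\<close>
        have m\<beta>: "m = \<beta>" using \<beta> True by (simp add: m_def)
        have "(tensor_c lam mu (T x) - tensor_c lam mu (P x)) \<bullet> E x \<le> norm (tensor_c lam mu (T x) - tensor_c lam mu (P x)) * norm (E x)"
          by (rule norm_cauchy_schwarz)
        also have "\<dots> \<le> (((real CARD('d))\<^sup>2 + 1) * \<Lambda> * D x powr m) * norm (E x)"
          unfolding D_def m\<beta> by (intro mult_right_mono tensor_c_hoelder[OF h \<beta> \<Lambda> elim]) simp
        also have "\<dots> \<le> (B * D x powr m) * norm (E x)"
        proof -
          have "((real CARD('d))\<^sup>2 + 1) * \<Lambda> \<le> ((real CARD('d))\<^sup>2 + 1) * (2 + \<Lambda>) * 1"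
            unfolding mult_1_right by (rule mult_left_mono) auto
          also have "\<dots> \<le> B" unfolding B_def using M \<Lambda> by (intro mult_left_mono) auto
          finally show ?thesis by (intro mult_right_mono) auto
        qed
        finally show ?case by (simp add: mult_ac)
      qed
    qed
    finally show ?thesis .
  next
    case False
    then have n2: "n \<ge> 2" using n by simp
    show ?thesis
    proof (rule integral_mono_AE[OF _ iDE])
      show "integrable (dx) (\<lambda>x. (A (T x) - A (P x)) \<bullet> E x)" using iT iP by (simp add: inner_diff_left)
      show "AE x in dx. (A (T x) - A (P x)) \<bullet> E x \<le> B * (norm (E x) * D x powr m)"
        using Tsym Psym' bd[OF n2] Pbd
      proof eventually_elim
        case (elim x)
        define d where "d = (real CARD('d))\<^sup>2 + 1"
        have d: "d \<ge> 0" by (simp add: d_def)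
        have D2: "0 \<le> D x" "D x \<le> 2 * M"
          using norm_triangle_ineq4[of "T x" "P x"] elim False by (auto simp: D_def)
        have "norm (A (T x) - A (P x)) \<le> norm (tensor_a n (T x) - tensor_a n (P x)) + norm (tensor_c lam mu (T x) - tensor_c lam mu (P x))"
          unfolding A_def add_diff_add by (rule norm_triangle_ineq)
        also have "\<dots> \<le> 2 * d * D x powr (1 / real n) + d * \<Lambda> * D x powr \<beta>"
          unfolding D_def d_def by (intro add_mono tensor_a_hoelder[OF n] tensor_c_hoelder[OF h \<beta> \<Lambda> elim(1,2)])
        also have "\<dots> \<le> 2 * d * (2 * M * D x powr m) + d * \<Lambda> * (2 * M * D x powr m)"
          using powr_le_bounded[OF D2 M m(1,2) \<beta>(2)] powr_le_bounded[OF D2 M m(1,3)] d \<Lambda> n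
          by (intro add_mono mult_left_mono) auto
        also have "\<dots> = B * D x powr m" by (simp add: B_def d_def algebra_simps)
        finally have "norm (A (T x) - A (P x)) * norm (E x) \<le> B * D x powr m * norm (E x)"
          by (intro mult_right_mono) auto
        then show ?case using norm_cauchy_schwarz[of "A (T x) - A (P x)" "E x"] by (simp add: mult_ac)
      qed
    qed
  qed
  define \<Psi> where "\<Psi> x = Phi n (norm (E x))" for x
  define X where "X x = Phi_conj n (norm (e x))" for x
  define Y where "Y x = Phi_conj n (D x powr m)" for x
  have i\<Psi>: "integrable (dx) \<Psi>" unfolding \<Psi>_def
    by (rule mesh_constant_integrable[OF mesh_constant_compose[OF Ec Ec, of "\<lambda>a _. Phi n (norm a)"]])
  have iX: "integrable (dx) X" unfolding X_def
    by (rule Phi_conj_integrable[OF lmeasurable_domain n]) (use eLp in \<open>auto simp: Lp_def\<close>)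
  have iY: "integrable (dx) Y" unfolding Y_def
    by (rule Phi_conj_integrable[OF lmeasurable_domain n DmLp]) simp
  define k1 where "k1 = K ^ nat \<lceil>1 / (c / 4)\<rceil>"
  define k2 where "k2 = K ^ nat \<lceil>B / (c / 4)\<rceil>"
  have k: "k1 \<ge> 0" "k2 \<ge> 0" using K by (auto simp: k1_def k2_def)
  \<comment> \<open>Needed at the end, where the separate constants of the two terms are replaced by
    their sum.\<close>
  have XY: "0 \<le> ?I X" "0 \<le> ?I Y"
    by (auto intro!: integral_nonneg_AE AE_I2 Phi_conj_nonneg n simp: X_def Y_def)
  have "c * ?I \<Psi> = ?I (\<lambda>x. c * \<Psi> x)" by simp
  also have "\<dots> \<le> ?I (\<lambda>x. (A (T\<^sub>h x) - A (P x)) \<bullet> E x)"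
  proof (rule integral_mono_AE)
    show "integrable (dx) (\<lambda>x. c * \<Psi> x)" using i\<Psi> by simp
    show "integrable (dx) (\<lambda>x. (A (T\<^sub>h x) - A (P x)) \<bullet> E x)" using iTh iP by (simp add: inner_diff_left)
    show "AE x in dx. c * \<Psi> x \<le> (A (T\<^sub>h x) - A (P x)) \<bullet> E x"
      using Pbd by eventually_elim (simp only: c_def \<Psi>_def E_def A_def operator_monotone[OF n mat M])
  qed
  also have "\<dots> \<le> ?I (\<lambda>x. B * (norm (E x) * D x powr m)) + ?I (\<lambda>x. e x \<bullet> E x)"
    unfolding key using consist by simp
  also have "?I (\<lambda>x. B * (norm (E x) * D x powr m)) \<le> ?I (\<lambda>x. c / 4 * \<Psi> x + c / 4 * k2 * Y x)"
  proof (rule integral_mono_AE[OF iDE])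
    show "integrable (dx) (\<lambda>x. c / 4 * \<Psi> x + c / 4 * k2 * Y x)" using i\<Psi> iY by simp
    show "AE x in dx. B * (norm (E x) * D x powr m) \<le> c / 4 * \<Psi> x + c / 4 * k2 * Y x"
      unfolding \<Psi>_def Y_def k2_def using c B by (intro AE_I2 Phi_young[OF n K dbl]) auto
  qed
  also have "?I (\<lambda>x. e x \<bullet> E x) \<le> ?I (\<lambda>x. c / 4 * \<Psi> x + c / 4 * k1 * X x)"
  proof (rule integral_mono_AE[OF int[OF eint]])
    show "integrable (dx) (\<lambda>x. c / 4 * \<Psi> x + c / 4 * k1 * X x)" using i\<Psi> iX by simp
    show "AE x in dx. e x \<bullet> E x \<le> c / 4 * \<Psi> x + c / 4 * k1 * X x"
    proof (intro AE_I2)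
      fix x
      have "e x \<bullet> E x \<le> 1 * (norm (E x) * norm (e x))" using norm_cauchy_schwarz[of "e x" "E x"] by (simp add: mult.commute)
      also have "\<dots> \<le> c / 4 * \<Psi> x + c / 4 * k1 * X x"
        unfolding \<Psi>_def X_def k1_def using c by (intro Phi_young[OF n K dbl]) auto
      finally show "e x \<bullet> E x \<le> c / 4 * \<Psi> x + c / 4 * k1 * X x" .
    qed
  qed
  finally have "c * ?I \<Psi> \<le> (c / 4 * ?I \<Psi> + c / 4 * k2 * ?I Y) + (c / 4 * ?I \<Psi> + c / 4 * k1 * ?I X)"
    using i\<Psi> iX iY by simp
  \<comment> \<open>The two Young terms take c/2 of the coercivity; the factor c/4 in front of the
    remaining terms against the c/2 left over gives the 1/2.\<close>
  then have "c * ?I \<Psi> \<le> c * ((k1 * ?I X + k2 * ?I Y) / 2)" by (simp add: algebra_simps)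
  then have "?I \<Psi> \<le> (k1 * ?I X + k2 * ?I Y) / 2" using c by simp
  also have "\<dots> \<le> (k1 + k2) * (?I X + ?I Y)"
    using mult_nonneg_nonneg[OF k(1) XY(1)] mult_nonneg_nonneg[OF k(1) XY(2)]
      mult_nonneg_nonneg[OF k(2) XY(1)] mult_nonneg_nonneg[OF k(2) XY(2)]
    by (simp add: algebra_simps)
  also have "k1 + k2 = error_constant (real CARD('d)) \<Lambda> n M K"
    by (simp add: error_constant_def Let_def k1_def k2_def c_def B_def)
  finally show ?thesis by (simp add: \<Psi>_def X_def Y_def E_def P_def D_def m_def e_def)
qed

end

lemma Linf_AE_le:
  fixes T :: "'a::euclidean_space \<Rightarrow> 'b::euclidean_space"
  assumes "T \<in> Linf \<Omega>"
  shows "AE x in lebesgue_on \<Omega>. norm (T x) \<le> Linf_norm \<Omega> T"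
proof -
  have fin: "esssup (lebesgue_on \<Omega>) (\<lambda>x. ereal (norm (T x))) < \<infinity>" using assms by (simp add: Linf_def)
  have "AE x in lebesgue_on \<Omega>. ereal (norm (T x)) \<le> esssup (lebesgue_on \<Omega>) (\<lambda>x. ereal (norm (T x)))"
    by (rule esssup_AE)
  then show ?thesis
  proof eventually_elim
    case (elim x)
    \<comment> \<open>Passing to a real number is safe: infinity is excluded by \<open>fin\<close>,
      and minus infinity because it would have to dominate a norm.\<close>
    then show ?case using fin unfolding Linf_norm_def
      by (cases "esssup (lebesgue_on \<Omega>) (\<lambda>x. ereal (norm (T x)))") auto
  qed
qed

theorem theorem5p5:
  assumes dim: "CARD('d::finite) = 2 \<or> CARD('d) = 3"
  shows "\<exists>(C :: real \<Rightarrow> real \<Rightarrow> nat \<Rightarrow> real \<Rightarrow> real \<Rightarrow> real) (C\<^sub>1 :: real \<Rightarrow> real \<Rightarrow> real \<Rightarrow> real).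
    \<forall>(\<Omega> :: (real ^ 'd) set) (n :: nat) F lam mu \<beta> \<Lambda> K T u H \<T> h T\<^sub>h u\<^sub>h.
      admissible_domain \<Omega> \<longrightarrow>
      n \<ge> 1 \<longrightarrow>
      F \<in> M_space n \<Omega> \<longrightarrow>
      material_functions lam mu \<longrightarrow>
      0 < \<beta> \<longrightarrow> \<beta> \<le> 1 \<longrightarrow> \<Lambda> > 0 \<longrightarrow>
      hoelder_material \<Lambda> \<beta> lam mu TYPE('d) \<longrightarrow>
      K > 2 \<longrightarrow> (\<forall>s \<ge> 0. Phi_conj n (2 * s) \<le> K * Phi_conj n s) \<longrightarrow>
      solves_R n lam mu \<Omega> F T u \<longrightarrow>
      (n \<ge> 2 \<longrightarrow> T \<in> Linf \<Omega>) \<longrightarrow>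
      shape_regular_family \<Omega> H \<T> \<longrightarrow> h \<in> H \<longrightarrow>
      solves_R_disc n lam mu \<Omega> F (\<T> h) T\<^sub>h u\<^sub>h \<longrightarrow>
      (LINT x|lebesgue_on \<Omega>. Phi n (norm (T\<^sub>h x - mesh_mean (\<T> h) T x)))
        \<le> (if n = 1 then C\<^sub>1 \<Lambda> \<beta> K else C \<Lambda> \<beta> n (max 1 (Linf_norm \<Omega> T)) K) *
           ((INF v\<in>X_disc \<Omega> (\<T> h).
               LINT x|lebesgue_on \<Omega>. Phi_conj n (norm (sym_gradient \<Omega> (\<lambda>y. v y - u y) x)))
            + (LINT x|lebesgue_on \<Omega>.
                 Phi_conj n (norm (T x - mesh_mean (\<T> h) T x) powr min \<beta> (1 / real n))))"
proof (intro exI[of _ "\<lambda>\<Lambda> \<beta> n M K. error_constant (real CARD('d)) \<Lambda> n M K"]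
    exI[of _ "\<lambda>\<Lambda> \<beta> K. error_constant (real CARD('d)) \<Lambda> 1 1 K"] allI impI)
  fix \<Omega> :: "(real ^ 'd) set" and n :: nat and F lam mu \<beta> \<Lambda> K T u H \<T> h T\<^sub>h u\<^sub>h
  assume adm: "admissible_domain \<Omega>" and n: "n \<ge> 1" and mat: "material_functions lam mu"
    and \<beta>: "0 < \<beta>" "\<beta> \<le> 1" and \<Lambda>: "\<Lambda> > 0" and hm: "hoelder_material \<Lambda> \<beta> lam mu TYPE('d)"
    and K: "K > 2" and dbl: "\<forall>s \<ge> 0. Phi_conj n (2 * s) \<le> K * Phi_conj n s"
    and sol: "solves_R n lam mu \<Omega> F T u" and inf: "n \<ge> 2 \<longrightarrow> T \<in> Linf \<Omega>"
    and reg: "shape_regular_family \<Omega> H \<T>" "h \<in> H"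
    and sol\<^sub>h: "solves_R_disc n lam mu \<Omega> F (\<T> h) T\<^sub>h u\<^sub>h"
  interpret mesh_domain \<Omega> "\<T> h"
    using adm reg negligible_frontier_polyhedral[of \<Omega>]
    by unfold_locales (auto simp: admissible_domain_def shape_regular_family_def)
  \<comment> \<open>With M = 1 for n = 1 the constant becomes independent of T, as the separate
    \<open>C\<^sub>1\<close> demands.\<close>
  define M where "M = (if n = 1 then 1 else max 1 (Linf_norm \<Omega> T))"
  define C where "C = error_constant (real CARD('d)) \<Lambda> n M K"
  have C: "C > 0" unfolding C_def by (rule error_constant_pos[OF K])
  have M: "M \<ge> 1" by (simp add: M_def)
  have bd: "AE x in lebesgue_on \<Omega>. norm (T x) \<le> M" if n2: "n \<ge> 2"
  proof -
    have "AE x in lebesgue_on \<Omega>. norm (T x) \<le> Linf_norm \<Omega> T" using inf n2 by (intro Linf_AE_le) auto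
    then show ?thesis by eventually_elim (use n2 in \<open>simp add: M_def\<close>)
  qed
  let ?L = "LINT x|lebesgue_on \<Omega>. Phi n (norm (T\<^sub>h x - mesh_mean (\<T> h) T x))"
  let ?X = "\<lambda>v. LINT x|lebesgue_on \<Omega>. Phi_conj n (norm (sym_gradient \<Omega> (\<lambda>y. v y - u y) x))"
  let ?Y = "LINT x|lebesgue_on \<Omega>. Phi_conj n (norm (T x - mesh_mean (\<T> h) T x) powr min \<beta> (1 / real n))"
  \<comment> \<open>Solved for the term in \<open>v\<close>, the estimate is a lower bound uniform
    in \<open>v\<close> and passes to the infimum.\<close>
  have est: "?L / C - ?Y \<le> ?X v" if "v \<in> X_disc \<Omega> (\<T> h)" for v
  proof -
    have "?L \<le> C * (?X v + ?Y)" unfolding C_def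
      by (rule error_estimate[OF n mat hm \<beta> \<Lambda> K dbl sol sol\<^sub>h M bd that])
    then show ?thesis using C by (simp add: field_simps)
  qed
  \<comment> \<open>Any element would do: the bound for a real infimum requires a nonempty
    set.\<close>
  have "u\<^sub>h \<in> X_disc \<Omega> (\<T> h)" using sol\<^sub>h by (simp add: solves_R_disc_def solves_def)
  then have "?L / C - ?Y \<le> (INF v\<in>X_disc \<Omega> (\<T> h). ?X v)" by (intro cINF_greatest est) auto
  then have "?L \<le> C * ((INF v\<in>X_disc \<Omega> (\<T> h). ?X v) + ?Y)" using C by (simp add: field_simps)
  moreover have "C = (if n = 1 then error_constant (real CARD('d)) \<Lambda> 1 1 K
      else error_constant (real CARD('d)) \<Lambda> n (max 1 (Linf_norm \<Omega> T)) K)" by (simp add: C_def M_def)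
  ultimately show "?L \<le> (if n = 1 then error_constant (real CARD('d)) \<Lambda> 1 1 K
      else error_constant (real CARD('d)) \<Lambda> n (max 1 (Linf_norm \<Omega> T)) K) * ((INF v\<in>X_disc \<Omega> (\<T> h). ?X v) + ?Y)"
    by (simp only:)
qed

end
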